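(* For any smoothing of the open longray $\mathbb{L}_+$, the positive part $T^+$ of the resulting tangent bundle of $\mathbb{L}_+$ is not contractible, and thus it is not homotopy equivalent to a CW-complex.
   Context: The closed longray $\mathbb{L}_{\ge 0}$ is $\omega_1\times[0,1)$ with the lexicographic order topology, and $\mathbb{L}_+$ is $\mathbb{L}_{\ge 0}$ with its smallest point $0$ removed; it is a (non-metrizable) $1$-manifold. A smoothing of $\mathbb{L}_+$ is a smooth ($C^\infty$) structure on $\mathbb{L}_+$ compatible with its topology. Given a smoothing, $TL^+$ denotes the total space of the tangent bundle of $\mathbb{L}_+$, with bundle projection $\pi:TL^+\to\mathbb{L}_+$; it is a surface. Removing the $0$-section from $TL^+$ disconnects it into two homeomorphic subsurfaces $T^+$ (the positive part, consisting of the positively oriented nonzero tangent vectors) and $T^-$. *)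

theory Defs
  imports "HOL-Analysis.Analysis" "HOL-Library.Countable_Set_Type"
begin

section \<open>The first uncountable ordinal\<close>

text \<open>\<open>cardSuc natLeq\<close> is a well-order of minimal order type among those of cardinality
  \<open>\<aleph>\<^sub>1\<close>; its field, ordered by it, is \<open>\<omega>\<^sub>1\<close>
  (see the two lemmas \<open>uncountable_omega1\<close> and \<open>countable_lessThan_omega1\<close>).\<close>

lemma Card_order_cardSuc_natLeq: "Card_order (cardSuc natLeq)"
  by (simp add: cardSuc_Card_order natLeq_Card_order)

lemma Well_order_cardSuc_natLeq: "Well_order (cardSuc natLeq)"
  using Card_order_cardSuc_natLeq by (simp add: card_order_on_def)

lemma infinite_Field_cardSuc_natLeq: "infinite (Field (cardSuc natLeq))"
  using cardSuc_finite[OF natLeq_Card_order] by (simp add: Field_natLeq)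

typedef omega1 = "Field (cardSuc natLeq)"
  using infinite_Field_cardSuc_natLeq by (metis all_not_in_conv finite.emptyI)

instantiation omega1 :: wellorder
begin

definition less_eq_omega1 :: "omega1 \<Rightarrow> omega1 \<Rightarrow> bool" where
  "less_eq_omega1 a b \<longleftrightarrow> (Rep_omega1 a, Rep_omega1 b) \<in> cardSuc natLeq"

definition less_omega1 :: "omega1 \<Rightarrow> omega1 \<Rightarrow> bool" where
  "less_omega1 a b \<longleftrightarrow> a \<le> b \<and> a \<noteq> b"

instance
proof -
  let ?r = "cardSuc natLeq"
  have wo: "Linear_order ?r" "wf (?r - Id)"
    using Well_order_cardSuc_natLeq by (auto simp: well_order_on_def)
  then have refl: "refl_on (Field ?r) ?r" and tr: "trans ?r" and as: "antisym ?r"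
    and tot: "total_on (Field ?r) ?r"
    by (auto simp: linear_order_on_def partial_order_on_def preorder_on_def)
  show "OFCLASS(omega1, wellorder_class)"
  proof
    fix x y z :: omega1
    show "x \<le> x"
      using refl Rep_omega1 by (auto simp: less_eq_omega1_def refl_on_def)
    show "x \<le> y \<Longrightarrow> y \<le> z \<Longrightarrow> x \<le> z"
      unfolding less_eq_omega1_def by (rule transD[OF tr])
    show "x \<le> y \<Longrightarrow> y \<le> x \<Longrightarrow> x = y"
      using antisymD[OF as, of "Rep_omega1 x" "Rep_omega1 y"]
      by (simp add: less_eq_omega1_def Rep_omega1_inject)
    show "x \<le> y \<or> y \<le> x"
      using tot refl_onD[OF refl Rep_omega1[of x]] Rep_omega1[of x] Rep_omega1[of y]
      by (cases "x = y") (auto simp: less_eq_omega1_def total_on_def Rep_omega1_inject)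
    show "x < y \<longleftrightarrow> x \<le> y \<and> \<not> y \<le> x"
      using antisymD[OF as, of "Rep_omega1 x" "Rep_omega1 y"] refl_onD[OF refl Rep_omega1[of x]]
      by (auto simp: less_omega1_def less_eq_omega1_def Rep_omega1_inject)
  next
    fix P :: "omega1 \<Rightarrow> bool" and a
    assume step: "\<And>x. (\<And>y. y < x \<Longrightarrow> P y) \<Longrightarrow> P x"
    have "wf (inv_image (?r - Id) Rep_omega1)"
      using wo by simp
    then show "P a"
    proof (induction a rule: wf_induct_rule)
      case (less x)
      then show ?case
        by (rule step) (auto simp: less_omega1_def less_eq_omega1_def Rep_omega1_inject)
    qed
  qed
qed

end

lemma uncountable_omega1: "uncountable (UNIV :: omega1 set)"
proof
  include cardinal_syntax
  assume "countable (UNIV :: omega1 set)"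
  then have "countable (Field (cardSuc natLeq))"
    using countable_image[of UNIV Rep_omega1]
    by (simp add: type_definition.Rep_range[OF type_definition_omega1])
  then have "|Field (cardSuc natLeq)| \<le>o natLeq"
    by (simp add: countable_card_le_natLeq)
  then have "cardSuc natLeq \<le>o natLeq"
    using card_of_Field_ordIso[OF Card_order_cardSuc_natLeq] ordIso_ordLeq_trans ordIso_symmetric
    by blast
  then show False
    using cardSuc_greater[OF natLeq_Card_order] not_ordLess_ordLeq by blast
qed

lemma countable_lessThan_omega1: "countable {..<a::omega1}"
proof -
  include cardinal_syntax
  let ?U = "underS (cardSuc natLeq) (Rep_omega1 a)"
  have "|?U| <o cardSuc natLeq"
    using card_of_underS[OF Card_order_cardSuc_natLeq Rep_omega1] .
  then have "|?U| \<le>o natLeq"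
    by (simp add: cardSuc_ordLeq_ordLess card_of_Card_order natLeq_Card_order)
  then have "countable ?U"
    by (simp add: countable_card_le_natLeq)
  moreover have "Rep_omega1 ` {..<a} \<subseteq> ?U"
    by (auto simp: underS_def less_omega1_def less_eq_omega1_def Rep_omega1_inject)
  ultimately have "countable (Rep_omega1 ` {..<a})"
    using countable_subset by blast
  then show ?thesis
    by (rule countable_image_inj_on) (simp add: inj_on_def Rep_omega1_inject)
qed

section \<open>The longray\<close>

text \<open>The closed longray is a separate type, not a set of pairs, because the topology that the
  libraries give to a product type is not the order topology of the lexicographic order.\<close>

typedef longray = "(UNIV :: omega1 set) \<times> {0..<1 :: real}"
  by (rule exI[of _ "(undefined, 0)"]) auto

instantiation longray :: "{linorder, order_bot}"
begin

definition less_eq_longray :: "longray \<Rightarrow> longray \<Rightarrow> bool" where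
  "less_eq_longray x y \<longleftrightarrow>
     fst (Rep_longray x) < fst (Rep_longray y) \<or>
     fst (Rep_longray x) = fst (Rep_longray y) \<and> snd (Rep_longray x) \<le> snd (Rep_longray y)"

definition less_longray :: "longray \<Rightarrow> longray \<Rightarrow> bool" where
  "less_longray x y \<longleftrightarrow> x \<le> y \<and> \<not> y \<le> x"

definition bot_longray :: longray where
  "bot_longray = Abs_longray (LEAST a. True, 0)"

instance
proof
  fix x y z :: longray
  show "x < y \<longleftrightarrow> x \<le> y \<and> \<not> y \<le> x" by (rule less_longray_def)
  show "x \<le> x" by (simp add: less_eq_longray_def)
  show "x \<le> y \<Longrightarrow> y \<le> z \<Longrightarrow> x \<le> z" by (auto simp: less_eq_longray_def)
  show "x \<le> y \<Longrightarrow> y \<le> x \<Longrightarrow> x = y"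
    by (auto simp: less_eq_longray_def Rep_longray_inject[symmetric] prod_eq_iff)
  show "x \<le> y \<or> y \<le> x" by (auto simp: less_eq_longray_def)
  have "Rep_longray bot = (LEAST a. True, 0)"
    by (simp add: bot_longray_def Abs_longray_inverse)
  moreover have "(LEAST a. True) \<le> fst (Rep_longray x)"
    by (rule Least_le) simp
  moreover have "0 \<le> snd (Rep_longray x)"
    using Rep_longray[of x] by auto
  ultimately show "bot \<le> x"
    by (auto simp: less_eq_longray_def)
qed

end

instantiation longray :: linorder_topology
begin

definition open_longray :: "longray set \<Rightarrow> bool" where
  "open_longray = generate_topology (range (\<lambda>a. {..<a}) \<union> range (\<lambda>a. {a<..}))"

instance
  by standard (rule open_longray_def)

end

definition longray_plus :: "longray topology" where
  "longray_plus = top_of_set (- {bot})"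

section \<open>Smooth structures on one-dimensional manifolds\<close>

text \<open>Used for open \<open>S\<close> only, so that every iterated derivative at a point of \<open>S\<close> depends on
  the values of \<open>f\<close> on \<open>S\<close> alone.\<close>

definition real_smooth_on :: "real set \<Rightarrow> (real \<Rightarrow> real) \<Rightarrow> bool" where
  "real_smooth_on S f \<longleftrightarrow> (\<forall>n. \<forall>x\<in>S. (deriv ^^ n) f field_differentiable at x)"

type_synonym 'a chart = "'a set \<times> ('a \<Rightarrow> real)"

text \<open>In a chart \<open>(U, \<phi>)\<close> the values of \<open>\<phi>\<close> outside \<open>U\<close> are irrelevant; a maximal atlas
  contains \<open>(U, \<phi>')\<close> along with \<open>(U, \<phi>)\<close> for every \<open>\<phi>'\<close> that agrees with \<open>\<phi>\<close> on \<open>U\<close>.\<close>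

definition chart_of :: "'a topology \<Rightarrow> 'a chart \<Rightarrow> bool" where
  "chart_of X c \<longleftrightarrow> (case c of (U, \<phi>) \<Rightarrow>
     openin X U \<and> open (\<phi> ` U) \<and> homeomorphic_map (subtopology X U) (top_of_set (\<phi> ` U)) \<phi>)"

definition transition :: "'a chart \<Rightarrow> 'a chart \<Rightarrow> real \<Rightarrow> real" where
  "transition c d = snd d \<circ> inv_into (fst c) (snd c)"

definition smoothly_compatible :: "'a chart \<Rightarrow> 'a chart \<Rightarrow> bool" where
  "smoothly_compatible c d \<longleftrightarrow>
     real_smooth_on (snd c ` (fst c \<inter> fst d)) (transition c d) \<and>
     real_smooth_on (snd d ` (fst c \<inter> fst d)) (transition d c)"

text \<open>A smooth structure is a maximal smooth atlas.\<close>

definition smooth_structure :: "'a topology \<Rightarrow> 'a chart set \<Rightarrow> bool" where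
  "smooth_structure X A \<longleftrightarrow>
     (\<forall>c\<in>A. chart_of X c) \<and>
     (\<Union>c\<in>A. fst c) = topspace X \<and>
     (\<forall>c\<in>A. \<forall>d\<in>A. smoothly_compatible c d) \<and>
     (\<forall>c. chart_of X c \<and> (\<forall>d\<in>A. smoothly_compatible c d) \<longrightarrow> c \<in> A)"

section \<open>The tangent bundle\<close>

definition quotient_topology :: "'a topology \<Rightarrow> ('a \<times> 'a) set \<Rightarrow> 'a set topology" where
  "quotient_topology X r =
     topology (\<lambda>W. W \<subseteq> topspace X // r \<and> openin X {x \<in> topspace X. r `` {x} \<in> W})"

lemma openin_quotient_topology:
  "openin (quotient_topology X r) W \<longleftrightarrow>
     W \<subseteq> topspace X // r \<and> openin X {x \<in> topspace X. r `` {x} \<in> W}"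
proof -
  have "istopology (\<lambda>W. W \<subseteq> topspace X // r \<and> openin X {x \<in> topspace X. r `` {x} \<in> W})"
    unfolding istopology_def
  proof (intro conjI allI impI)
    fix S T
    assume "S \<subseteq> topspace X // r \<and> openin X {x \<in> topspace X. r `` {x} \<in> S}"
      and "T \<subseteq> topspace X // r \<and> openin X {x \<in> topspace X. r `` {x} \<in> T}"
    moreover have "{x \<in> topspace X. r `` {x} \<in> S \<inter> T} =
        {x \<in> topspace X. r `` {x} \<in> S} \<inter> {x \<in> topspace X. r `` {x} \<in> T}" by auto
    ultimately show "S \<inter> T \<subseteq> topspace X // r" "openin X {x \<in> topspace X. r `` {x} \<in> S \<inter> T}"
      by auto
  next
    fix K
    assume K: "\<forall>S\<in>K. S \<subseteq> topspace X // r \<and> openin X {x \<in> topspace X. r `` {x} \<in> S}"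
    have "{x \<in> topspace X. r `` {x} \<in> \<Union>K} = (\<Union>S\<in>K. {x \<in> topspace X. r `` {x} \<in> S})" by auto
    moreover have "openin X (\<Union>S\<in>K. {x \<in> topspace X. r `` {x} \<in> S})"
      using K by (intro openin_Union) auto
    ultimately show "\<Union>K \<subseteq> topspace X // r" "openin X {x \<in> topspace X. r `` {x} \<in> \<Union>K}"
      using K by auto
  qed
  then show ?thesis
    by (simp add: quotient_topology_def topology_inverse')
qed

lemma topspace_quotient_topology: "topspace (quotient_topology X r) = topspace X // r"
proof -
  have "{x \<in> topspace X. r `` {x} \<in> topspace X // r} = topspace X"
    by (auto simp: quotient_def)
  then have "openin (quotient_topology X r) (topspace X // r)"
    by (simp add: openin_quotient_topology)
  then show ?thesis
    by (meson openin_quotient_topology openin_subset openin_topspace subset_antisym)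
qed

text \<open>\<open>(c, x, v)\<close> stands for the tangent vector at \<open>x\<close> whose coordinate in the chart \<open>c\<close> is \<open>v\<close>.
  The tangent bundle is glued from the products \<open>U \<times> \<real>\<close>, one for each chart \<open>(U, \<phi>)\<close>, along the
  derivatives of the transition functions.\<close>

definition tangent_rel :: "'a chart set \<Rightarrow> (('a chart \<times> 'a \<times> real) \<times> ('a chart \<times> 'a \<times> real)) set"
  where "tangent_rel A =
    {((c, x, v), (d, y, w)). c \<in> A \<and> d \<in> A \<and> x = y \<and> x \<in> fst c \<inter> fst d \<and>
       w = deriv (transition c d) (snd c x) * v}"

definition tangent_bundle ::
  "'a topology \<Rightarrow> 'a chart set \<Rightarrow> ('a chart \<times> 'a \<times> real) set topology" where
  "tangent_bundle X A = quotient_topology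
     (sum_topology (\<lambda>c. prod_topology (subtopology X (fst c)) euclideanreal) A)
     (tangent_rel A)"

definition increasing_near :: "'a::linorder topology \<Rightarrow> 'a chart \<Rightarrow> 'a \<Rightarrow> bool" where
  "increasing_near X c x \<longleftrightarrow> (\<exists>N. openin X N \<and> x \<in> N \<and> N \<subseteq> fst c \<and> strict_mono_on N (snd c))"

text \<open>The orientation is the one given by the order of the underlying space: a vector is positive
  if its coordinate is positive in some chart that preserves the order near the base point. A
  maximal atlas has such a chart at every point, and the choice among them does not matter.\<close>

definition positive_vectors ::
  "'a::linorder topology \<Rightarrow> 'a chart set \<Rightarrow> ('a chart \<times> 'a \<times> real) set set" where
  "positive_vectors X A = {\<xi> \<in> topspace (tangent_bundle X A).
     \<exists>c x v. (c, x, v) \<in> \<xi> \<and> increasing_near X c x \<and> v > 0}"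

definition positive_tangent_bundle ::
  "'a::linorder topology \<Rightarrow> 'a chart set \<Rightarrow> ('a chart \<times> 'a \<times> real) set topology" where
  "positive_tangent_bundle X A = subtopology (tangent_bundle X A) (positive_vectors X A)"

section \<open>CW-complexes\<close>

definition closed_disk :: "nat \<Rightarrow> (nat \<Rightarrow> real) topology" where
  "closed_disk n = subtopology (Euclidean_space n) {x. (\<Sum>i<n. (x i)\<^sup>2) \<le> 1}"

definition open_disk :: "nat \<Rightarrow> (nat \<Rightarrow> real) topology" where
  "open_disk n = subtopology (Euclidean_space n) {x. (\<Sum>i<n. (x i)\<^sup>2) < 1}"

text \<open>A characteristic map of the open \<open>n\<close>-cell \<open>e\<close>, where \<open>C m\<close> is the set of open \<open>m\<close>-cells of
  the complex. Closure-finiteness is part of this definition.\<close>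

definition characteristic_map ::
  "'a topology \<Rightarrow> (nat \<Rightarrow> 'a set set) \<Rightarrow> nat \<Rightarrow> 'a set \<Rightarrow> ((nat \<Rightarrow> real) \<Rightarrow> 'a) \<Rightarrow> bool" where
  "characteristic_map X C n e \<Phi> \<longleftrightarrow>
     continuous_map (closed_disk n) X \<Phi> \<and>
     homeomorphic_map (open_disk n) (subtopology X e) \<Phi> \<and>
     (\<exists>F. finite F \<and> F \<subseteq> (\<Union>m<n. C m) \<and>
        \<Phi> ` (topspace (closed_disk n) - topspace (open_disk n)) \<subseteq> \<Union>F)"

definition CW_complex :: "'a topology \<Rightarrow> bool" where
  "CW_complex X \<longleftrightarrow> Hausdorff_space X \<and>
     (\<exists>C :: nat \<Rightarrow> 'a set set.
        \<Union>(\<Union>n. C n) = topspace X \<and>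
        pairwise disjnt (\<Union>n. C n) \<and>
        (\<forall>n. \<forall>e\<in>C n. \<exists>\<Phi>. characteristic_map X C n e \<Phi>) \<and>
        (\<forall>S\<subseteq>topspace X. (\<forall>e\<in>\<Union>n. C n. closedin X (S \<inter> X closure_of e)) \<longrightarrow> closedin X S))"

end

theory Submission
  imports Defs
begin

text \<open>
Composing a contraction of the positive tangent bundle with the projection to the base point gives
maps \<open>G t\<close> to the longray, for \<open>t\<close> in the unit interval, with \<open>G 0\<close> the projection and \<open>G 1\<close>
constant. On the longray itself such a homotopy is impossible, since a continuous map from the
longray to itself either fixes the points of a club or is bounded on one. These two
conditions exclude each other, and each defines a closed set of times \<open>t\<close>, because countable intersections of
clubs are clubs and countable sets are bounded; so the interval, which is connected, would be the
union of two disjoint nonempty closed sets.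

The dichotomy for a single map uses that points climbing to \<open>x\<close> converge to \<open>x\<close>. In the bundle the base
points of a sequence may converge while the vectors escape along the fibres, and there need not be any
long section along which to argue. The way out is to ask whether the dichotomy holds on the full
fibres at every time. If it does, the argument above applies (\<open>dichotomy_impossible\<close>). If it
fails for one map \<open>g\<close>, then for some \<open>\<gamma>\<close> both \<open>g < \<gamma>\<close> and \<open>g > \<gamma>\<close> occur over stationary sets
of base points. By continuity and Fodor's lemma (\<open>pressing_down\<close>) there are sections with values in
these two open sets over intervals with a common left end point \<open>\<delta>\<close> and right end points in
stationary sets. An open subset of the fibre over \<open>\<delta>\<close> has countably many components, so the sections can be
chosen to start in one component for each of the two sets, and since sections of different kinds never
meet, one kind stays on one side of the other for ever. Between them runs a tube of compact intervals (\<open>tube_exists\<close>,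
\<open>tube_between\<close>) in which vectors cannot escape. On the tube the dichotomy holds for every map
(\<open>tube_dichotomy\<close>): otherwise, over the points \<open>x\<close> of a club, there are vectors of ratio arbitrarily close
to 1 of which one is sent to \<open>x\<close> and the other below \<open>x\<close>, and pressing down together with
compactness produces a vector with two different values. So the argument for the longray applies to the tube.

Only the structure of a principal bundle with group the positive reals enters, and this part is
carried out in the locale \<open>longray_line_bundle\<close>. The derivatives of the transition functions
between charts that preserve the order provide the cocycle.

For the second claim, a compact set of positive vectors lies over a compact interval \<open>[x, y]\<close>, and
the part of the bundle over \<open>[x, y]\<close> is contractible, since it can be pushed down chart by chart to
a single fibre (\<open>band_contractible\<close>). A map from a CW-complex to a space with this property is
null-homotopic: the homotopy is built skeleton by skeleton, each time extending a map from the
boundary of a cylinder over a disk, whose image is compact (\<open>CW_complex_null_homotopic\<close>). A homotopy equivalence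
with a CW-complex would therefore make the bundle contractible.
\<close>

section \<open>The longray as a linear continuum\<close>

definition ordl :: "longray \<Rightarrow> omega1" where "ordl x = fst (Rep_longray x)"
definition frc :: "longray \<Rightarrow> real" where "frc x = snd (Rep_longray x)"

lemma frc_bounds: "0 \<le> frc x" "frc x < 1"
  using Rep_longray[of x] by (auto simp: frc_def)

lemma longray_le_iff: "x \<le> y \<longleftrightarrow> ordl x < ordl y \<or> ordl x = ordl y \<and> frc x \<le> frc y"
  by (simp add: less_eq_longray_def ordl_def frc_def)

lemma longray_less_iff: "x < y \<longleftrightarrow> ordl x < ordl y \<or> ordl x = ordl y \<and> frc x < frc y"
  unfolding less_longray_def longray_le_iff by auto

lemma Abs_longray_coords:
  assumes "0 \<le> r" "r < 1"
  shows "ordl (Abs_longray (a, r)) = a" "frc (Abs_longray (a, r)) = r"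
  using assms by (simp_all add: ordl_def frc_def Abs_longray_inverse)

lemma omega1_countable_bounded:
  assumes "countable (B :: omega1 set)"
  obtains a where "\<And>b. b \<in> B \<Longrightarrow> b < a"
proof -
  have "countable (\<Union>b\<in>B. {..b})"
  proof (intro countable_UN assms)
    fix b :: omega1
    have "{..b} = insert b {..<b}" by auto
    then show "countable {..b}" using countable_lessThan_omega1[of b] by simp
  qed
  then have "(\<Union>b\<in>B. {..b}) \<noteq> UNIV"
    using uncountable_omega1 by metis
  then obtain a where "\<And>b. b \<in> B \<Longrightarrow> \<not> a \<le> b" by auto
  then show ?thesis using that by (meson not_le)
qed

lemma longray_countable_bounded:
  assumes "countable (B :: longray set)"
  obtains x where "\<And>b. b \<in> B \<Longrightarrow> b < x"
proof -
  have "countable (ordl ` B)" using assms by simp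
  then obtain a where a: "\<And>b. b \<in> ordl ` B \<Longrightarrow> b < a"
    using omega1_countable_bounded by metis
  show ?thesis
    by (rule that[of "Abs_longray (a, 0)"]) (use a in \<open>auto simp: longray_less_iff Abs_longray_coords\<close>)
qed

text \<open>The first coordinate of the least upper bound is the least one that occurs among the upper
  bounds, and the second is an infimum of real numbers in \<open>[0, 1)\<close>.\<close>

lemma longray_lub_exists:
  assumes "\<And>s. s \<in> S \<Longrightarrow> s \<le> (z :: longray)"
  shows "\<exists>l. (\<forall>s\<in>S. s \<le> l) \<and> (\<forall>u. (\<forall>s\<in>S. s \<le> u) \<longrightarrow> l \<le> u)"
proof -
  define B where "B = {u. \<forall>s\<in>S. s \<le> u}"
  have zB: "z \<in> B" using assms by (simp add: B_def)
  define a where "a = (LEAST a. a \<in> ordl ` B)"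
  have "a \<in> ordl ` B" unfolding a_def by (rule LeastI[of _ "ordl z"]) (use zB in auto)
  then obtain u where u: "u \<in> B" "ordl u = a" by auto
  have least: "a \<le> ordl b" if "b \<in> B" for b
    unfolding a_def by (rule Least_le) (use that in auto)
  define R where "R = frc ` {b \<in> B. ordl b = a}"
  have R: "R \<noteq> {}" "bdd_below R" using u frc_bounds by (auto simp: R_def intro!: bdd_belowI[of _ 0])
  have "Inf R \<le> frc u" using R u by (intro cInf_lower) (auto simp: R_def)
  then have r1: "Inf R < 1" using frc_bounds[of u] by simp
  have r0: "0 \<le> Inf R" using R frc_bounds by (intro cInf_greatest) (auto simp: R_def)
  define l where "l = Abs_longray (a, Inf R)"
  have l: "ordl l = a" "frc l = Inf R" using r0 r1 by (simp_all add: l_def Abs_longray_coords)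
  have "s \<le> l" if s: "s \<in> S" for s
  proof -
    have "s \<le> u" using u s by (auto simp: B_def)
    then have "ordl s \<le> a" using u by (auto simp: longray_le_iff)
    moreover have "frc s \<le> Inf R" if "ordl s = a"
    proof (rule cInf_greatest[OF R(1)])
      fix r assume "r \<in> R"
      then obtain b where "b \<in> B" "ordl b = a" "r = frc b" by (auto simp: R_def)
      then show "frc s \<le> r" using s that by (auto simp: B_def longray_le_iff)
    qed
    ultimately show ?thesis by (auto simp: longray_le_iff l)
  qed
  moreover have "l \<le> b" if "b \<in> B" for b
    using least[OF that] cInf_lower[OF _ R(2), of "frc b"] that
    by (auto simp: longray_le_iff l R_def)
  ultimately show ?thesis by (auto simp: B_def)
qed

text \<open>The longray is a linear continuum, so intervals are connected and the intermediate value theorem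
  holds on it. Only least upper bounds of bounded sets and greatest lower bounds of sets that are
  bounded below matter; the value of \<open>Sup\<close> on an unbounded set is arbitrary.\<close>

instantiation longray :: distrib_lattice
begin

definition inf_longray :: "longray \<Rightarrow> longray \<Rightarrow> longray" where "inf_longray = min"

definition sup_longray :: "longray \<Rightarrow> longray \<Rightarrow> longray" where "sup_longray = max"

instance
  by standard (auto simp: inf_longray_def sup_longray_def max_min_distrib2)

end

instantiation longray :: linear_continuum
begin

definition Sup_longray :: "longray set \<Rightarrow> longray" where
  "Sup_longray S = (SOME l. (\<forall>s\<in>S. s \<le> l) \<and> (\<forall>u. (\<forall>s\<in>S. s \<le> u) \<longrightarrow> l \<le> u))"

definition Inf_longray :: "longray set \<Rightarrow> longray" where
  "Inf_longray S = Sup {l. \<forall>s\<in>S. l \<le> s}"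

instance
proof
  have *: "(\<forall>s\<in>S. s \<le> Sup S) \<and> (\<forall>u. (\<forall>s\<in>S. s \<le> u) \<longrightarrow> Sup S \<le> u)"
    if "\<And>s. s \<in> S \<Longrightarrow> s \<le> z" for S and z :: longray
    unfolding Sup_longray_def by (rule someI_ex) (rule longray_lub_exists[OF that])
  fix x y z :: longray and X :: "longray set"
  show "x \<in> X \<Longrightarrow> bdd_above X \<Longrightarrow> x \<le> Sup X"
    using * unfolding bdd_above_def by blast
  show "X \<noteq> {} \<Longrightarrow> (\<And>x. x \<in> X \<Longrightarrow> x \<le> z) \<Longrightarrow> Sup X \<le> z"
    using * by blast
  show "Inf X \<le> x" if "x \<in> X" "bdd_below X"
    using *[of "{l. \<forall>s\<in>X. l \<le> s}" x] that by (auto simp: Inf_longray_def)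
  show "X \<noteq> {} \<Longrightarrow> (\<And>x. x \<in> X \<Longrightarrow> z \<le> x) \<Longrightarrow> z \<le> Inf X"
    using *[of "{l. \<forall>s\<in>X. l \<le> s}"] unfolding Inf_longray_def by blast
  show "\<exists>z. x < z \<and> z < y" if "x < y"
  proof (cases "ordl x = ordl y")
    case True
    then have "frc x < frc y" using that by (simp add: longray_less_iff)
    then show ?thesis using True frc_bounds[of x] frc_bounds[of y]
      by (intro exI[of _ "Abs_longray (ordl x, (frc x + frc y) / 2)"])
        (auto simp: longray_less_iff Abs_longray_coords)
  next
    case False
    then show ?thesis using that frc_bounds[of x]
      by (intro exI[of _ "Abs_longray (ordl x, (frc x + 1) / 2)"])
        (auto simp: longray_less_iff Abs_longray_coords)
  qed
  have "Abs_longray (undefined, 0) \<noteq> Abs_longray (undefined, 1/2)"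
    
  proof
    assume eq: "Abs_longray (undefined, 0) = Abs_longray (undefined, 1/2 :: real)"
    have "frc (Abs_longray (undefined, 0)) = 0" "frc (Abs_longray (undefined, 1/2)) = 1/2"
      by (simp_all add: Abs_longray_coords)
    then show False unfolding eq by simp
  qed
  then show "\<exists>a b :: longray. a \<noteq> b" by blast
qed

end

instance longray :: linear_continuum_topology ..

instance longray :: no_top
proof
  show "\<exists>y. x < y" for x :: longray
    by (rule longray_countable_bounded[of "{x}"]) auto
qed

text \<open>Initial segments are separable: below \<open>x\<close> there are only countably many points with a rational
  second coordinate.\<close>

lemma longray_countable_dense_below:
  obtains D where "countable D" "\<And>u v. u < v \<Longrightarrow> v \<le> (x :: longray) \<Longrightarrow> \<exists>d\<in>D. u < d \<and> d < v"
proof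
  have eq: "{..ordl x} = insert (ordl x) {..<ordl x}" by auto
  have "countable {..ordl x}" unfolding eq using countable_lessThan_omega1 by simp
  then show "countable (Abs_longray ` ({..ordl x} \<times> \<rat>))"
    by (intro countable_image countable_SIGMA countable_rat)
  fix u v assume uv: "u < v" "v \<le> x"
  then have *: "ordl u \<le> ordl v" "ordl v \<le> ordl x" by (auto simp: longray_less_iff longray_le_iff)
  obtain r where r: "r \<in> \<rat>" "frc u < r" "r < 1" "ordl u = ordl v \<Longrightarrow> r < frc v"
  proof (cases "ordl u = ordl v")
    case True
    then have "frc u < frc v" using uv by (auto simp: longray_less_iff)
    then obtain r where "r \<in> \<rat>" "frc u < r" "r < frc v" using Rats_dense_in_real by blast
    then show ?thesis using that frc_bounds(2)[of v] by auto
  next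
    case False
    obtain r where "r \<in> \<rat>" "frc u < r" "r < 1" using Rats_dense_in_real frc_bounds(2)[of u] by blast
    then show ?thesis using that False by auto
  qed
  have "0 \<le> r" using r frc_bounds(1)[of u] by linarith
  then show "\<exists>d\<in>Abs_longray ` ({..ordl x} \<times> \<rat>). u < d \<and> d < v"
    using r * by (intro bexI[of _ "Abs_longray (ordl u, r)"])
      (auto simp: longray_less_iff Abs_longray_coords)
qed

text \<open>Every point of the longray, limit ordinals included, has countable cofinality, so convergence
  from the left is a matter of sequences.\<close>

lemma longray_limit_sequence:
  fixes x :: longray
  assumes x: "bot < x" and S: "\<And>y. y < x \<Longrightarrow> \<exists>z. z \<in> S \<and> y < z \<and> z < x"
  obtains s where "\<And>n. s n \<in> S" "\<And>n. s n < x" "s \<longlonglongrightarrow> x"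
proof -
  obtain D where D: "countable D" "\<And>u v. u < v \<Longrightarrow> v \<le> x \<Longrightarrow> \<exists>d\<in>D. u < d \<and> d < v"
    using longray_countable_dense_below by metis
  define E where "E = D \<inter> {..<x}"
  have Ec: "countable E" using D(1) by (auto simp: E_def)
  have "E \<noteq> {}" using D(2)[OF x order_refl] by (auto simp: E_def)
  define d where "d = from_nat_into E"
  have d: "d n < x" for n using from_nat_into[OF \<open>E \<noteq> {}\<close>, of n] by (auto simp: d_def E_def)
  have "\<exists>z. z \<in> S \<and> Max (d ` {..n}) < z \<and> z < x" for n
    by (rule S) (use d in \<open>subst Max_less_iff; auto\<close>)
  then obtain s where s: "\<And>n. s n \<in> S \<and> Max (d ` {..n}) < s n \<and> s n < x" by metis
  have "s \<longlonglongrightarrow> x"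
  proof (rule order_tendstoI)
    fix a assume "a < x"
    then obtain e where e: "e \<in> E" "a < e" using D(2)[OF _ order_refl] by (auto simp: E_def)
    then obtain m where m: "e = d m" using from_nat_into_surj[OF Ec] unfolding d_def by metis
    have "a < s n" if "m \<le> n" for n
    proof -
      have "d m \<le> Max (d ` {..n})" using that by (intro Max_ge) auto
      then show ?thesis using e m s[of n] by (meson order_less_trans order_le_less_trans)
    qed
    then show "\<forall>\<^sub>F n in sequentially. a < s n" unfolding eventually_sequentially by blast
  next
    fix a assume "x < a"
    then show "\<forall>\<^sub>F n in sequentially. s n < a" using s by (intro always_eventually) (meson order_less_trans)
  qed
  then show ?thesis using that s by blast
qed

lemma longray_increasing_lub:
  fixes s :: "nat \<Rightarrow> longray"
  assumes "\<And>n. s n < s (Suc n)"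
  obtains x where "\<And>n. s n < x" "\<And>y. y < x \<Longrightarrow> \<exists>n. y < s n"
proof
  obtain z where z: "\<And>b. b \<in> range s \<Longrightarrow> b < z"
    by (rule longray_countable_bounded[of "range s"]) auto
  have bdd: "bdd_above (range s)" by (rule bdd_aboveI[of _ z]) (rule less_imp_le[OF z])
  show "s n < Sup (range s)" for n
    using assms[of n] cSup_upper[OF _ bdd, of "s (Suc n)"] by (meson order_less_le_trans rangeI)
  show "\<exists>n. y < s n" if "y < Sup (range s)" for y
    using that less_cSup_iff[OF _ bdd] by auto
qed

section \<open>Closed unbounded and stationary sets\<close>

text \<open>The role of the ordinal \<open>\<omega>\<^sub>1\<close> is played by the longray itself. Closedness asks only for limits from
  the left: this is what recursion along an increasing sequence produces, and the set of left limits
  of an unbounded set need not be closed under limits from the right.\<close>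

definition club :: "longray set \<Rightarrow> bool" where
  "club C \<longleftrightarrow> (\<forall>x. \<exists>y\<in>C. x < y) \<and>
     (\<forall>x>bot. (\<forall>y<x. \<exists>z\<in>C. y < z \<and> z < x) \<longrightarrow> x \<in> C)"

definition stationary :: "longray set \<Rightarrow> bool" where
  "stationary S \<longleftrightarrow> (\<forall>C. club C \<longrightarrow> (\<exists>x\<in>S. x \<in> C))"

definition limits :: "longray set \<Rightarrow> longray set" where
  "limits S = {x. bot < x \<and> (\<forall>y<x. \<exists>z\<in>S. y < z \<and> z < x)}"

lemma clubI:
  assumes "\<And>x. \<exists>y\<in>C. x < y" "\<And>x. x \<in> limits C \<Longrightarrow> x \<in> C"
  shows "club C"
  unfolding club_def using assms unfolding limits_def by blast

lemma club_unbounded: "club C \<Longrightarrow> \<exists>y\<in>C. x < y"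
  and club_closed: "club C \<Longrightarrow> x \<in> limits C \<Longrightarrow> x \<in> C"
  unfolding club_def limits_def by blast+

text \<open>The recursion behind every unboundedness proof for clubs: a sequence whose consecutive terms
  satisfy a prescribed relation climbs to a point of the longray, since countable sets are bounded.\<close>

lemma longray_sequence_limit:
  fixes x :: longray and Q :: "nat \<Rightarrow> longray \<Rightarrow> longray \<Rightarrow> bool"
  assumes "\<And>n y. \<exists>z>y. Q n y z"
  obtains s y where "x < y" "\<And>n. s n < s (Suc n)" "\<And>n. Q n (s n) (s (Suc n))" "\<And>n. s n < y"
    "\<And>z. z < y \<Longrightarrow> \<exists>n. z < s n"
proof -
  define h where "h n y = (SOME z. y < z \<and> Q n y z)" for n y
  have h: "y < h n y \<and> Q n y (h n y)" for n y
    unfolding h_def using someI_ex[OF assms] .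
  define s where "s = rec_nat x h"
  have s: "s 0 = x" "\<And>n. s (Suc n) = h n (s n)" by (simp_all add: s_def)
  have inc: "s n < s (Suc n)" for n using h s by simp
  obtain y where y: "\<And>n. s n < y" "\<And>z. z < y \<Longrightarrow> \<exists>n. z < s n"
    using longray_increasing_lub[of s, OF inc] by blast
  show ?thesis
  proof (rule that)
    show "x < y" using y(1)[of 0] s(1) by simp
    show "Q n (s n) (s (Suc n))" for n using h s by simp
  qed (use inc y in auto)
qed

lemma bot_less_of_less: "x < y \<Longrightarrow> bot < (y :: longray)"
  using order_le_less_trans[OF bot_least] .

lemma limits_mono: "S \<subseteq> T \<Longrightarrow> limits S \<subseteq> limits T"
  unfolding limits_def by blast

lemma limitsE:
  assumes "x \<in> limits S" "y < x"
  obtains z where "z \<in> S" "y < z" "z < x"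
  using assms unfolding limits_def by blast

lemma increasing_le: "(\<And>n. s n < (s (Suc n) :: longray)) \<Longrightarrow> m \<le> n \<Longrightarrow> s m \<le> s n"
  by (rule lift_Suc_mono_le[of s]) (auto intro: less_imp_le)

lemma club_INT:
  assumes C: "\<And>n::nat. club (C n)"
  shows "club (\<Inter>n. C n)"
proof (rule clubI)
  fix x
  \<comment> \<open>The sequence visits each of the clubs infinitely often, so its limit lies in all of them.\<close>
  define f :: "nat \<Rightarrow> nat" where "f = fst \<circ> prod_decode"
  obtain s y where s: "x < y" "\<And>n. s n < s (Suc n)" "\<And>n. s (Suc n) \<in> C (f n)" "\<And>n. s n < y"
    "\<And>z. z < y \<Longrightarrow> \<exists>n. z < s n"
  proof -
    have "\<exists>z>y. z \<in> C (f n)" for n y using club_unbounded[OF C] by blast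
    from this show ?thesis
      by (rule longray_sequence_limit[of "\<lambda>n y z. z \<in> C (f n)", where x = x]) (rule that)
  qed
  have "y \<in> C n" for n
  proof (rule club_closed[OF C])
    have "\<exists>z\<in>C n. u < z \<and> z < y" if "u < y" for u
    proof -
      obtain i where i: "u < s i" using s(5) \<open>u < y\<close> by blast
      define j where "j = prod_encode (n, i)"
      have j: "f j = n" "i \<le> j" by (simp_all add: f_def j_def le_prod_encode_2)
      have "s i \<le> s (Suc j)" using j by (intro increasing_le[of s, OF s(2)]) auto
      then show ?thesis using s(3)[of j] s(4)[of "Suc j"] j i by (auto intro: order_less_le_trans)
    qed
    then show "y \<in> limits (C n)" using s(1) by (auto simp: limits_def intro: bot_less_of_less[of x])
  qed
  then show "\<exists>y\<in>\<Inter>n. C n. x < y" using s(1) by blast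
next
  fix x assume "x \<in> limits (\<Inter>n. C n)"
  then have "x \<in> limits (C n)" for n using limits_mono[of "\<Inter>n. C n" "C n"] by auto
  then have "x \<in> C n" for n by (intro club_closed[OF C])
  then show "x \<in> (\<Inter>n. C n)" by simp
qed

lemma club_Int: "club C \<Longrightarrow> club D \<Longrightarrow> club (C \<inter> D)"
proof -
  assume "club C" "club D"
  then have "club (\<Inter>n::nat. if n = 0 then C else D)" by (intro club_INT) auto
  moreover have "(\<Inter>n::nat. if n = 0 then C else D) = C \<inter> D"
    by (auto split: if_splits)
  ultimately show ?thesis by simp
qed

lemma club_INT_countable:
  assumes "countable I" "\<And>i. i \<in> I \<Longrightarrow> club (C i)"
  shows "club (\<Inter>i\<in>I. C i)"
proof (cases "I = {}")
  case True
  then show ?thesis using gt_ex by (intro clubI) auto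
next
  case False
  have "(\<Inter>i\<in>I. C i) = (\<Inter>n. C (from_nat_into I n))"
    by (subst (1) range_from_nat_into[OF False assms(1), symmetric]) simp
  moreover have "club (\<Inter>n. C (from_nat_into I n))"
    by (intro club_INT assms(2) from_nat_into[OF False])
  ultimately show ?thesis by simp
qed

lemma club_greaterThan: "club {a<..}"
proof (rule clubI)
  show "\<exists>y\<in>{a<..}. x < y" for x
  proof -
    obtain y where "max a x < y" using gt_ex by blast
    then show ?thesis by (intro bexI[of _ y]) auto
  qed
  show "x \<in> {a<..}" if x: "x \<in> limits {a<..}" for x
  proof -
    have "bot < x" using x by (simp add: limits_def)
    then obtain z where "z \<in> {a<..}" "z < x" using limitsE[OF x] by blast
    then show ?thesis by simp
  qed
qed

text \<open>The relation \<open>Q\<close> can be satisfied below such a point from every starting point below it. The limits of a set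
  and the points that a map to the longray does not lead beyond are of this form.\<close>

lemma club_diagonal:
  fixes Q :: "longray \<Rightarrow> longray \<Rightarrow> bool"
  assumes ex: "\<And>y. \<exists>z>y. Q y z" and mono: "\<And>y y' z. Q y z \<Longrightarrow> y' \<le> y \<Longrightarrow> Q y' z"
  shows "club {x. bot < x \<and> (\<forall>y<x. \<exists>z. y < z \<and> z < x \<and> Q y z)}" (is "club ?C")
proof (rule clubI)
  fix x
  obtain s y where s: "x < y" "\<And>n. s n < s (Suc n)" "\<And>n. Q (s n) (s (Suc n))" "\<And>n. s n < y"
    "\<And>z. z < y \<Longrightarrow> \<exists>n. z < s n"
    by (rule longray_sequence_limit[of "\<lambda>n. Q", where x = x]) (rule ex, rule that)
  have "\<exists>z. u < z \<and> z < y \<and> Q u z" if "u < y" for u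
  proof -
    obtain n where n: "u < s n" using s(5) \<open>u < y\<close> by blast
    have "u < s (Suc n)" using n s(2)[of n] by simp
    moreover have "Q u (s (Suc n))" using mono[OF s(3)[of n]] n by simp
    ultimately show ?thesis using s(4)[of "Suc n"] by blast
  qed
  then show "\<exists>y\<in>?C. x < y" using s(1) bot_less_of_less by blast
next
  fix x assume x: "x \<in> limits ?C"
  have "\<exists>z. y < z \<and> z < x \<and> Q y z" if "y < x" for y
  proof -
    obtain w where "w \<in> ?C" "y < w" "w < x" using limitsE[OF x \<open>y < x\<close>] by blast
    then obtain z where "y < z" "z < w" "Q y z" by blast
    then show ?thesis using \<open>w < x\<close> by (intro exI[of _ z]) simp
  qed
  then show "x \<in> ?C" using x by (simp add: limits_def)
qed

lemma club_limits:
  assumes "\<And>x. \<exists>y\<in>S. x < y"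
  shows "club (limits S)"
proof -
  have "club {x. bot < x \<and> (\<forall>y<x. \<exists>z. y < z \<and> z < x \<and> z \<in> S)}"
    by (rule club_diagonal) (use assms in blast)+
  also have "{x. bot < x \<and> (\<forall>y<x. \<exists>z. y < z \<and> z < x \<and> z \<in> S)} = limits S"
    unfolding limits_def by blast
  finally show ?thesis .
qed

lemma club_imp_stationary: "club C \<Longrightarrow> stationary C"
  unfolding stationary_def using club_unbounded[OF club_Int] by blast

lemma not_stationaryE:
  assumes "\<not> stationary S"
  obtains C where "club C" "\<And>x. x \<in> C \<Longrightarrow> x \<notin> S"
  using assms unfolding stationary_def by blast

lemma stationary_Int_club: "stationary S \<Longrightarrow> club C \<Longrightarrow> stationary (S \<inter> C)"
proof -
  assume S: "stationary S" and C: "club C"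
  show "stationary (S \<inter> C)"
    unfolding stationary_def
  proof (intro allI impI)
    fix D assume "club D"
    then obtain x where "x \<in> S" "x \<in> C \<inter> D"
      using S club_Int[OF C] unfolding stationary_def by blast
    then show "\<exists>x\<in>S \<inter> C. x \<in> D" by blast
  qed
qed

lemma stationary_unbounded:
  assumes "stationary S"
  shows "\<exists>y\<in>S. x < y"
proof -
  have "\<exists>y\<in>S. y \<in> {x<..}"
    using assms club_greaterThan[of x] unfolding stationary_def by (elim allE impE)
  then show ?thesis by simp
qed

lemma club_limits_stationary: "stationary S \<Longrightarrow> club (limits S)"
  by (intro club_limits stationary_unbounded)

lemma stationary_countable_split:
  assumes S: "stationary S" and Q: "countable Q" "\<And>x. x \<in> S \<Longrightarrow> h x \<in> Q"
  obtains q where "q \<in> Q" "stationary {x \<in> S. h x = q}"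
proof (rule ccontr)
  note found = that
  assume none: "\<not> thesis"
  have "\<not> stationary {x \<in> S. h x = q}" if "q \<in> Q" for q
    using found[OF that] none by (rule contrapos_nn[rotated])
  then have "\<forall>q\<in>Q. \<exists>C. club C \<and> (\<forall>x\<in>C. x \<notin> {x \<in> S. h x = q})"
    unfolding stationary_def by blast
  then obtain C where C: "\<And>q. q \<in> Q \<Longrightarrow> club (C q)" "\<And>q x. q \<in> Q \<Longrightarrow> x \<in> C q \<Longrightarrow> x \<notin> {x \<in> S. h x = q}"
    by metis
  have "club (\<Inter>q\<in>Q. C q)" by (intro club_INT_countable Q C)
  then obtain x where "x \<in> S" "\<And>q. q \<in> Q \<Longrightarrow> x \<in> C q"
    using S unfolding stationary_def by blast
  then show False using C(2) Q(2) by blast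
qed

text \<open>A form of Fodor's lemma. Only a bound for \<open>f\<close>, and not a constant value, is obtained on a
  stationary set; this suffices everywhere below and spares a partition into the fibres of \<open>f\<close>.\<close>

lemma pressing_down:
  assumes S: "stationary S" and f: "\<And>x. x \<in> S \<Longrightarrow> f x < x"
  obtains \<gamma> where "stationary {x \<in> S. f x \<le> \<gamma>}"
proof (rule ccontr)
  note found = that
  assume none: "\<not> thesis"
  have "\<not> stationary {x \<in> S. f x \<le> \<gamma>}" for \<gamma>
    using found[of \<gamma>] none by (rule contrapos_nn[rotated])
  then have "\<forall>\<gamma>. \<exists>C. club C \<and> (\<forall>x\<in>C. x \<notin> {x \<in> S. f x \<le> \<gamma>})"
    unfolding stationary_def by blast
  then obtain C where C: "\<And>\<gamma>. club (C \<gamma>)" "\<And>\<gamma> x. x \<in> C \<gamma> \<Longrightarrow> x \<notin> {x \<in> S. f x \<le> \<gamma>}"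
    by metis
  define Z where "Z = range (\<lambda>a. Abs_longray (a, 0))"
  have cZ: "countable {z \<in> Z. z < y}" for y
  proof -
    have eq: "{..ordl y} = insert (ordl y) {..<ordl y}" by auto
    have "countable {..ordl y}" unfolding eq using countable_lessThan_omega1 by simp
    moreover have "{z \<in> Z. z < y} \<subseteq> (\<lambda>a. Abs_longray (a, 0)) ` {..ordl y}"
      by (auto simp: Z_def longray_less_iff Abs_longray_coords)
    ultimately show ?thesis using countable_subset countable_image by metis
  qed
  have Zub: "\<exists>z\<in>Z. x < z" for x
  proof -
    obtain a where "\<And>b. b \<in> {ordl x} \<Longrightarrow> b < a" using omega1_countable_bounded[of "{ordl x}"] by auto
    then show ?thesis by (intro bexI[of _ "Abs_longray (a, 0)"])
      (auto simp: Z_def longray_less_iff Abs_longray_coords)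
  qed
  \<comment> \<open>The diagonal intersection of the clubs is indexed by the ordinals, because below any point there are only countably many of them.\<close>
  define D where "D = {x. \<forall>z\<in>Z. z < x \<longrightarrow> x \<in> C z}"
  have "club D"
  proof (rule clubI)
    fix x
    obtain s y where s: "x < y" "\<And>n. s n < s (Suc n)" "\<And>n. s (Suc n) \<in> (\<Inter>z\<in>{z \<in> Z. z < s n}. C z)"
      "\<And>n. s n < y" "\<And>z. z < y \<Longrightarrow> \<exists>n. z < s n"
    proof -
      have "\<exists>w>y. w \<in> (\<Inter>z\<in>{z \<in> Z. z < y}. C z)" for y
        using club_unbounded[OF club_INT_countable[OF cZ[of y], of C], of y] C(1) by blast
      from this show ?thesis
      by (rule longray_sequence_limit[of "\<lambda>n y w. w \<in> (\<Inter>z\<in>{z \<in> Z. z < y}. C z)", where x = x]) (rule that)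
    qed
    have "y \<in> C z" if "z \<in> Z" "z < y" for z
    proof (rule club_closed[OF C(1)])
      obtain m where m: "z < s m" using s(5) \<open>z < y\<close> by blast
      have "\<exists>w\<in>C z. u < w \<and> w < y" if "u < y" for u
      proof -
        obtain i where i: "u < s i" using s(5) \<open>u < y\<close> by blast
        define j where "j = max i m"
        have "s i \<le> s (Suc j)" "s m \<le> s j"
          by (intro increasing_le[of s, OF s(2)]; simp add: j_def)+
        then show ?thesis using s(3)[of j] s(4)[of "Suc j"] i m \<open>z \<in> Z\<close>
          by (intro bexI[of _ "s (Suc j)"]) (auto intro: order_less_le_trans)
      qed
      then show "y \<in> limits (C z)" using s(1) by (auto simp: limits_def intro: bot_less_of_less[of x])
    qed
    then show "\<exists>y\<in>D. x < y" using s(1) by (auto simp: D_def)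
  next
    fix x assume x: "x \<in> limits D"
    have "x \<in> C z" if z: "z \<in> Z" "z < x" for z
    proof (rule club_closed[OF C(1)])
      have "\<exists>w\<in>C z. u < w \<and> w < x" if "u < x" for u
      proof -
        have "max u z < x" using that z by simp
        then obtain w where "w \<in> D" "max u z < w" "w < x" using x unfolding limits_def by blast
        then show ?thesis using z by (auto simp: D_def)
      qed
      then show "x \<in> limits (C z)" using x by (auto simp: limits_def)
    qed
    then show "x \<in> D" by (auto simp: D_def)
  qed
  then have "club (D \<inter> limits Z)" by (intro club_Int club_limits Zub)
  then obtain x where x: "x \<in> S" "x \<in> D" "x \<in> limits Z" using S by (auto simp: stationary_def)
  obtain z where z: "z \<in> Z" "f x < z" "z < x" using x(3) f[OF x(1)] by (auto simp: limits_def)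
  then have "x \<in> C z" using x(2) by (auto simp: D_def)
  then show False using C(2)[of x z] x(1) z(2) by auto
qed

section \<open>Line bundles over the longray and tubes in them\<close>

text \<open>A principal bundle over the open longray with group the positive reals under multiplication,
  given by charts: \<open>p x y v\<close> is the vector over \<open>y\<close> whose coordinate is \<open>v\<close> in the chart around
  \<open>x\<close>, a chart that covers the interval from \<open>a x\<close> to \<open>b x\<close>. The change of coordinates from the
  chart at \<open>x'\<close> to the chart at \<open>x\<close> is multiplication by \<open>k x x' y\<close>. Continuity of
  maps out of the total space is tested in charts, so the total space is a mere type. The coordinate of a vector over \<open>x\<close> is taken in the chart at
  \<open>x\<close> whenever nothing else is said.\<close>

locale longray_line_bundle =
  fixes a b :: "longray \<Rightarrow> longray"
    and p :: "longray \<Rightarrow> longray \<Rightarrow> real \<Rightarrow> 'p"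
    and k :: "longray \<Rightarrow> longray \<Rightarrow> longray \<Rightarrow> real"
  assumes chart_around: "bot < x \<Longrightarrow> a x < x" "bot < x \<Longrightarrow> x < b x"
    and transition: "\<lbrakk>bot < x; bot < x'; y \<in> {a x<..<b x}; y \<in> {a x'<..<b x'}\<rbrakk>
      \<Longrightarrow> p x' y v = p x y (k x x' y * v)"
    and k_pos: "\<lbrakk>bot < x; bot < x'; y \<in> {a x<..<b x}; y \<in> {a x'<..<b x'}\<rbrakk> \<Longrightarrow> 0 < k x x' y"
    and cocycle: "\<lbrakk>bot < x; bot < x'; bot < x''; y \<in> {a x<..<b x}; y \<in> {a x'<..<b x'};
        y \<in> {a x''<..<b x''}\<rbrakk> \<Longrightarrow> k x x'' y = k x x' y * k x' x'' y"
    and k_cont: "\<lbrakk>bot < x; bot < x'\<rbrakk>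
      \<Longrightarrow> continuous_on ({a x<..<b x} \<inter> {a x'<..<b x'}) (k x x')"
begin

lemma mem_chart: "bot < x \<Longrightarrow> x \<in> {a x<..<b x}"
  using chart_around by simp

text \<open>A tube chooses in each fibre beyond \<open>\<delta>\<close> a compact interval, in such a way that vectors of the tube
  whose base points climb to \<open>y\<close> have a subsequence that converges to a vector of the tube over
  \<open>y\<close>; the coordinates are compared in the chart at \<open>y\<close>. The full fibres do not have this
  property, as they are not compact. A tube makes limits of vectors available at every limit point, as on
  the longray itself.\<close>

definition tube :: "(longray \<Rightarrow> real set) \<Rightarrow> longray \<Rightarrow> bool" where
  "tube I \<delta> \<longleftrightarrow>
     (\<forall>y>\<delta>. \<exists>l u. 0 < l \<and> l \<le> u \<and> I y = {l..u}) \<and>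
     (\<forall>y>\<delta>. \<forall>s w. (\<forall>n::nat. \<delta> < s n \<and> s n < y \<and> w n \<in> I (s n)) \<and> s \<longlonglongrightarrow> y \<longrightarrow>
        (\<exists>r w'. strict_mono (r :: nat \<Rightarrow> nat) \<and> w' \<in> I y \<and>
           (\<lambda>n. k y (s (r n)) (s (r n)) * w (r n)) \<longlonglongrightarrow> w'))"

lemma tube_interval:
  assumes "tube I \<delta>" "\<delta> < y"
  obtains l u where "0 < l" "l \<le> u" "I y = {l..u}"
  using assms unfolding tube_def by blast

lemma tube_limit:
  assumes "tube I \<delta>" "\<delta> < y" "\<And>n. \<delta> < s n \<and> s n < y \<and> w n \<in> I (s n)" "s \<longlonglongrightarrow> y"
  obtains r w' where "strict_mono (r :: nat \<Rightarrow> nat)" "w' \<in> I y"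
    "(\<lambda>n. k y (s (r n)) (s (r n)) * w (r n)) \<longlonglongrightarrow> w'"
  using assms unfolding tube_def by blast

text \<open>Suppose that from \<open>\<delta>\<close> up to each \<open>x\<close> in the unbounded sets \<open>S1\<close> and \<open>S2\<close> there is a section that is
  constant in the chart at \<open>x\<close>, with values in \<open>Z1\<close> or in \<open>Z2\<close>. Sections of the two kinds never
  meet, so by the intermediate value theorem their order at \<open>\<delta>\<close> persists. The vectors that lie
  above all sections of the first kind and below all those of the second kind form a tube: one
  section of each kind, reaching beyond \<open>y\<close>, keeps the tube near \<open>y\<close> between two continuous functions.\<close>

lemma tube_between:
  assumes \<delta>: "bot < \<delta>"
    and unb: "\<And>y. \<exists>x\<in>S1. y < x" "\<And>y. \<exists>x\<in>S2. y < x"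
    and pos: "\<And>x. x \<in> S1 \<Longrightarrow> 0 < v1 x" "\<And>x. x \<in> S2 \<Longrightarrow> 0 < v2 x"
    and gt: "\<And>x. x \<in> S1 \<union> S2 \<Longrightarrow> \<delta> < x"
    and chart: "\<And>x y. x \<in> S1 \<union> S2 \<Longrightarrow> \<delta> \<le> y \<Longrightarrow> y \<le> x \<Longrightarrow> y \<in> {a x<..<b x}"
    and Z: "\<And>x y. x \<in> S1 \<Longrightarrow> \<delta> \<le> y \<Longrightarrow> y \<le> x \<Longrightarrow> p x y (v1 x) \<in> Z1"
      "\<And>x y. x \<in> S2 \<Longrightarrow> \<delta> \<le> y \<Longrightarrow> y \<le> x \<Longrightarrow> p x y (v2 x) \<in> Z2" "Z1 \<inter> Z2 = {}"
    and less: "\<And>x x'. x \<in> S1 \<Longrightarrow> x' \<in> S2 \<Longrightarrow> k \<delta> x \<delta> * v1 x < k \<delta> x' \<delta> * v2 x'"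
  obtains I where "tube I \<delta>"
proof -
  have bx: "bot < x" if "x \<in> S1 \<union> S2" for x by (rule bot_less_of_less[OF gt[OF that]])
  have order: "k y x y * v1 x < k y x' y * v2 x'"
    if x: "x \<in> S1" "x' \<in> S2" and y: "\<delta> \<le> y" "y \<le> x" "y \<le> x'" for x x' y
  proof -
    \<comment> \<open>The second section in the coordinates of the chart at \<open>x\<close>, in which the first one is constant.\<close>
    define f where "f z = k x x' z * v2 x'" for z
    note bots = bx[of x] bx[of x'] \<delta>
    have boty: "bot < y" using less_le_trans[OF \<delta> y(1)] .
    have c\<delta>: "\<delta> \<in> {a \<delta><..<b \<delta>}" "\<delta> \<in> {a x<..<b x}" "\<delta> \<in> {a x'<..<b x'}"
      using mem_chart[OF \<delta>] chart[of x \<delta>] chart[of x' \<delta>] x y by auto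
    have cy: "y \<in> {a y<..<b y}" "y \<in> {a x<..<b x}" "y \<in> {a x'<..<b x'}"
      using mem_chart[OF boty] chart[of x y] chart[of x' y] x y by auto
    have "k \<delta> x \<delta> * v1 x < k \<delta> x \<delta> * f \<delta>"
      using less[OF x] cocycle[of \<delta> x x' \<delta>] c\<delta> bots x by (simp add: f_def mult.assoc)
    then have f\<delta>: "v1 x < f \<delta>" using k_pos[of \<delta> x \<delta>] c\<delta> bots x by simp
    have "v1 x < f y"
    proof (rule ccontr)
      assume "\<not> v1 x < f y"
      then have "f y \<le> v1 x" by simp
      moreover have "continuous_on {\<delta>..y} f"
        unfolding f_def
      proof (intro continuous_intros continuous_on_subset[OF k_cont[of x x']])
        show "{\<delta>..y} \<subseteq> {a x<..<b x} \<inter> {a x'<..<b x'}"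
          using chart[of x] chart[of x'] x y by (meson IntI UnI1 UnI2 atLeastAtMost_iff order_trans subsetI)
      qed (use bots x in auto)
      ultimately obtain z where z: "\<delta> \<le> z" "z \<le> y" "f z = v1 x"
        using IVT2'[of f y "v1 x" \<delta>] f\<delta> y(1) by auto
      have "p x' z (v2 x') = p x z (f z)"
        unfolding f_def using transition[of x x' z "v2 x'"] chart[of x z] chart[of x' z] z y x bots by auto
      then have "p x' z (v2 x') \<in> Z1" using z Z(1)[of x z] x y by auto
      then show False using Z(2)[of x' z] Z(3) x y z by auto
    qed
    then have "k y x y * v1 x < k y x y * f y" using k_pos[of y x y] cy boty bots x by simp
    then show ?thesis using cocycle[of y x x' y] cy boty bots x by (simp add: f_def mult.assoc)
  qed
  \<comment> \<open>The sections of the two kinds that exist over \<open>y\<close>, in the chart at \<open>y\<close>.\<close>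
  define lo where "lo y = (\<lambda>x. k y x y * v1 x) ` {x \<in> S1. y \<le> x}" for y
  define hi where "hi y = (\<lambda>x. k y x y * v2 x) ` {x \<in> S2. y \<le> x}" for y
  define I where "I y = {w. (\<forall>e\<in>lo y. e \<le> w) \<and> (\<forall>e\<in>hi y. w \<le> e)}" for y
  have kp: "0 < k y x y" if "x \<in> S1 \<union> S2" "\<delta> < y" "y \<le> x" for x y
  proof -
    have "bot < y" by (rule bot_less_of_less[OF that(2)])
    then show ?thesis using k_pos[of y x y] mem_chart[of y] chart[of x y] bx[of x] that by auto
  qed
  have tube1: "\<exists>l u. 0 < l \<and> l \<le> u \<and> I y = {l..u}" if "\<delta> < y" for y
  proof -
    obtain x1 where x1: "x1 \<in> S1" "y < x1" using unb(1) by blast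
    obtain x2 where x2: "x2 \<in> S2" "y < x2" using unb(2) by blast
    have ne: "lo y \<noteq> {}" "hi y \<noteq> {}" using x1 x2 by (auto simp: lo_def hi_def intro: less_imp_le)
    have le: "e \<le> e'" if "e \<in> lo y" "e' \<in> hi y" for e e'
      using that order \<open>\<delta> < y\<close> unfolding lo_def hi_def by (fastforce intro: less_imp_le)
    have bdd: "bdd_above (lo y)" "bdd_below (hi y)"
      using le ne by (meson bdd_above.I ex_in_conv, meson bdd_below.I ex_in_conv)
    have I: "I y = {Sup (lo y)..Inf (hi y)}"
      using cSup_le_iff[OF ne(1) bdd(1)] le_cInf_iff[OF ne(2) bdd(2)] by (auto simp: I_def)
    have "0 < k y x1 y * v1 x1" using kp[of x1 y] pos x1 \<open>\<delta> < y\<close> by simp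
    also have "\<dots> \<le> Sup (lo y)" by (rule cSup_upper[OF _ bdd(1)]) (use x1 in \<open>auto simp: lo_def\<close>)
    finally have "0 < Sup (lo y)" .
    moreover have "Sup (lo y) \<le> Inf (hi y)" using le ne by (intro cSup_least cInf_greatest)
    ultimately show ?thesis using I by blast
  qed
  have "\<exists>r w'. strict_mono (r :: nat \<Rightarrow> nat) \<and> w' \<in> I y \<and>
           (\<lambda>n. k y (s (r n)) (s (r n)) * w (r n)) \<longlonglongrightarrow> w'"
    if y: "\<delta> < y" and s: "\<And>n. \<delta> < s n \<and> s n < y \<and> w n \<in> I (s n)" "s \<longlonglongrightarrow> y" for y s w
  proof -
    have boty: "bot < y" by (rule bot_less_of_less[OF y])
    have bs: "bot < s n" for n using s(1)[of n] bot_less_of_less[of \<delta> "s n"] by simp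
    have "\<forall>\<^sub>F n in sequentially. s n \<in> {a y<..<b y}"
      by (rule topological_tendstoD[OF s(2) _ mem_chart[OF boty]]) simp
    then obtain N where N: "\<And>n. N \<le> n \<Longrightarrow> s n \<in> {a y<..<b y}" unfolding eventually_sequentially by blast
    have s_le: "\<delta> \<le> s n" "y \<le> x \<Longrightarrow> s n \<le> x" for n x
      using s(1)[of n] by auto
    define w' where "w' n = k y (s n) (s n) * w n" for n
    have kx: "k y x (s n) = k y (s n) (s n) * k (s n) x (s n)" "0 < k y (s n) (s n)"
      if "x \<in> S1 \<union> S2" "y \<le> x" "N \<le> n" for x n
    proof -
      have "s n \<in> {a x<..<b x}" using chart[OF that(1) s_le(1) s_le(2)[OF that(2)]] .
      then show "k y x (s n) = k y (s n) (s n) * k (s n) x (s n)" "0 < k y (s n) (s n)"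
        using cocycle[of y "s n" x "s n"] k_pos[of y "s n" "s n"] N[OF that(3)] mem_chart[OF bs] bs[of n] boty
          bx[OF that(1)] by blast+
    qed
    have k_lim: "(\<lambda>n. k y x (s n) * c) \<longlonglongrightarrow> k y x y * c" if "x \<in> S1 \<union> S2" "y \<le> x" for x c
    proof (intro tendsto_mult_right continuous_on_tendsto_compose[OF k_cont[OF boty bx[OF that(1)]] s(2)])
      show "y \<in> {a y<..<b y} \<inter> {a x<..<b x}"
        using mem_chart[OF boty] chart[OF that(1) _ that(2)] y by simp
      show "\<forall>\<^sub>F n in sequentially. s n \<in> {a y<..<b y} \<inter> {a x<..<b x}"
        unfolding eventually_sequentially
      proof (intro exI[of _ N] allI impI IntI N)
        show "s n \<in> {a x<..<b x}" for n using chart[OF that(1) s_le(1) s_le(2)[OF that(2)]] .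
      qed
    qed
    have lo: "k y x (s n) * v1 x \<le> w' n" if "x \<in> S1" "y \<le> x" "N \<le> n" for x n
    proof -
      have "k (s n) x (s n) * v1 x \<le> w n"
        using s(1)[of n] that s_le(2)[of x n] by (auto simp: I_def lo_def)
      then show ?thesis using kx[of x n] that by (simp add: w'_def mult.assoc)
    qed
    have hi: "w' n \<le> k y x (s n) * v2 x" if "x \<in> S2" "y \<le> x" "N \<le> n" for x n
    proof -
      have "w n \<le> k (s n) x (s n) * v2 x"
        using s(1)[of n] that s_le(2)[of x n] by (auto simp: I_def hi_def)
      then show ?thesis using kx[of x n] that by (simp add: w'_def mult.assoc)
    qed
    obtain x1 where x1: "x1 \<in> S1" "y \<le> x1" using unb(1) less_imp_le by metis
    obtain x2 where x2: "x2 \<in> S2" "y \<le> x2" using unb(2) less_imp_le by metis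
    obtain M where M: "\<And>n. k y x2 (s n) * v2 x2 \<le> M"
    proof -
      have "Bseq (\<lambda>n. k y x2 (s n) * v2 x2)" using k_lim[of x2] x2 by (intro convergent_imp_Bseq convergentI) auto
      then obtain K where "\<And>n. norm (k y x2 (s n) * v2 x2) \<le> K" unfolding Bseq_def by blast
      then show ?thesis by (intro that[of K]) (metis abs_le_D1 real_norm_def)
    qed
    have "bounded (range (\<lambda>n. w' (n + N)))"
    proof (rule bounded_subset[OF bounded_closed_interval[of 0 M]], safe)
      fix n
      have "0 < k y x1 (s (n + N)) * v1 x1"
      proof -
        have "0 < k y (s (n + N)) (s (n + N))" using kx(2)[of x1 "n + N"] x1 by simp
        moreover have "0 < k (s (n + N)) x1 (s (n + N))"
          using kp[of x1 "s (n + N)"] s(1)[of "n + N"] x1 s_le(2)[of x1 "n + N"] by simp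
        ultimately show ?thesis using kx(1)[of x1 "n + N"] x1 pos(1) by simp
      qed
      then show "w' (n + N) \<in> {0..M}"
        using lo[of x1 "n + N"] hi[of x2 "n + N"] M[of "n + N"] x1 x2 by auto
    qed
    then obtain c r where r: "strict_mono r" "((\<lambda>n. w' (n + N)) \<circ> r) \<longlonglongrightarrow> c"
      using bounded_imp_convergent_subsequence by blast
    define r' where "r' n = r n + N" for n
    have r': "strict_mono r'" using r(1) by (auto simp: r'_def strict_mono_def)
    have lim: "(\<lambda>n. w' (r' n)) \<longlonglongrightarrow> c" using r(2) by (simp add: r'_def o_def)
    have "e \<le> c" if "e \<in> lo y" for e
    proof -
      obtain x where x: "x \<in> S1" "y \<le> x" "e = k y x y * v1 x" using \<open>e \<in> lo y\<close> by (auto simp: lo_def)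
      have "(\<lambda>n. k y x (s (r' n)) * v1 x) \<longlonglongrightarrow> e"
        using LIMSEQ_subseq_LIMSEQ[OF k_lim[of x "v1 x"] r'] x by (simp add: o_def)
      then show ?thesis by (rule LIMSEQ_le[OF _ lim]) (use lo[of x] x in \<open>auto simp: r'_def\<close>)
    qed
    moreover have "c \<le> e" if "e \<in> hi y" for e
    proof -
      obtain x where x: "x \<in> S2" "y \<le> x" "e = k y x y * v2 x" using \<open>e \<in> hi y\<close> by (auto simp: hi_def)
      have "(\<lambda>n. k y x (s (r' n)) * v2 x) \<longlonglongrightarrow> e"
        using LIMSEQ_subseq_LIMSEQ[OF k_lim[of x "v2 x"] r'] x by (simp add: o_def)
      then show ?thesis by (rule LIMSEQ_le[OF lim]) (use hi[of x] x in \<open>auto simp: r'_def\<close>)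
    qed
    ultimately have "c \<in> I y" by (simp add: I_def)
    then show ?thesis using r' lim unfolding w'_def by blast
  qed
  then have "tube I \<delta>" unfolding tube_def using tube1 by blast
  then show ?thesis by (rule that)
qed

end

section \<open>Maps from a line bundle to the longray\<close>

locale longray_line_bundle_map = longray_line_bundle a b p k
  for a b :: "longray \<Rightarrow> longray" and p :: "longray \<Rightarrow> longray \<Rightarrow> real \<Rightarrow> 'p" and k +
  fixes g :: "'p \<Rightarrow> longray"
  assumes g_cont: "bot < x \<Longrightarrow> continuous_on ({a x<..<b x} \<times> {0<..}) (\<lambda>(y, v). g (p x y v))"
begin

lemma g_seq_limit:
  assumes x: "bot < x" and v: "0 < v" and s: "s \<longlonglongrightarrow> x" and w: "w \<longlonglongrightarrow> v"
  shows "(\<lambda>n. g (p x (s n) (w n))) \<longlonglongrightarrow> g (p x x v)"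
proof -
  have "\<forall>\<^sub>F n in sequentially. s n \<in> {a x<..<b x}"
    by (rule topological_tendstoD[OF s _ mem_chart[OF x]]) simp
  moreover have "\<forall>\<^sub>F n in sequentially. w n \<in> {0<..}"
    by (rule topological_tendstoD[OF w]) (use v in auto)
  ultimately have "\<forall>\<^sub>F n in sequentially. (s n, w n) \<in> {a x<..<b x} \<times> {0<..}"
    by eventually_elim simp
  then have "(\<lambda>n. (\<lambda>(y, v). g (p x y v)) (s n, w n)) \<longlonglongrightarrow> (\<lambda>(y, v). g (p x y v)) (x, v)"
    using continuous_on_tendsto_compose[OF g_cont[OF x] tendsto_Pair[OF s w]] mem_chart[OF x] v by simp
  then show ?thesis by simp
qed

lemma g_fiber_continuous: "bot < x \<Longrightarrow> continuous_on {0<..} (\<lambda>v. g (p x x v))"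
  using mem_chart by (intro continuous_on_compose2[OF g_cont, of x "{0<..}" "\<lambda>v. (x, v)", simplified])
    (auto intro!: continuous_intros)

lemma g_left:
  assumes x: "bot < x" and v: "0 < v" and U: "open U" "g (p x x v) \<in> U"
  obtains d where "d < x" "\<And>y. d < y \<Longrightarrow> y \<le> x \<Longrightarrow> y \<in> {a x<..<b x} \<and> g (p x y v) \<in> U"
proof -
  have "continuous_on {a x<..<b x} (\<lambda>y. g (p x y v))"
    using v by (intro continuous_on_compose2[OF g_cont[OF x], of _ "\<lambda>y. (y, v)", simplified])
      (auto intro!: continuous_intros)
  then have "open ((\<lambda>y. g (p x y v)) -` U \<inter> {a x<..<b x})"
    using U(1) continuous_on_open_vimage[of "{a x<..<b x}" "\<lambda>y. g (p x y v)"] by simp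
  then obtain d where "d < x" "{d<..x} \<subseteq> (\<lambda>y. g (p x y v)) -` U \<inter> {a x<..<b x}"
    using open_left[of _ x bot] U(2) mem_chart[OF x] x by (metis IntI vimageI)
  then show ?thesis by (intro that[of d]) auto
qed

text \<open>The part of the bundle over an initial segment is separable, and countable subsets of the longray
  are bounded. In place of a dense sequence of vectors, the countably many vectors with rational
  coordinate over a countable dense set of base points are used.\<close>

lemma g_bounded_below:
  obtains \<beta> where "\<And>y v. bot < y \<Longrightarrow> y \<le> x \<Longrightarrow> 0 < v \<Longrightarrow> g (p y y v) \<le> \<beta>"
proof -
  obtain D where D: "countable D" "\<And>u v. u < v \<Longrightarrow> v \<le> x \<Longrightarrow> \<exists>d\<in>D. u < d \<and> d < v"
    using longray_countable_dense_below by metis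
  have "countable ((\<lambda>(y, q). g (p y y q)) ` (D \<times> (\<rat> :: real set)))"
    using D(1) countable_rat by blast
  then obtain \<beta> where \<beta>: "\<And>c. c \<in> (\<lambda>(y, q). g (p y y q)) ` (D \<times> (\<rat> :: real set)) \<Longrightarrow> c < \<beta>"
    by (rule longray_countable_bounded) (rule that)
  show ?thesis
  proof (rule that[of \<beta>], rule ccontr)
    fix y v assume y: "bot < y" "y \<le> x" and v: "(0::real) < v" and "\<not> g (p y y v) \<le> \<beta>"
    then have gt: "\<beta> < g (p y y v)" by simp
    let ?h = "\<lambda>(z, w). g (p y z w)" and ?X = "{a y<..<b y} \<times> {0::real<..}"
    have "open (?h -` {\<beta><..} \<inter> ?X)"
      using g_cont[OF y(1)] continuous_on_open_vimage[of ?X ?h] by (simp add: open_Times)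
    moreover have "(y, v) \<in> ?h -` {\<beta><..} \<inter> ?X" using gt v mem_chart[OF y(1)] by simp
    ultimately obtain S T where ST: "open S" "open T" "y \<in> S" "v \<in> T" "S \<times> T \<subseteq> ?h -` {\<beta><..} \<inter> ?X"
      by (rule open_prod_elim) blast
    obtain d where d: "d < y" "{d<..y} \<subseteq> S" using open_left[OF ST(1,3) y(1)] by blast
    obtain z where z: "z \<in> D" "d < z" "z < y" using D(2)[OF d(1) y(2)] by blast
    have zS: "z \<in> S" using z d by auto
    have zc: "z \<in> {a y<..<b y}" using zS ST(4,5) by auto
    have bz: "bot < z" by (rule bot_less_of_less[OF z(2)])
    have kz: "0 < k z y z" using k_pos[OF bz y(1) mem_chart[OF bz] zc] .
    obtain e where e: "e > 0" "\<And>w. \<bar>w - v\<bar> < e \<Longrightarrow> w \<in> T"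
      using ST(2,4) by (auto simp: open_dist dist_real_def)
    have "k z y z * (v - e) < k z y z * v" using kz e by simp
    then obtain q where q: "q \<in> \<rat>" "k z y z * (v - e) < q" "q < k z y z * v"
      using Rats_dense_in_real by blast
    define w where "w = q / k z y z"
    have w: "v - e < w" "w < v" using q kz by (auto simp: w_def field_simps)
    then have "w \<in> T" using e by auto
    then have "\<beta> < g (p y z w)" using zS ST(5) by auto
    moreover have "p y z w = p z z q"
      using transition[OF bz y(1) mem_chart[OF bz] zc, of w] kz by (simp add: w_def)
    moreover have "g (p z z q) < \<beta>" using \<beta> z(1) q(1) by auto
    ultimately show False by simp
  qed
qed

text \<open>The points below which \<open>g\<close> does not lead out. Over such a point \<open>g\<close> takes values at most \<open>x\<close>, because
  every vector over \<open>x\<close> is a limit of vectors over smaller points; so \<open>g\<close> is regressive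
  at the vectors that it does not send to their base point.\<close>

definition trapping :: "longray set" where
  "trapping = {x. bot < x \<and>
     (\<forall>y<x. \<exists>z. y < z \<and> z < x \<and> (\<forall>u v. bot < u \<longrightarrow> u \<le> y \<longrightarrow> 0 < v \<longrightarrow> g (p u u v) < z))}"

lemma club_trapping: "club trapping"
  unfolding trapping_def
proof (rule club_diagonal)
  fix y
  obtain \<beta> where \<beta>: "\<And>u v. bot < u \<Longrightarrow> u \<le> y \<Longrightarrow> 0 < v \<Longrightarrow> g (p u u v) \<le> \<beta>"
    by (rule g_bounded_below[of y]) (rule that)
  obtain z where "max y \<beta> < z" using gt_ex by blast
  then show "\<exists>z>y. \<forall>u v. bot < u \<longrightarrow> u \<le> y \<longrightarrow> 0 < v \<longrightarrow> g (p u u v) < z"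
    using \<beta> by (intro exI[of _ z]) (auto intro: le_less_trans)
qed (meson order_trans)

lemma trapping_le:
  assumes x: "x \<in> trapping" and v: "0 < v"
  shows "g (p x x v) \<le> x"
proof (rule ccontr)
  assume "\<not> g (p x x v) \<le> x"
  then have gt: "g (p x x v) \<in> {x<..}" by simp
  have bx: "bot < x" using x by (simp add: trapping_def)
  obtain d where d: "d < x" "\<And>y. d < y \<Longrightarrow> y \<le> x \<Longrightarrow> y \<in> {a x<..<b x} \<and> g (p x y v) \<in> {x<..}"
    by (rule g_left[OF bx v open_greaterThan gt]) (rule that)
  obtain y where y: "d < y" "y < x" using dense d(1) by blast
  have by': "bot < y" by (rule bot_less_of_less[OF y(1)])
  have cy: "y \<in> {a x<..<b x}" "x < g (p x y v)" using d(2)[of y] y by auto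
  have "p x y v = p y y (k y x y * v)" "0 < k y x y"
    using transition[OF by' bx mem_chart[OF by'] cy(1)] k_pos[OF by' bx mem_chart[OF by'] cy(1)] by auto
  moreover obtain z where "z < x" "\<And>u v. bot < u \<Longrightarrow> u \<le> y \<Longrightarrow> 0 < v \<Longrightarrow> g (p u u v) < z"
    using x y(2) unfolding trapping_def by blast
  ultimately show False using by' cy(2) v by (metis less_asym less_trans mult_pos_pos order_refl)
qed

end

section \<open>The dichotomy on a tube\<close>

context longray_line_bundle
begin

text \<open>The two ways in which a map to the longray can behave on the vectors with coordinate in \<open>I\<close>:
  like the projection, or like a bounded map. Both are preserved by pointwise limits of sequences of maps,
  as countable intersections of clubs are clubs and countable sets of bounds are bounded.\<close>

definition fixed_on_club :: "('p \<Rightarrow> longray) \<Rightarrow> (longray \<Rightarrow> real set) \<Rightarrow> bool" where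
  "fixed_on_club g I \<longleftrightarrow> (\<exists>C. club C \<and> (\<forall>x\<in>C. \<forall>v\<in>I x. g (p x x v) = x))"

definition bounded_on_club :: "('p \<Rightarrow> longray) \<Rightarrow> (longray \<Rightarrow> real set) \<Rightarrow> bool" where
  "bounded_on_club g I \<longleftrightarrow> (\<exists>C \<gamma>. club C \<and> (\<forall>x\<in>C. \<forall>v\<in>I x. g (p x x v) \<le> \<gamma>))"

end

context longray_line_bundle_map
begin

lemma not_fixed_on_club:
  assumes "\<not> fixed_on_club g I" "\<And>x v. v \<in> I x \<Longrightarrow> 0 < v"
  obtains \<gamma> S v where "stationary S" "S \<subseteq> trapping" "\<And>x. x \<in> S \<Longrightarrow> v x \<in> I x"
    "\<And>x. x \<in> S \<Longrightarrow> g (p x x (v x)) \<le> \<gamma>"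
proof -
  have "stationary {x. \<exists>v\<in>I x. g (p x x v) \<noteq> x}"
  proof (rule ccontr)
    assume "\<not> stationary {x. \<exists>v\<in>I x. g (p x x v) \<noteq> x}"
    then obtain C where C: "club C" "\<And>x. x \<in> C \<Longrightarrow> x \<notin> {x. \<exists>v\<in>I x. g (p x x v) \<noteq> x}"
      by (rule not_stationaryE) (rule that)
    have "\<forall>x\<in>C. \<forall>v\<in>I x. g (p x x v) = x" using C(2) by simp
    then have "fixed_on_club g I" unfolding fixed_on_club_def using C(1) by (intro exI conjI)
    then show False using assms(1) by simp
  qed
  then have S: "stationary ({x. \<exists>v\<in>I x. g (p x x v) \<noteq> x} \<inter> trapping)" (is "stationary ?S")
    by (rule stationary_Int_club[OF _ club_trapping])
  have "\<exists>v. v \<in> I x \<and> g (p x x v) < x" if x: "x \<in> ?S" for x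
  proof -
    obtain v where v: "v \<in> I x" "g (p x x v) \<noteq> x" using x by blast
    then have "g (p x x v) \<le> x" using trapping_le[of x v] assms(2)[of v x] x by simp
    then show ?thesis using v by (intro exI[of _ v]) simp
  qed
  then have "\<forall>x\<in>?S. \<exists>v. v \<in> I x \<and> g (p x x v) < x" by blast
  from bchoice[OF this] obtain v where v': "\<forall>x\<in>?S. v x \<in> I x \<and> g (p x x (v x)) < x" ..
  have v: "v x \<in> I x" "g (p x x (v x)) < x" if "x \<in> ?S" for x using bspec[OF v' that] by auto
  obtain \<gamma> where \<gamma>: "stationary {x \<in> ?S. g (p x x (v x)) \<le> \<gamma>}"
    by (rule pressing_down[OF S v(2)]) (assumption, rule that)
  show ?thesis
  proof (rule that[OF \<gamma>])
    show "v x \<in> I x" if "x \<in> {x \<in> ?S. g (p x x (v x)) \<le> \<gamma>}" for x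
      using that v(1)[of x] by simp
    show "g (p x x (v x)) \<le> \<gamma>" if "x \<in> {x \<in> ?S. g (p x x (v x)) \<le> \<gamma>}" for x
      using that by simp
  qed auto
qed

lemma not_bounded_on_club:
  assumes "\<not> bounded_on_club g I"
  shows "stationary {x. \<exists>v\<in>I x. \<gamma> < g (p x x v)}"
proof (rule ccontr)
  assume "\<not> stationary {x. \<exists>v\<in>I x. \<gamma> < g (p x x v)}"
  then obtain C where C: "club C" "\<And>x. x \<in> C \<Longrightarrow> x \<notin> {x. \<exists>v\<in>I x. \<gamma> < g (p x x v)}"
    by (rule not_stationaryE) (rule that)
  have "\<forall>x\<in>C. \<forall>v\<in>I x. g (p x x v) \<le> \<gamma>" using C(2) by (simp add: not_less)
  then have "bounded_on_club g I" unfolding bounded_on_club_def using C(1) by (intro exI conjI)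
  then show False using assms by simp
qed

lemma tube_pos:
  assumes "tube I \<delta>" "\<delta> < x" "v \<in> I x"
  shows "0 < v"
proof -
  obtain l u where "0 < l" "I x = {l..u}" by (rule tube_interval[OF assms(1,2)]) (rule that)
  then show ?thesis using assms(3) by simp
qed

text \<open>Limits are taken along a common subsequence for two vectors at a time, so that a bound on the ratio of
  their coordinates survives. Such a ratio does not depend on the chart.\<close>

lemma tube_limit_pair:
  assumes I: "tube I \<delta>" "\<delta> < x" and s: "\<And>n. \<delta> < s n" "\<And>n. s n < x" "s \<longlonglongrightarrow> x"
    and w: "\<And>n. w n \<in> I (s n)" "\<And>n. w' n \<in> I (s n)"
    and ratio: "\<And>n. w' n \<le> c * w n" "\<And>n. w n \<le> c * w' n"
  obtains r v v' where "strict_mono (r :: nat \<Rightarrow> nat)" "v \<in> I x" "v' \<in> I x" "v' \<le> c * v" "v \<le> c * v'"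
    "(\<lambda>n. g (p (s (r n)) (s (r n)) (w (r n)))) \<longlonglongrightarrow> g (p x x v)"
    "(\<lambda>n. g (p (s (r n)) (s (r n)) (w' (r n)))) \<longlonglongrightarrow> g (p x x v')"
proof -
  have bx: "bot < x" by (rule bot_less_of_less[OF I(2)])
  have bs: "bot < s n" for n by (rule bot_less_of_less[OF s(1)])
  define K where "K n = k x (s n) (s n)" for n
  obtain r1 v where r1: "strict_mono r1" "v \<in> I x" "(\<lambda>n. K (r1 n) * w (r1 n)) \<longlonglongrightarrow> v"
    unfolding K_def by (rule tube_limit[OF I, of s w]) (simp add: s w, rule s, rule that[unfolded K_def])
  have s1: "(\<lambda>n. s (r1 n)) \<longlonglongrightarrow> x" using LIMSEQ_subseq_LIMSEQ[OF s(3) r1(1)] by (simp add: o_def)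
  obtain r2 v' where r2: "strict_mono r2" "v' \<in> I x" "(\<lambda>n. K (r1 (r2 n)) * w' (r1 (r2 n))) \<longlonglongrightarrow> v'"
    unfolding K_def by (rule tube_limit[OF I, of "\<lambda>n. s (r1 n)" "\<lambda>n. w' (r1 n)"])
      (simp add: s w, rule s1, rule that[unfolded K_def])
  define r where "r = r1 \<circ> r2"
  have r: "strict_mono r" unfolding r_def by (rule strict_mono_o[OF r1(1) r2(1)])
  have sr: "(\<lambda>n. s (r n)) \<longlonglongrightarrow> x" using LIMSEQ_subseq_LIMSEQ[OF s(3) r] by (simp add: o_def)
  have l: "(\<lambda>n. K (r n) * w (r n)) \<longlonglongrightarrow> v" "(\<lambda>n. K (r n) * w' (r n)) \<longlonglongrightarrow> v'"
    using LIMSEQ_subseq_LIMSEQ[OF r1(3) r2(1)] r2(3) by (simp_all add: r_def o_def)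
  have "\<forall>\<^sub>F n in sequentially. s (r n) \<in> {a x<..<b x}"
    by (rule topological_tendstoD[OF sr _ mem_chart[OF bx]]) simp
  then have "\<forall>\<^sub>F n in sequentially. 0 < K (r n) \<and>
      (\<forall>z. p x (s (r n)) (K (r n) * z) = p (s (r n)) (s (r n)) z)"
  proof eventually_elim
    case (elim n)
    show ?case
      unfolding K_def using transition[OF bx bs elim mem_chart[OF bs]] k_pos[OF bx bs elim mem_chart[OF bs]] by simp
  qed
  then obtain N where N: "\<And>n. N \<le> n \<Longrightarrow> 0 < K (r n)"
     "\<And>n z. N \<le> n \<Longrightarrow> p x (s (r n)) (K (r n) * z) = p (s (r n)) (s (r n)) z"
    unfolding eventually_sequentially by blast
  show ?thesis
  proof (rule that[OF r r1(2) r2(2)])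
    show "v' \<le> c * v"
    proof (rule LIMSEQ_le[OF l(2) tendsto_mult_left[OF l(1)]], intro exI[of _ N] allI impI)
      show "K (r n) * w' (r n) \<le> c * (K (r n) * w (r n))" if "N \<le> n" for n
        using mult_left_mono[OF ratio(1)[of "r n"], of "K (r n)"] N(1)[OF that] by (simp add: algebra_simps)
    qed
    show "v \<le> c * v'"
    proof (rule LIMSEQ_le[OF l(1) tendsto_mult_left[OF l(2)]], intro exI[of _ N] allI impI)
      show "K (r n) * w (r n) \<le> c * (K (r n) * w' (r n))" if "N \<le> n" for n
        using mult_left_mono[OF ratio(2)[of "r n"], of "K (r n)"] N(1)[OF that] by (simp add: algebra_simps)
    qed
    have *: "(\<lambda>n. g (p (s (r n)) (s (r n)) (u (r n)))) \<longlonglongrightarrow> g (p x x z)"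
      if "(\<lambda>n. K (r n) * u (r n)) \<longlonglongrightarrow> z" "0 < z" for u z
    proof (rule Lim_transform_eventually[OF g_seq_limit[OF bx that(2) sr that(1)]])
      show "\<forall>\<^sub>F n in sequentially. g (p x (s (r n)) (K (r n) * u (r n))) = g (p (s (r n)) (s (r n)) (u (r n)))"
        unfolding eventually_sequentially by (intro exI[of _ N] allI impI) (simp only: N(2))
    qed
    show "(\<lambda>n. g (p (s (r n)) (s (r n)) (w (r n)))) \<longlonglongrightarrow> g (p x x v)"
      "(\<lambda>n. g (p (s (r n)) (s (r n)) (w' (r n)))) \<longlonglongrightarrow> g (p x x v')"
      by (intro * l tube_pos[OF I r1(2)] tube_pos[OF I r2(2)])+
  qed
qed

lemma tube_limit_bounded:
  assumes I: "tube I \<delta>" "\<delta> < x" and x: "x \<in> limits S"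
    and S: "\<And>y. y \<in> S \<Longrightarrow> \<delta> < y \<and> w y \<in> I y \<and> g (p y y (w y)) \<le> \<gamma>"
  shows "\<exists>v\<in>I x. g (p x x v) \<le> \<gamma>"
proof -
  have bx: "bot < x" by (rule bot_less_of_less[OF I(2)])
  obtain s where s: "\<And>n. s n \<in> S" "\<And>n. s n < x" "s \<longlonglongrightarrow> x"
  proof (rule longray_limit_sequence[OF bx, of S])
    show "\<exists>z. z \<in> S \<and> y < z \<and> z < x" if "y < x" for y
      by (rule limitsE[OF x that]) blast
  qed (rule that)
  have S': "\<delta> < s n" "w (s n) \<in> I (s n)" "g (p (s n) (s n) (w (s n))) \<le> \<gamma>" for n
    using S[OF s(1)[of n]] by simp_all
  obtain r v where r: "v \<in> I x" "(\<lambda>n. g (p (s (r n)) (s (r n)) (w (s (r n))))) \<longlonglongrightarrow> g (p x x v)"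
    by (rule tube_limit_pair[OF I S'(1) s(2,3) S'(2) S'(2), of 1]) (simp, simp, rule that)
  have "g (p x x v) \<le> \<gamma>" by (rule LIMSEQ_le_const2[OF r(2)]) (use S'(3) in simp)
  then show ?thesis using r(1) ..
qed

lemma tube_limit_unbounded:
  assumes I: "tube I \<delta>" "\<delta> < x"
    and x: "\<And>y. y < x \<Longrightarrow> \<exists>z. y < z \<and> z < x \<and> \<delta> < z \<and> (\<exists>v\<in>I z. y < g (p z z v))"
  shows "\<exists>v\<in>I x. x \<le> g (p x x v)"
proof -
  have bx: "bot < x" by (rule bot_less_of_less[OF I(2)])
  obtain t where t: "\<And>n. t n < x" "t \<longlonglongrightarrow> x"
  proof (rule longray_limit_sequence[OF bx, of UNIV])
    show "\<exists>z. z \<in> UNIV \<and> y < z \<and> z < x" if "y < x" for y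
      using dense[OF that] by simp
  qed (rule that)
  have "\<forall>n. \<exists>z. t n < z \<and> z < x \<and> \<delta> < z \<and> (\<exists>w\<in>I z. t n < g (p z z w))"
    using x[OF t(1)] by blast
  from choice[OF this] obtain s where
    s0: "\<forall>n. t n < s n \<and> s n < x \<and> \<delta> < s n \<and> (\<exists>w\<in>I (s n). t n < g (p (s n) (s n) w))" ..
  then have "\<forall>n. \<exists>w. w \<in> I (s n) \<and> t n < g (p (s n) (s n) w)" by blast
  from choice[OF this] obtain w where "\<forall>n. w n \<in> I (s n) \<and> t n < g (p (s n) (s n) (w n))" ..
  then have s: "t n < s n \<and> s n < x \<and> \<delta> < s n \<and> w n \<in> I (s n) \<and> t n < g (p (s n) (s n) (w n))" for n
    using s0 by simp
  have sl: "s \<longlonglongrightarrow> x"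
    by (rule tendsto_sandwich[OF _ _ t(2) tendsto_const[of x]])
      (use s in \<open>simp_all add: less_imp_le\<close>)
  have s': "\<delta> < s n" "s n < x" "w n \<in> I (s n)" "t n \<le> g (p (s n) (s n) (w n))" for n
    using s[of n] by (simp_all add: less_imp_le)
  obtain r v where r: "strict_mono r" "v \<in> I x" "(\<lambda>n. g (p (s (r n)) (s (r n)) (w (r n)))) \<longlonglongrightarrow> g (p x x v)"
    by (rule tube_limit_pair[OF I s'(1,2) sl s'(3) s'(3), of 1]) (simp, simp, rule that)
  have "(\<lambda>n. t (r n)) \<longlonglongrightarrow> x" using LIMSEQ_subseq_LIMSEQ[OF t(2) r(1)] by (simp add: o_def)
  then have "x \<le> g (p x x v)"
    by (rule LIMSEQ_le[OF _ r(3)]) (use s'(4) in simp)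
  then show ?thesis using r(2) by blast
qed

text \<open>A property that holds at one point of an interval and fails at another changes between points of
  ratio arbitrarily close to 1, since otherwise it would be locally constant.\<close>

lemma close_pair:
  fixes P :: "real \<Rightarrow> bool"
  assumes "0 < l" "u \<in> {l..h}" "u' \<in> {l..h}" "P u" "\<not> P u'" "1 < c"
  obtains v v' where "v \<in> {l..h}" "v' \<in> {l..h}" "P v" "\<not> P v'" "v' \<le> c * v" "v \<le> c * v'"
proof (rule ccontr)
  note found = that
  assume none: "\<not> thesis"
  have "P u'"
  proof (rule connected_induction_simple[of "{l..h}" u u' P])
    fix z assume z: "z \<in> {l..h}"
    \<comment> \<open>Two points within the factor \<open>e\<close> of \<open>z\<close> are within the factor \<open>c\<close> of each other.\<close>
    define e where "e = sqrt c"
    have e: "1 < e" "e * e = c" using \<open>1 < c\<close> by (simp_all add: e_def)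
    have z0: "0 < z" using z \<open>0 < l\<close> by auto
    show "\<exists>T. openin (top_of_set {l..h}) T \<and> z \<in> T \<and> (\<forall>x\<in>T. \<forall>y\<in>T. P x \<longrightarrow> P y)"
    proof (intro exI[of _ "{l..h} \<inter> {z / e<..<z * e}"] conjI ballI impI)
      show "z \<in> {l..h} \<inter> {z / e<..<z * e}" using z z0 e by (auto simp: field_simps)
      fix x y assume xy: "x \<in> {l..h} \<inter> {z / e<..<z * e}" "y \<in> {l..h} \<inter> {z / e<..<z * e}" "P x"
      have "w \<le> c * w'" if "w \<in> {z / e<..<z * e}" "w' \<in> {z / e<..<z * e}" for w w'
      proof -
        have "w \<le> e * z" using that by (simp add: mult.commute)
        also have "\<dots> \<le> e * (e * w')" using that e by (intro mult_left_mono) (auto simp: field_simps)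
        finally show ?thesis using e(2) by (simp add: mult.assoc[symmetric])
      qed
      then show "P y" using found[of x y] none xy by blast
    qed (rule openin_open_Int, simp)
  qed (use assms in auto)
  then show False using assms by simp
qed

text \<open>Assume that both alternatives fail. By compactness of the tube, over every point \<open>x\<close> of a club
  there are a vector of the tube on which \<open>g\<close> is at most some fixed \<open>\<gamma>\<close> and one that \<open>g\<close>
  sends to \<open>x\<close>. Hence for each \<open>m\<close> there are two vectors over \<open>x\<close>, of ratio at most
  \<open>1 + 1 / (m + 1)\<close>, of which \<open>g\<close> sends one below \<open>x\<close> and the other to \<open>x\<close>. Pressing down bounds
  the smaller value on a stationary set, and the bounds for all \<open>m\<close> have a common bound \<open>\<Gamma>\<close>. Over a
  point \<open>x > \<Gamma>\<close> that is a limit of all these stationary sets, limits of such pairs exist for every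
  \<open>m\<close>; letting \<open>m\<close> tend to infinity gives a single vector that \<open>g\<close> sends both below \<open>\<Gamma>\<close> and to \<open>x\<close>.\<close>

lemma tube_dichotomy:
  assumes I: "tube I \<delta>"
  shows "fixed_on_club g (\<lambda>x. if \<delta> < x then I x else {}) \<or> bounded_on_club g (\<lambda>x. if \<delta> < x then I x else {})"
    (is "fixed_on_club g ?I \<or> bounded_on_club g ?I")
proof (rule ccontr)
  assume "\<not> ?thesis"
  then have nf: "\<not> fixed_on_club g ?I" and nb: "\<not> bounded_on_club g ?I" by auto
  have Ipos: "0 < v" if "v \<in> ?I x" for x v
    using that tube_pos[OF I, of x v] by (simp split: if_splits)
  obtain \<gamma> S u where S: "stationary S" "\<And>x. x \<in> S \<Longrightarrow> u x \<in> ?I x" "\<And>x. x \<in> S \<Longrightarrow> g (p x x (u x)) \<le> \<gamma>"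
    by (rule not_fixed_on_club[OF nf]) (erule Ipos, rule that)
  have S': "\<delta> < y \<and> u y \<in> I y \<and> g (p y y (u y)) \<le> \<gamma>" if "y \<in> S" for y
    using S(2,3)[OF that] by (simp split: if_splits)
  have low: "\<exists>v\<in>I x. g (p x x v) \<le> \<gamma>" if "x \<in> limits S" "\<delta> < x" for x
    by (rule tube_limit_bounded[OF I that(2,1) S'])
  \<comment> \<open>At a limit of vectors whose values climb to the limit of their base points, \<open>g\<close> takes this limit as its value.\<close>
  define Q where "Q y z \<longleftrightarrow> \<delta> < z \<and> (\<exists>v\<in>I z. y < g (p z z v))" for y z
  define K where "K = {x. bot < x \<and> (\<forall>y<x. \<exists>z. y < z \<and> z < x \<and> Q y z)}"
  have "club K"
    unfolding K_def
  proof (rule club_diagonal)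
    fix y
    obtain z where "z \<in> {x. \<exists>v\<in>?I x. y < g (p x x v)}" "y < z"
      using stationary_unbounded[OF not_bounded_on_club[OF nb]] by blast
    then have "Q y z" unfolding Q_def by (auto split: if_splits)
    then show "\<exists>z>y. Q y z" using \<open>y < z\<close> by blast
  next
    fix y y' z assume "Q y z" "y' \<le> y"
    then obtain v where "\<delta> < z" "v \<in> I z" "y < g (p z z v)" unfolding Q_def by blast
    then show "Q y' z" unfolding Q_def using \<open>y' \<le> y\<close> by (intro conjI bexI[of _ v]) simp_all
  qed
  have high: "\<exists>v\<in>I x. x \<le> g (p x x v)" if "x \<in> K" "\<delta> < x" for x
    by (rule tube_limit_unbounded[OF I that(2)]) (use that(1) in \<open>simp add: K_def Q_def\<close>)
  define C where "C = limits S \<inter> K \<inter> trapping \<inter> {max \<delta> \<gamma><..}"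
  have C: "club C"
    unfolding C_def by (intro club_Int club_limits_stationary S(1) \<open>club K\<close> club_trapping club_greaterThan)
  define c where "c m = 1 + 1 / real (Suc m)" for m
  define R where "R m x v v' \<longleftrightarrow> v \<in> I x \<and> v' \<in> I x \<and> g (p x x v) < x \<and> g (p x x v') = x \<and>
      v' \<le> c m * v \<and> v \<le> c m * v'" for m x v v'
  have ex: "\<exists>v v'. R m x v v'"
    if x: "x \<in> C" for x m
  proof -
    have d: "\<delta> < x" "\<gamma> < x" using x by (auto simp: C_def)
    obtain l h where lh: "0 < l" "I x = {l..h}" by (rule tube_interval[OF I d(1)]) (rule that)
    have le: "g (p x x v) \<le> x" if "v \<in> I x" for v
      using trapping_le[of x v] x that lh by (auto simp: C_def)
    obtain w where w: "w \<in> {l..h}" "g (p x x w) < x" using low[of x] x d lh by (auto simp: C_def)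
    obtain w' where w': "w' \<in> {l..h}" "\<not> g (p x x w') < x" using high[of x] x d lh by (auto simp: C_def not_less)
    have "1 < c m" by (simp add: c_def)
    obtain v v' where "v \<in> {l..h}" "v' \<in> {l..h}" "g (p x x v) < x" "\<not> g (p x x v') < x"
      "v' \<le> c m * v" "v \<le> c m * v'"
      by (rule close_pair[OF lh(1) w(1) w'(1), of "\<lambda>v. g (p x x v) < x" "c m"])
        (rule w(2), rule w'(2), rule \<open>1 < c m\<close>, rule that)
    then have "R m x v v'" unfolding R_def using le[of v'] lh(2) by simp
    then show ?thesis by blast
  qed
  define v where "v m x = (SOME v. \<exists>v'. R m x v v')" for m x
  define v' where "v' m x = (SOME v'. R m x (v m x) v')" for m x
  have "R m x (v m x) (v' m x)" if "x \<in> C" for m x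
    unfolding v'_def by (rule someI_ex) (unfold v_def, rule someI_ex[OF ex[OF that]])
  then have v: "v m x \<in> I x" "v' m x \<in> I x" "g (p x x (v m x)) < x" "g (p x x (v' m x)) = x"
      "v' m x \<le> c m * v m x" "v m x \<le> c m * v' m x" if "x \<in> C" for m x
    using that unfolding R_def by blast+
  have "\<exists>\<gamma>. stationary {x \<in> C. g (p x x (v m x)) \<le> \<gamma>}" for m
    by (rule pressing_down[OF club_imp_stationary[OF C] v(3)]) (assumption, rule exI)
  then have "\<forall>m. \<exists>\<gamma>. stationary {x \<in> C. g (p x x (v m x)) \<le> \<gamma>}" ..
  from choice[OF this] obtain G where G': "\<forall>m. stationary {x \<in> C. g (p x x (v m x)) \<le> G m}" ..
  then have G: "stationary {x \<in> C. g (p x x (v m x)) \<le> G m}" for m by simp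
  obtain \<Gamma> where \<Gamma>: "\<And>e. e \<in> range G \<Longrightarrow> e < \<Gamma>"
    by (rule longray_countable_bounded[of "range G"]) (simp, rule that)
  have "club ((\<Inter>m. limits {x \<in> C. g (p x x (v m x)) \<le> G m}) \<inter> {max \<Gamma> \<delta><..})"
    by (intro club_Int club_INT club_limits_stationary G club_greaterThan)
  from club_unbounded[OF this, of bot] obtain x where
    "x \<in> (\<Inter>m. limits {x \<in> C. g (p x x (v m x)) \<le> G m}) \<inter> {max \<Gamma> \<delta><..}" by blast
  then have x: "\<And>m. x \<in> limits {x \<in> C. g (p x x (v m x)) \<le> G m}" "\<Gamma> < x" "\<delta> < x" by simp_all
  have bx: "bot < x" by (rule bot_less_of_less[OF x(2)])
  define T where "T m w w' \<longleftrightarrow> w \<in> I x \<and> w' \<le> c m * w \<and> w \<le> c m * w' \<and>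
      g (p x x w) \<le> \<Gamma> \<and> g (p x x w') = x" for m w w'
  have T: "\<exists>w w'. T m w w'" for m
  proof -
    obtain s where s: "\<And>n. s n \<in> {x \<in> C. g (p x x (v m x)) \<le> G m}" "\<And>n. s n < x" "s \<longlonglongrightarrow> x"
    proof (rule longray_limit_sequence[OF bx, of "{x \<in> C. g (p x x (v m x)) \<le> G m}"])
      show "\<exists>z. z \<in> {x \<in> C. g (p x x (v m x)) \<le> G m} \<and> y < z \<and> z < x" if "y < x" for y
        by (rule limitsE[OF x(1)[of m] that]) blast
    qed (rule that)
    have sC: "s n \<in> C" "g (p (s n) (s n) (v m (s n))) \<le> G m" for n using s(1) by auto
    have s\<delta>: "\<delta> < s n" for n using sC(1)[of n] by (simp add: C_def)
    obtain r w w' where r: "strict_mono r" "w \<in> I x" "w' \<in> I x" "w' \<le> c m * w" "w \<le> c m * w'"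
      "(\<lambda>n. g (p (s (r n)) (s (r n)) (v m (s (r n))))) \<longlonglongrightarrow> g (p x x w)"
      "(\<lambda>n. g (p (s (r n)) (s (r n)) (v' m (s (r n))))) \<longlonglongrightarrow> g (p x x w')"
      by (rule tube_limit_pair[OF I x(3) s\<delta> s(2,3), of "\<lambda>n. v m (s n)" "\<lambda>n. v' m (s n)" "c m"])
        (rule v[OF sC(1)], rule v[OF sC(1)], rule v[OF sC(1)], rule v[OF sC(1)], rule that)
    have "g (p x x w) \<le> G m" by (rule LIMSEQ_le_const2[OF r(6)]) (use sC(2) in blast)
    then have "g (p x x w) \<le> \<Gamma>" using \<Gamma>[of "G m"] by auto
    moreover have "g (p x x w') = x"
    proof (rule LIMSEQ_unique[OF r(7)])
      have "(\<lambda>n. s (r n)) \<longlonglongrightarrow> x" using LIMSEQ_subseq_LIMSEQ[OF s(3) r(1)] by (simp add: o_def)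
      then show "(\<lambda>n. g (p (s (r n)) (s (r n)) (v' m (s (r n))))) \<longlonglongrightarrow> x" using v[OF sC(1)] by simp
    qed
    ultimately have "T m w w'" unfolding T_def using r by simp
    then show ?thesis by blast
  qed
  define w where "w m = (SOME w. \<exists>w'. T m w w')" for m
  define w' where "w' m = (SOME w'. T m (w m) w')" for m
  have "T m (w m) (w' m)" for m
    unfolding w'_def by (rule someI_ex) (unfold w_def, rule someI_ex[OF T])
  then have w: "w m \<in> I x" "w' m \<le> c m * w m" "w m \<le> c m * w' m"
      "g (p x x (w m)) \<le> \<Gamma>" "g (p x x (w' m)) = x" for m
    unfolding T_def by blast+
  obtain l h where lh: "0 < l" "I x = {l..h}" by (rule tube_interval[OF I x(3)]) (rule that)
  have comp: "compact (I x)" unfolding lh by simp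
  obtain z r where z: "z \<in> I x" "strict_mono r" "(w \<circ> r) \<longlonglongrightarrow> z"
    by (rule seq_compactE[OF compact_imp_seq_compact[OF comp], of w]) (use w(1) in simp, rule that)
  have c1: "(\<lambda>m. c (r m)) \<longlonglongrightarrow> 1"
  proof -
    have "c \<longlonglongrightarrow> 1" unfolding c_def using LIMSEQ_inverse_real_of_nat_add[of 1] by (simp add: inverse_eq_divide)
    then show ?thesis using LIMSEQ_subseq_LIMSEQ[OF _ z(2), of c 1] by (simp add: o_def)
  qed
  have wl: "(\<lambda>m. w (r m)) \<longlonglongrightarrow> z" using z(3) by (simp add: o_def)
  have cpos: "0 < c m" for m by (simp add: c_def add_pos_pos)
  have wl': "(\<lambda>m. w' (r m)) \<longlonglongrightarrow> z"
  proof (rule tendsto_sandwich)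
    show "\<forall>\<^sub>F m in sequentially. w (r m) / c (r m) \<le> w' (r m)"
      using w cpos by (auto simp: divide_le_eq mult.commute)
    show "\<forall>\<^sub>F m in sequentially. w' (r m) \<le> c (r m) * w (r m)" using w by auto
    show "(\<lambda>m. w (r m) / c (r m)) \<longlonglongrightarrow> z" using tendsto_divide[OF wl c1] by simp
    show "(\<lambda>m. c (r m) * w (r m)) \<longlonglongrightarrow> z" using tendsto_mult[OF c1 wl] by simp
  qed
  have z0: "0 < z" using z(1) lh by auto
  have "g (p x x z) \<le> \<Gamma>"
    by (rule LIMSEQ_le_const2[OF g_seq_limit[OF bx z0 tendsto_const wl]]) (use w in blast)
  moreover have "g (p x x z) = x"
    by (rule LIMSEQ_unique[OF g_seq_limit[OF bx z0 tendsto_const wl']]) (use w in simp)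
  ultimately show False using x(2) by simp
qed

end

section \<open>The projection of a line bundle is not null-homotopic\<close>

context longray_line_bundle_map
begin

text \<open>Continuity extends a vector over \<open>x\<close> to a section over an interval to the left of \<open>x\<close>, and
  pressing down makes the left end point common to a stationary set of \<open>x\<close>.\<close>

lemma long_sections:
  assumes S: "stationary S" and U: "open U"
    and v: "\<And>x. x \<in> S \<Longrightarrow> bot < x" "\<And>x. x \<in> S \<Longrightarrow> 0 < v x" "\<And>x. x \<in> S \<Longrightarrow> g (p x x (v x)) \<in> U"
  obtains d S' where "stationary S'" "S' \<subseteq> S"
    "\<And>x y. x \<in> S' \<Longrightarrow> d < y \<Longrightarrow> y \<le> x \<Longrightarrow> y \<in> {a x<..<b x} \<and> g (p x y (v x)) \<in> U"
proof -
  define Q where "Q x d \<longleftrightarrow> d < x \<and> (\<forall>y. d < y \<longrightarrow> y \<le> x \<longrightarrow> y \<in> {a x<..<b x} \<and> g (p x y (v x)) \<in> U)" for x d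
  have ex: "\<exists>d. Q x d" if x: "x \<in> S" for x
    unfolding Q_def by (rule g_left[OF v(1)[OF x] v(2)[OF x] U v(3)[OF x]]) blast
  have Q: "Q x (SOME d. Q x d)" if "x \<in> S" for x by (rule someI_ex[OF ex[OF that]])
  define d where "d x = (SOME d. Q x d)" for x
  have d: "d x < x" "\<And>y. d x < y \<Longrightarrow> y \<le> x \<Longrightarrow> y \<in> {a x<..<b x} \<and> g (p x y (v x)) \<in> U" if "x \<in> S" for x
    using Q[OF that] unfolding d_def[symmetric] unfolding Q_def by simp_all
  obtain \<gamma> where \<gamma>: "stationary {x \<in> S. d x \<le> \<gamma>}" by (rule pressing_down[OF S d(1)]) (assumption, rule that)
  show ?thesis
  proof (rule that[OF \<gamma>])
    show "y \<in> {a x<..<b x} \<and> g (p x y (v x)) \<in> U" if "x \<in> {x \<in> S. d x \<le> \<gamma>}" "\<gamma> < y" "y \<le> x" for x y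
    proof (rule d(2))
      show "d x < y" using that by auto
    qed (use that in auto)
  qed simp
qed

text \<open>An open subset of the fibre over \<open>\<delta>\<close> has only countably many components, so stationarily many of
  the given points share one. The component is represented by the rational number \<open>q\<close>.\<close>

lemma common_component:
  assumes \<delta>: "bot < \<delta>" and S: "stationary S" and U: "open U"
    and e: "\<And>x. x \<in> S \<Longrightarrow> 0 < e x" "\<And>x. x \<in> S \<Longrightarrow> g (p \<delta> \<delta> (e x)) \<in> U"
  obtains q S' where "stationary S'" "S' \<subseteq> S" "\<And>x. x \<in> S' \<Longrightarrow> e x < q"
    "\<And>x w. x \<in> S' \<Longrightarrow> e x \<le> w \<Longrightarrow> w \<le> q \<Longrightarrow> g (p \<delta> \<delta> w) \<in> U"
proof -
  define Q where "Q x q \<longleftrightarrow> q \<in> \<rat> \<and> e x < q \<and> (\<forall>w. e x \<le> w \<longrightarrow> w \<le> q \<longrightarrow> g (p \<delta> \<delta> w) \<in> U)" for x q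
  have op: "open ((\<lambda>w. g (p \<delta> \<delta> w)) -` U \<inter> {0<..})"
    using U continuous_on_open_vimage[of "{0<..}" "\<lambda>w. g (p \<delta> \<delta> w)"] g_fiber_continuous[OF \<delta>] by simp
  have ex: "\<exists>q. Q x q" if x: "x \<in> S" for x
  proof -
    have "e x \<in> (\<lambda>w. g (p \<delta> \<delta> w)) -` U \<inter> {0<..}" using e[OF x] by simp
    then obtain b where b: "e x < b" "{e x..<b} \<subseteq> (\<lambda>w. g (p \<delta> \<delta> w)) -` U \<inter> {0<..}"
      using open_right[OF op, of "e x" "e x + 1"] by auto
    obtain q where "q \<in> \<rat>" "e x < q" "q < b" using Rats_dense_in_real[OF b(1)] by blast
    then have "Q x q" unfolding Q_def using b(2) by force
    then show ?thesis ..
  qed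
  have Q: "Q x (SOME q. Q x q)" if "x \<in> S" for x by (rule someI_ex[OF ex[OF that]])
  define h where "h x = (SOME q. Q x q)" for x
  have h: "h x \<in> \<rat>" "e x < h x" "\<And>w. e x \<le> w \<Longrightarrow> w \<le> h x \<Longrightarrow> g (p \<delta> \<delta> w) \<in> U" if "x \<in> S" for x
    using Q[OF that] unfolding h_def[symmetric] unfolding Q_def by simp_all
  obtain q where q: "stationary {x \<in> S. h x = q}"
    by (rule stationary_countable_split[OF S countable_rat h(1)]) (assumption, rule that)
  show ?thesis
  proof (rule that[OF q])
    show "e x < q" if "x \<in> {x \<in> S. h x = q}" for x using h(2)[of x] that by simp
    show "g (p \<delta> \<delta> w) \<in> U" if "x \<in> {x \<in> S. h x = q}" "e x \<le> w" "w \<le> q" for x w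
      using h(3)[of x w] that by simp
  qed auto
qed

text \<open>If \<open>g\<close> is neither like the projection nor like a bounded map, then for some \<open>\<gamma>\<close> there are vectors with
  \<open>g < \<gamma>\<close> and vectors with \<open>g > \<gamma>\<close> over stationary sets. They extend to sections over long
  intervals; over a common left end point those of one kind can be taken in a single component, so
  that one kind lies entirely on one side of the other, and a tube runs between them.\<close>

lemma tube_exists:
  assumes nf: "\<not> fixed_on_club g (\<lambda>_. {0<..})" and nb: "\<not> bounded_on_club g (\<lambda>_. {0<..})"
  obtains I \<delta> where "tube I \<delta>"
proof -
  obtain \<gamma>0 S1 v1 where S1: "stationary S1" "S1 \<subseteq> trapping" "\<And>x. x \<in> S1 \<Longrightarrow> v1 x \<in> {0<..}"
    "\<And>x. x \<in> S1 \<Longrightarrow> g (p x x (v1 x)) \<le> \<gamma>0"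
    by (rule not_fixed_on_club[OF nf]) (simp, rule that)
  obtain \<gamma> where \<gamma>: "\<gamma>0 < \<gamma>" using gt_ex by blast
  have S1': "bot < x" "0 < v1 x" "g (p x x (v1 x)) \<in> {..<\<gamma>}" if "x \<in> S1" for x
    using S1(2) S1(3)[OF that] S1(4)[OF that] \<gamma> that by (auto simp: trapping_def)
  define S2 where "S2 = {x. \<exists>v\<in>{0<..}. \<gamma> < g (p x x v)} \<inter> {bot<..}"
  have S2: "stationary S2"
    unfolding S2_def by (rule stationary_Int_club[OF not_bounded_on_club[OF nb] club_greaterThan])
  have "\<forall>x\<in>S2. \<exists>v. 0 < v \<and> \<gamma> < g (p x x v)" by (auto simp: S2_def)
  from bchoice[OF this] obtain v2 where v2: "\<forall>x\<in>S2. 0 < v2 x \<and> \<gamma> < g (p x x (v2 x))" ..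
  have S2': "bot < x" "0 < v2 x" "g (p x x (v2 x)) \<in> {\<gamma><..}" if "x \<in> S2" for x
    using bspec[OF v2 that] that by (simp_all add: S2_def)
  obtain d1 S1a where S1a: "stationary S1a" "S1a \<subseteq> S1"
    "\<And>x y. x \<in> S1a \<Longrightarrow> d1 < y \<Longrightarrow> y \<le> x \<Longrightarrow> y \<in> {a x<..<b x} \<and> g (p x y (v1 x)) \<in> {..<\<gamma>}"
    by (rule long_sections[OF S1(1) open_lessThan S1']) (assumption, assumption, assumption, rule that)
  obtain d2 S2a where S2a: "stationary S2a" "S2a \<subseteq> S2"
    "\<And>x y. x \<in> S2a \<Longrightarrow> d2 < y \<Longrightarrow> y \<le> x \<Longrightarrow> y \<in> {a x<..<b x} \<and> g (p x y (v2 x)) \<in> {\<gamma><..}"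
    by (rule long_sections[OF S2 open_greaterThan S2']) (assumption, assumption, assumption, rule that)
  obtain \<delta> where "max d1 d2 < \<delta>" using gt_ex by blast
  then have \<delta>: "d1 < \<delta>" "d2 < \<delta>" by simp_all
  have b\<delta>: "bot < \<delta>" by (rule bot_less_of_less[OF \<delta>(1)])
  \<comment> \<open>The coordinate over \<open>\<delta>\<close>, in the chart at \<open>\<delta>\<close>, of the section with the constant coordinate \<open>v x\<close> in the chart at \<open>x\<close>.\<close>
  define e where "e v x = k \<delta> x \<delta> * v x" for v x
  have e: "0 < e v x" "p \<delta> \<delta> (e v x) = p x \<delta> (v x)"
    if "\<delta> \<in> {a x<..<b x}" "bot < x" "0 < v x" for v x
    using transition[OF b\<delta> that(2) mem_chart[OF b\<delta>] that(1), of "v x"]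
      k_pos[OF b\<delta> that(2) mem_chart[OF b\<delta>] that(1)] that(3) by (simp_all add: e_def)
  have T1: "\<delta> < x" "bot < x" "0 < v1 x" "\<delta> \<in> {a x<..<b x}" "0 < e v1 x" "g (p \<delta> \<delta> (e v1 x)) \<in> {..<\<gamma>}"
    if x: "x \<in> S1a \<inter> {\<delta><..}" for x
  proof -
    have x': "x \<in> S1a" "x \<in> S1" "\<delta> < x" using x S1a(2) by auto
    note * = S1'(1,2)[OF x'(2)] S1a(3)[OF x'(1) \<delta>(1) less_imp_le[OF x'(3)]]
    show "\<delta> < x" "bot < x" "0 < v1 x" "\<delta> \<in> {a x<..<b x}" using * x' by simp_all
    then show "0 < e v1 x" "g (p \<delta> \<delta> (e v1 x)) \<in> {..<\<gamma>}" using e[of x v1] * by simp_all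
  qed
  have T2: "\<delta> < x" "bot < x" "0 < v2 x" "\<delta> \<in> {a x<..<b x}" "0 < e v2 x" "g (p \<delta> \<delta> (e v2 x)) \<in> {\<gamma><..}"
    if x: "x \<in> S2a \<inter> {\<delta><..}" for x
  proof -
    have x': "x \<in> S2a" "x \<in> S2" "\<delta> < x" using x S2a(2) by auto
    note * = S2'(1,2)[OF x'(2)] S2a(3)[OF x'(1) \<delta>(2) less_imp_le[OF x'(3)]]
    show "\<delta> < x" "bot < x" "0 < v2 x" "\<delta> \<in> {a x<..<b x}" using * x' by simp_all
    then show "0 < e v2 x" "g (p \<delta> \<delta> (e v2 x)) \<in> {\<gamma><..}" using e[of x v2] * by simp_all
  qed
  obtain q1 R1 where R1: "stationary R1" "R1 \<subseteq> S1a \<inter> {\<delta><..}" "\<And>x. x \<in> R1 \<Longrightarrow> e v1 x < q1"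
    "\<And>x w. x \<in> R1 \<Longrightarrow> e v1 x \<le> w \<Longrightarrow> w \<le> q1 \<Longrightarrow> g (p \<delta> \<delta> w) \<in> {..<\<gamma>}"
    by (rule common_component[OF b\<delta> stationary_Int_club[OF S1a(1) club_greaterThan] open_lessThan T1(5,6)])
      (assumption, assumption, rule that)
  obtain q2 R2 where R2: "stationary R2" "R2 \<subseteq> S2a \<inter> {\<delta><..}" "\<And>x. x \<in> R2 \<Longrightarrow> e v2 x < q2"
    "\<And>x w. x \<in> R2 \<Longrightarrow> e v2 x \<le> w \<Longrightarrow> w \<le> q2 \<Longrightarrow> g (p \<delta> \<delta> w) \<in> {\<gamma><..}"
    by (rule common_component[OF b\<delta> stationary_Int_club[OF S2a(1) club_greaterThan] open_greaterThan T2(5,6)])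
      (assumption, assumption, rule that)
  have sec1: "y \<in> {a x<..<b x}" "g (p x y (v1 x)) < \<gamma>" if "x \<in> R1" "\<delta> \<le> y" "y \<le> x" for x y
    using S1a(3)[of x y] R1(2) that \<delta>(1) by auto
  have sec2: "y \<in> {a x<..<b x}" "\<gamma> < g (p x y (v2 x))" if "x \<in> R2" "\<delta> \<le> y" "y \<le> x" for x y
    using S2a(3)[of x y] R2(2) that \<delta>(2) by auto
  have apart: "\<not> (e v1 x \<le> w \<and> w \<le> q1 \<and> e v2 x' \<le> w \<and> w \<le> q2)" if "x \<in> R1" "x' \<in> R2" for x x' w
    using R1(4)[OF that(1), of w] R2(4)[OF that(2), of w] by auto
  consider "q1 < q2" | "q2 \<le> q1" by linarith
  then show ?thesis
  proof cases
    case 1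
    have less: "e v1 x < e v2 x'" if "x \<in> R1" "x' \<in> R2" for x x'
      using apart[OF that, of q1] apart[OF that, of "e v1 x"] R1(3)[OF that(1)] 1 by linarith
    show ?thesis
    proof (rule tube_between[OF b\<delta>, of R1 R2 v1 v2 "{\<xi>. g \<xi> < \<gamma>}" "{\<xi>. \<gamma> < g \<xi>}"])
      show "\<delta> < x" if "x \<in> R1 \<union> R2" for x using that R1(2) R2(2) by auto
      show "y \<in> {a x<..<b x}" if "x \<in> R1 \<union> R2" "\<delta> \<le> y" "y \<le> x" for x y
        using that(1) sec1(1)[OF _ that(2,3)] sec2(1)[OF _ that(2,3)] by (elim UnE)
      show "k \<delta> x \<delta> * v1 x < k \<delta> x' \<delta> * v2 x'" if "x \<in> R1" "x' \<in> R2" for x x'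
        using less[OF that] by (simp add: e_def)
      show "\<exists>x\<in>R1. y < x" "\<exists>x\<in>R2. y < x" for y
        by (rule stationary_unbounded[OF R1(1)], rule stationary_unbounded[OF R2(1)])
      show "0 < v1 x" if "x \<in> R1" for x using T1(3)[of x] R1(2) that by blast
      show "0 < v2 x" if "x \<in> R2" for x using T2(3)[of x] R2(2) that by blast
    qed (use sec1(2) sec2(2) in auto, rule that)
  next
    case 2
    have less: "e v2 x' < e v1 x" if "x \<in> R1" "x' \<in> R2" for x x'
      using apart[OF that, of q2] apart[OF that, of "e v2 x'"] R2(3)[OF that(2)] 2 by linarith
    show ?thesis
    proof (rule tube_between[OF b\<delta>, of R2 R1 v2 v1 "{\<xi>. \<gamma> < g \<xi>}" "{\<xi>. g \<xi> < \<gamma>}"])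
      show "\<delta> < x" if "x \<in> R2 \<union> R1" for x using that R1(2) R2(2) by auto
      show "y \<in> {a x<..<b x}" if "x \<in> R2 \<union> R1" "\<delta> \<le> y" "y \<le> x" for x y
        using that(1) sec1(1)[OF _ that(2,3)] sec2(1)[OF _ that(2,3)] by (elim UnE)
      show "k \<delta> x \<delta> * v2 x < k \<delta> x' \<delta> * v1 x'" if "x \<in> R2" "x' \<in> R1" for x x'
        using less[OF that(2,1)] by (simp add: e_def)
      show "\<exists>x\<in>R2. y < x" "\<exists>x\<in>R1. y < x" for y
        by (rule stationary_unbounded[OF R2(1)], rule stationary_unbounded[OF R1(1)])
      show "0 < v1 x" if "x \<in> R1" for x using T1(3)[of x] R1(2) that by blast
      show "0 < v2 x" if "x \<in> R2" for x using T2(3)[of x] R2(2) that by blast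
    qed (use sec1(2) sec2(2) in auto, rule that)
  qed
qed

end

context longray_line_bundle
begin

text \<open>The times at which \<open>G\<close> is like the projection and those at which it is like a bounded map form two
  disjoint closed sets; the first contains 0 and the second contains 1, so they cannot cover the
  connected interval.\<close>

lemma dichotomy_impossible:
  fixes G :: "real \<Rightarrow> 'p \<Rightarrow> longray"
  assumes cont: "\<And>x v. bot < x \<Longrightarrow> 0 < v \<Longrightarrow> continuous_on {0..1} (\<lambda>t. G t (p x x v))"
    and G0: "\<And>x v. bot < x \<Longrightarrow> 0 < v \<Longrightarrow> G 0 (p x x v) = x"
    and G1: "\<And>x v. bot < x \<Longrightarrow> 0 < v \<Longrightarrow> G 1 (p x x v) = q"
    and I: "\<And>x. \<delta> < x \<Longrightarrow> I x \<noteq> {}" "\<And>x v. v \<in> I x \<Longrightarrow> 0 < v"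
    and dich: "\<And>t. t \<in> {0..1} \<Longrightarrow> fixed_on_club (G t) I \<or> bounded_on_club (G t) I"
  shows False
proof -
  have lim: "(\<lambda>n. G (t n) (p x x v)) \<longlonglongrightarrow> G t' (p x x v)"
    if "\<And>n. t n \<in> {0..1}" "t' \<in> {0..1}" "t \<longlonglongrightarrow> t'" "bot < x" "0 < v" for t :: "nat \<Rightarrow> real" and t' x v
    by (rule continuous_on_tendsto_compose[OF cont[OF that(4,5)] that(3,2)]) (use that(1) in simp)
  define A where "A = {t \<in> {0..1}. fixed_on_club (G t) I}"
  define B where "B = {t \<in> {0..1}. bounded_on_club (G t) I}"
  have "closed A"
    unfolding closed_sequential_limits
  proof (intro allI impI, elim conjE)
    fix t t' assume t: "\<forall>n. t n \<in> A" "t \<longlonglongrightarrow> t'"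
    have t01: "t n \<in> {0..1}" for n using t(1) by (simp add: A_def)
    have t': "t' \<in> {0..1}" by (rule closed_sequentially[OF closed_atLeastAtMost t01 t(2)])
    have "\<forall>n. \<exists>C. club C \<and> (\<forall>x\<in>C. \<forall>v\<in>I x. G (t n) (p x x v) = x)"
      using t(1) by (simp add: A_def fixed_on_club_def)
    from choice[OF this] obtain C where
      C: "\<forall>n. club (C n) \<and> (\<forall>x\<in>C n. \<forall>v\<in>I x. G (t n) (p x x v) = x)" ..
    have "club ((\<Inter>n. C n) \<inter> {bot<..})" using C by (intro club_Int club_INT club_greaterThan) simp
    moreover have "\<forall>x\<in>(\<Inter>n. C n) \<inter> {bot<..}. \<forall>v\<in>I x. G t' (p x x v) = x"
    proof (intro ballI)
      fix x v assume x: "x \<in> (\<Inter>n. C n) \<inter> {bot<..}" and v: "v \<in> I x"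
      have "(\<lambda>n. G (t n) (p x x v)) \<longlonglongrightarrow> G t' (p x x v)"
        by (rule lim[OF t01 t' t(2) _ I(2)[OF v]]) (use x in simp)
      moreover have "G (t n) (p x x v) = x" for n using C x v by simp
      ultimately show "G t' (p x x v) = x" by (simp add: LIMSEQ_const_iff)
    qed
    ultimately show "t' \<in> A" unfolding A_def fixed_on_club_def using t' by blast
  qed
  moreover have "closed B"
    unfolding closed_sequential_limits
  proof (intro allI impI, elim conjE)
    fix t t' assume t: "\<forall>n. t n \<in> B" "t \<longlonglongrightarrow> t'"
    have t01: "t n \<in> {0..1}" for n using t(1) by (simp add: B_def)
    have t': "t' \<in> {0..1}" by (rule closed_sequentially[OF closed_atLeastAtMost t01 t(2)])
    have "\<forall>n. \<exists>C. club C \<and> (\<exists>\<gamma>. \<forall>x\<in>C. \<forall>v\<in>I x. G (t n) (p x x v) \<le> \<gamma>)"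
      using t(1) by (simp add: B_def bounded_on_club_def)
    from choice[OF this] obtain C where
      C: "\<forall>n. club (C n) \<and> (\<exists>\<gamma>. \<forall>x\<in>C n. \<forall>v\<in>I x. G (t n) (p x x v) \<le> \<gamma>)" ..
    then have "\<forall>n. \<exists>\<gamma>. \<forall>x\<in>C n. \<forall>v\<in>I x. G (t n) (p x x v) \<le> \<gamma>" by blast
    from choice[OF this] obtain \<gamma> where
      \<gamma>: "\<forall>n. \<forall>x\<in>C n. \<forall>v\<in>I x. G (t n) (p x x v) \<le> \<gamma> n" ..
    obtain \<Gamma> where \<Gamma>: "\<And>e. e \<in> range \<gamma> \<Longrightarrow> e < \<Gamma>"
      by (rule longray_countable_bounded[of "range \<gamma>"]) (simp, rule that)
    have "club ((\<Inter>n. C n) \<inter> {bot<..})" using C by (intro club_Int club_INT club_greaterThan) simp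
    moreover have "\<forall>x\<in>(\<Inter>n. C n) \<inter> {bot<..}. \<forall>v\<in>I x. G t' (p x x v) \<le> \<Gamma>"
    proof (intro ballI)
      fix x v assume x: "x \<in> (\<Inter>n. C n) \<inter> {bot<..}" and v: "v \<in> I x"
      have l: "(\<lambda>n. G (t n) (p x x v)) \<longlonglongrightarrow> G t' (p x x v)"
        by (rule lim[OF t01 t' t(2) _ I(2)[OF v]]) (use x in simp)
      have "G (t n) (p x x v) \<le> \<gamma> n" for n using \<gamma> x v by simp
      moreover have "\<gamma> n \<le> \<Gamma>" for n using \<Gamma>[of "\<gamma> n"] by simp
      ultimately have "G (t n) (p x x v) \<le> \<Gamma>" for n by (rule order_trans)
      then show "G t' (p x x v) \<le> \<Gamma>" by (intro LIMSEQ_le_const2[OF l]) simp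
    qed
    ultimately show "t' \<in> B" unfolding B_def bounded_on_club_def using t' by blast
  qed
  moreover have "{0..1} \<subseteq> A \<union> B" unfolding A_def B_def using dich by blast
  moreover have "A \<inter> B = {}"
  proof (rule ccontr)
    assume "A \<inter> B \<noteq> {}"
    then obtain t where "fixed_on_club (G t) I" "bounded_on_club (G t) I" by (auto simp: A_def B_def)
    then obtain C D \<gamma> where C: "club C" "\<forall>x\<in>C. \<forall>v\<in>I x. G t (p x x v) = x"
      and D: "club D" "\<forall>x\<in>D. \<forall>v\<in>I x. G t (p x x v) \<le> \<gamma>"
      unfolding fixed_on_club_def bounded_on_club_def by blast
    obtain x where x: "x \<in> C \<inter> D" "max \<delta> \<gamma> < x"
      using club_unbounded[OF club_Int[OF C(1) D(1)]] by blast
    obtain v where "v \<in> I x" using I(1)[of x] x(2) by auto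
    then show False using C(2) D(2) x by fastforce
  qed
  moreover have "0 \<in> A"
    unfolding A_def fixed_on_club_def using club_greaterThan[of bot] G0 I(2)
    by (auto intro!: exI[of _ "{bot<..}"])
  moreover have "1 \<in> B"
    unfolding B_def bounded_on_club_def using club_greaterThan[of bot] G1 I(2)
    by (auto intro!: exI[of _ "{bot<..}"] exI[of _ q])
  moreover have "(0::real) \<in> {0..1}" "(1::real) \<in> {0..1}" by simp_all
  ultimately show False using connected_Icc[of "0::real" 1] unfolding connected_closed by blast
qed

text \<open>If at all times the dichotomy holds on full fibres, it is refuted there. Otherwise some time
  provides a tube, and on the tube the dichotomy holds at all times.\<close>

theorem projection_not_null_homotopic:
  fixes G :: "real \<Rightarrow> 'p \<Rightarrow> longray"
  assumes cont: "\<And>x v. bot < x \<Longrightarrow> 0 < v \<Longrightarrow> continuous_on {0..1} (\<lambda>t. G t (p x x v))"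
    and map: "\<And>t x. t \<in> {0..1} \<Longrightarrow> bot < x \<Longrightarrow>
      continuous_on ({a x<..<b x} \<times> {0<..}) (\<lambda>(y, v). G t (p x y v))"
    and G0: "\<And>x v. bot < x \<Longrightarrow> 0 < v \<Longrightarrow> G 0 (p x x v) = x"
    and G1: "\<And>x v. bot < x \<Longrightarrow> 0 < v \<Longrightarrow> G 1 (p x x v) = q"
  shows False
proof -
  have loc: "longray_line_bundle_map a b p k (G t)" if "t \<in> {0..1}" for t
    by (intro longray_line_bundle_map.intro longray_line_bundle_axioms
        longray_line_bundle_map_axioms.intro map that)
  show False
  proof (cases "\<forall>t\<in>{0..1}. fixed_on_club (G t) (\<lambda>_. {0<..}) \<or> bounded_on_club (G t) (\<lambda>_. {0<..})")
    case True
    show False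
      by (rule dichotomy_impossible[OF cont G0 G1, where I = "\<lambda>_. {0<..}"]) (use True in auto)
  next
    case False
    then obtain t where t: "t \<in> {0..1}" "\<not> fixed_on_club (G t) (\<lambda>_. {0<..})"
      "\<not> bounded_on_club (G t) (\<lambda>_. {0<..})" by blast
    obtain I \<delta> where I: "tube I \<delta>"
      by (rule longray_line_bundle_map.tube_exists[OF loc[OF t(1)] t(2,3)]) (rule that)
    show False
    proof (rule dichotomy_impossible[OF cont G0 G1, where I = "\<lambda>x. if \<delta> < x then I x else {}" and \<delta> = \<delta>])
      show "(if \<delta> < x then I x else {}) \<noteq> {}" if "\<delta> < x" for x
        using that by (rule tube_interval[OF I]) (use that in auto)
      show "0 < v" if "v \<in> (if \<delta> < x then I x else {})" for x v
        using that longray_line_bundle_map.tube_pos[OF loc[OF t(1)] I, of x v] by (simp split: if_splits)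
      show "fixed_on_club (G t) (\<lambda>x. if \<delta> < x then I x else {}) \<or>
          bounded_on_club (G t) (\<lambda>x. if \<delta> < x then I x else {})" if "t \<in> {0..1}" for t
        by (rule longray_line_bundle_map.tube_dichotomy[OF loc[OF that] I])
    qed
  qed
qed

end

section \<open>Extending maps over the cylinder on a disk\<close>

definition radius :: "nat \<Rightarrow> (nat \<Rightarrow> real) \<Rightarrow> real" where
  "radius n z = sqrt (\<Sum>i<n. (z i)\<^sup>2)"

lemma topspace_closed_disk: "topspace (closed_disk n) = {z. (\<forall>i\<ge>n. z i = 0) \<and> radius n z \<le> 1}"
  by (auto simp: closed_disk_def topspace_Euclidean_space radius_def)

lemma topspace_open_disk: "topspace (open_disk n) = {z. (\<forall>i\<ge>n. z i = 0) \<and> radius n z < 1}"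
  by (auto simp: open_disk_def topspace_Euclidean_space radius_def)

lemma closed_disk_eq: "closed_disk n = subtopology (powertop_real UNIV) {z. (\<forall>i\<ge>n. z i = 0) \<and> radius n z \<le> 1}"
  by (simp add: closed_disk_def Euclidean_space_def subtopology_subtopology Int_def radius_def)

lemma radius_scale: "radius n (\<lambda>i. z i * c) = radius n z * \<bar>c\<bar>"
  by (simp add: radius_def power_mult_distrib sum_distrib_right[symmetric] real_sqrt_mult)

lemma continuous_map_coordinate: "continuous_map (closed_disk n) euclideanreal (\<lambda>z. z i)"
  unfolding closed_disk_eq by (intro continuous_map_from_subtopology continuous_map_product_projection) simp

lemma continuous_map_sum_squares:
  fixes n :: nat
  assumes "\<And>i. continuous_map X euclideanreal (\<lambda>z. z i)"
  shows "continuous_map X euclideanreal (\<lambda>z. \<Sum>i<n. (z i)\<^sup>2)"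
  unfolding power2_eq_square by (intro continuous_map_sum continuous_map_real_mult assms finite_lessThan)

lemma continuous_map_radius: "continuous_map (closed_disk n) euclideanreal (radius n)"
proof -
  have 1: "continuous_map euclideanreal euclideanreal sqrt"
    unfolding continuous_map_iff_continuous2 by (intro continuous_at_imp_continuous_on ballI isCont_real_sqrt)
  have 2: "continuous_map (closed_disk n) euclideanreal (\<lambda>z. \<Sum>i<n. (z i)\<^sup>2)"
    by (rule continuous_map_sum_squares[OF continuous_map_coordinate])
  have "radius n = sqrt \<circ> (\<lambda>z. \<Sum>i<n. (z i)\<^sup>2)" by (rule ext) (simp add: radius_def)
  then show ?thesis using continuous_map_compose[OF 2 1] by simp
qed

lemma compact_space_closed_disk: "compact_space (closed_disk n)"
proof -
  let ?P = "powertop_real UNIV"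
  have c: "continuous_map ?P euclideanreal (\<lambda>z. z i)" for i
    by (rule continuous_map_product_projection) simp
  have 1: "compactin ?P (PiE UNIV (\<lambda>i. {-1..1}))"
    by (simp add: compactin_PiE)
  have 2: "closedin ?P {z. (\<forall>i\<ge>n. z i = 0) \<and> radius n z \<le> 1}"
  proof -
    have "closedin ?P {z \<in> topspace ?P. z i \<in> {0}}" for i
      by (rule closedin_continuous_map_preimage[OF c]) simp
    then have "closedin ?P (\<Inter>i\<in>{n..}. {z \<in> topspace ?P. z i \<in> {0}})" by (intro closedin_Inter) auto
    moreover have "closedin ?P {z \<in> topspace ?P. (\<Sum>i<n. (z i)\<^sup>2) \<in> {..1}}"
      by (rule closedin_continuous_map_preimage[OF continuous_map_sum_squares[OF c]]) simp
    ultimately have "closedin ?P ((\<Inter>i\<in>{n..}. {z \<in> topspace ?P. z i \<in> {0}}) \<inter>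
        {z \<in> topspace ?P. (\<Sum>i<n. (z i)\<^sup>2) \<in> {..1}})"
      by (rule closedin_Int)
    also have "((\<Inter>i\<in>{n..}. {z \<in> topspace ?P. z i \<in> {0}}) \<inter>
        {z \<in> topspace ?P. (\<Sum>i<n. (z i)\<^sup>2) \<in> {..1}}) = {z. (\<forall>i\<ge>n. z i = 0) \<and> radius n z \<le> 1}"
      by (auto simp: radius_def)
    finally show ?thesis .
  qed
  have 3: "{z. (\<forall>i\<ge>n. z i = 0) \<and> radius n z \<le> 1} \<subseteq> PiE UNIV (\<lambda>i. {-1..1})"
  proof
    fix z assume z: "z \<in> {z. (\<forall>i\<ge>n. z i = 0) \<and> radius n z \<le> 1}"
    have "\<bar>z i\<bar> \<le> 1" for i
    proof (cases "i < n")
      case True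
      have "(z i)\<^sup>2 \<le> (\<Sum>i<n. (z i)\<^sup>2)" using True by (intro member_le_sum) auto
      also have "\<dots> \<le> 1" using z by (simp add: radius_def)
      finally show ?thesis by (simp add: abs_square_le_1)
    qed (use z in simp)
    then show "z \<in> PiE UNIV (\<lambda>i. {-1..1})" by (auto simp: abs_le_iff)
  qed
  have "compactin ?P {z. (\<forall>i\<ge>n. z i = 0) \<and> radius n z \<le> 1}"
    by (rule closed_compactin[OF 1 3 2])
  then show ?thesis unfolding closed_disk_eq by (simp add: compact_space_subtopology)
qed

abbreviation cylinder :: "nat \<Rightarrow> (real \<times> (nat \<Rightarrow> real)) topology" where
  "cylinder n \<equiv> prod_topology (top_of_set {0..1}) (closed_disk n)"

lemma compact_space_cylinder: "compact_space (cylinder n)"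
proof -
  have "compact_space (top_of_set {0..1::real})"
    by (rule compact_space_subtopology) (simp add: compactin_euclidean_iff)
  then show ?thesis by (simp only: compact_space_prod_topology compact_space_closed_disk simp_thms)
qed

text \<open>The cylinder over the closed disk, with its top, bottom and side as boundary, is the unit ball of
  this gauge around the point \<open>(1 / 2, 0)\<close>.\<close>

definition cylinder_gauge :: "nat \<Rightarrow> real \<times> (nat \<Rightarrow> real) \<Rightarrow> real" where
  "cylinder_gauge n = (\<lambda>(t, z). max \<bar>2 * t - 1\<bar> (radius n z))"

lemma continuous_map_cylinder_fst: "continuous_map (cylinder n) euclideanreal fst"
  by (rule continuous_map_into_fulltopology[OF continuous_map_fst])

lemma continuous_map_cylinder_gauge: "continuous_map (cylinder n) euclideanreal (cylinder_gauge n)"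
proof -
  have "continuous_map (cylinder n) euclideanreal (\<lambda>x. radius n (snd x))"
    using continuous_map_compose[OF continuous_map_snd continuous_map_radius] by (simp add: o_def)
  moreover have "continuous_map (cylinder n) euclideanreal (\<lambda>x. \<bar>2 * fst x - 1\<bar>)"
    by (intro continuous_map_real_abs continuous_intros continuous_map_cylinder_fst) 
  ultimately show ?thesis
    unfolding cylinder_gauge_def case_prod_unfold by (rule continuous_map_real_max[rotated])
qed

lemma topspace_cylinder: "topspace (cylinder n) = {0..1} \<times> topspace (closed_disk n)"
  by (simp only: topspace_prod_topology topspace_euclidean_subtopology)

lemma cylinder_gauge_le: "x \<in> topspace (cylinder n) \<Longrightarrow> cylinder_gauge n x \<le> 1"
  unfolding topspace_cylinder topspace_closed_disk cylinder_gauge_def by (cases x) (simp add: abs_le_iff)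

text \<open>The image of the boundary is compact, hence lies in a contractible subspace, and a map into a
  contractible space extends from the unit sphere of the gauge to the ball: push radially to the
  boundary while running the contraction. The contraction is complete at half the radius and the map is constant
  inside, which avoids a separate continuity argument at the centre.\<close>

lemma cylinder_extension:
  assumes P: "\<And>K. compactin P K \<Longrightarrow> \<exists>Q. K \<subseteq> Q \<and> contractible_space (subtopology P Q)"
    and b: "continuous_map (subtopology (cylinder n) {x. cylinder_gauge n x = 1}) P b"
  obtains J where "continuous_map (cylinder n) P J"
    "\<And>x. x \<in> topspace (cylinder n) \<Longrightarrow> cylinder_gauge n x = 1 \<Longrightarrow> J x = b x"
proof -
  let ?C = "cylinder n" and ?N = "cylinder_gauge n"
  let ?B = "{x. ?N x = 1}"
  have "closedin ?C {x \<in> topspace ?C. ?N x \<in> {1}}"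
    by (rule closedin_continuous_map_preimage[OF continuous_map_cylinder_gauge]) simp
  then have "compactin ?C {x \<in> topspace ?C. ?N x \<in> {1}}"
    by (rule closedin_compact_space[OF compact_space_cylinder])
  then have "compactin (subtopology ?C ?B) {x \<in> topspace ?C. ?N x \<in> {1}}"
    by (simp add: compactin_subtopology) blast
  then have "compactin P (b ` {x \<in> topspace ?C. ?N x \<in> {1}})"
    by (rule image_compactin[OF _ b])
  then obtain Q where Q: "b ` {x \<in> topspace ?C. ?N x \<in> {1}} \<subseteq> Q" "contractible_space (subtopology P Q)"
    using P by blast
  have bQ: "continuous_map (subtopology ?C ?B) (subtopology P Q) b"
    unfolding continuous_map_in_subtopology using b Q(1) by auto
  obtain q where "homotopic_with (\<lambda>x. True) (subtopology P Q) (subtopology P Q) id (\<lambda>x. q)"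
    using Q(2) unfolding contractible_space_def by blast
  then obtain c where c: "continuous_map (prod_topology (top_of_set {0..1::real}) (subtopology P Q)) (subtopology P Q) c"
    "\<And>x. c (0, x) = x" "\<And>x. c (1, x) = q"
    unfolding homotopic_with_def by auto
  \<comment> \<open>Radial projection from the centre to the boundary.\<close>
  define \<rho> where "\<rho> x = (1 / 2 + (fst x - 1 / 2) / ?N x, \<lambda>i. snd x i * (1 / ?N x))" for x
  define X where "X = subtopology ?C {x \<in> topspace ?C. 1 / 2 \<le> ?N x}"
  have XN: "?N x \<noteq> 0" "1 / 2 \<le> ?N x" "?N x \<le> 1" "x \<in> topspace ?C" if "x \<in> topspace X" for x
    using that cylinder_gauge_le[of x n] by (auto simp: X_def)
  have cN: "continuous_map X euclideanreal ?N"
    unfolding X_def by (intro continuous_map_from_subtopology continuous_map_cylinder_gauge)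
  have cf: "continuous_map X euclideanreal fst"
    unfolding X_def by (intro continuous_map_from_subtopology continuous_map_into_fulltopology[OF continuous_map_fst])
  have cs: "continuous_map X (closed_disk n) snd"
    unfolding X_def by (intro continuous_map_from_subtopology continuous_map_snd)
  have radr: "radius n (snd (\<rho> x)) = radius n (snd x) / ?N x" if "x \<in> topspace X" for x
    using radius_scale[of n "snd x" "1 / ?N x"] XN[OF that] by (simp add: \<rho>_def)
  have N\<rho>: "?N (\<rho> x) = 1" if "x \<in> topspace X" for x
  proof -
    have N: "0 < ?N x" using XN(2)[OF that] by simp
    have "2 * fst (\<rho> x) - 1 = (2 * fst x - 1) / ?N x" by (simp add: \<rho>_def diff_divide_distrib)
    then have "?N (\<rho> x) = max (\<bar>2 * fst x - 1\<bar> / ?N x) (radius n (snd x) / ?N x)"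
      using radr[OF that] N by (simp add: cylinder_gauge_def case_prod_unfold abs_divide)
    also have "\<dots> = max \<bar>2 * fst x - 1\<bar> (radius n (snd x)) / ?N x"
      using N by (simp add: max_def divide_le_cancel)
    also have "\<dots> = ?N x / ?N x" by (simp add: cylinder_gauge_def case_prod_unfold)
    finally show ?thesis using N by simp
  qed
  have \<rho>C: "\<rho> x \<in> topspace ?C" if "x \<in> topspace X" for x
  proof -
    have *: "\<bar>2 * fst (\<rho> x) - 1\<bar> \<le> 1" "radius n (snd (\<rho> x)) \<le> 1"
      using N\<rho>[OF that] by (auto simp: cylinder_gauge_def case_prod_unfold)
    have "\<forall>i\<ge>n. snd (\<rho> x) i = 0" using XN(4)[OF that] by (auto simp: \<rho>_def topspace_closed_disk)
    then have "snd (\<rho> x) \<in> topspace (closed_disk n)" using * by (simp add: topspace_closed_disk)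
    then show ?thesis using *(1) by (simp add: mem_Times_iff) arith
  qed
  have c\<rho>: "continuous_map X (subtopology ?C ?B) \<rho>"
  proof -
    have "continuous_map X (top_of_set {0..1}) (\<lambda>x. fst (\<rho> x))"
      using \<rho>C by (fastforce simp: continuous_map_in_subtopology \<rho>_def intro!: continuous_intros cN cf XN)
    moreover have "continuous_map X (closed_disk n) (\<lambda>x. snd (\<rho> x))"
      unfolding closed_disk_eq continuous_map_in_subtopology continuous_map_componentwise_UNIV
    proof (intro conjI allI)
      fix i
      have "continuous_map X euclideanreal (\<lambda>x. snd x i)"
        using continuous_map_compose[OF cs continuous_map_coordinate[of n i]] by (simp add: o_def)
      then show "continuous_map X euclideanreal (\<lambda>x. snd (\<rho> x) i)"
        unfolding \<rho>_def by (simp, intro continuous_intros cN XN)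
      show "(\<lambda>x. snd (\<rho> x)) \<in> topspace X \<rightarrow> {z. (\<forall>i\<ge>n. z i = 0) \<and> radius n z \<le> 1}"
        using \<rho>C by (auto simp: topspace_closed_disk mem_Times_iff)
    qed
    ultimately have "continuous_map X ?C \<rho>"
      by (simp add: continuous_map_pairwise o_def)
    then show ?thesis using N\<rho> by (auto simp: continuous_map_in_subtopology)
  qed
  define f where "f x = c (2 - 2 * ?N x, b (\<rho> x))" for x
  have "continuous_map X (subtopology P Q) f"
    unfolding f_def
  proof (rule continuous_map_compose[OF _ c(1), unfolded o_def])
    have "continuous_map X (top_of_set {0..1}) (\<lambda>x. 2 - 2 * ?N x)"
      unfolding continuous_map_in_subtopology
    proof
      show "continuous_map X euclideanreal (\<lambda>x. 2 - 2 * ?N x)" by (intro continuous_intros cN) simp_all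
      show "(\<lambda>x. 2 - 2 * ?N x) \<in> topspace X \<rightarrow> {0..1}"
      proof
        fix x assume "x \<in> topspace X"
        from XN(2,3)[OF this] show "2 - 2 * ?N x \<in> {0..1}" by simp
      qed
    qed
    then show "continuous_map X (prod_topology (top_of_set {0..1}) (subtopology P Q)) (\<lambda>x. (2 - 2 * ?N x, b (\<rho> x)))"
      using continuous_map_compose[OF c\<rho> bQ] by (simp add: continuous_map_paired o_def)
  qed
  then have cf': "continuous_map X P f" by (rule continuous_map_into_fulltopology)
  have "q \<in> topspace P"
  proof -
    have one: "(1, \<lambda>i. 0) \<in> topspace ?C" by (simp add: topspace_closed_disk radius_def)
    moreover have "?N (1, \<lambda>i. 0) = 1" by (simp add: cylinder_gauge_def radius_def)
    ultimately have "b (1, \<lambda>i. 0) \<in> topspace (subtopology P Q)"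
      using continuous_map_image_subset_topspace[OF bQ] by auto
    then have "c (1, b (1, \<lambda>i. 0)) \<in> topspace (subtopology P Q)"
      using continuous_map_image_subset_topspace[OF c(1)] by auto
    then show ?thesis using c(3) by simp
  qed
  show ?thesis
  proof (rule that[of "\<lambda>x. if 1 / 2 \<le> ?N x then f x else q"])
    show "continuous_map ?C P (\<lambda>x. if 1 / 2 \<le> ?N x then f x else q)"
    proof (rule continuous_map_cases_le)
      show "continuous_map (subtopology ?C {x \<in> topspace ?C. 1 / 2 \<le> ?N x}) P f"
        using cf' by (simp add: X_def)
      show "f x = q" if "1 / 2 = ?N x" for x
      proof -
        have "2 - 2 * ?N x = 1" using that by simp
        then show ?thesis using c(3) by (simp only: f_def)
      qed
    qed (use \<open>q \<in> topspace P\<close> in \<open>auto intro: continuous_map_cylinder_gauge\<close>)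
    fix x assume "x \<in> topspace ?C" "?N x = 1"
    then show "(if 1 / 2 \<le> ?N x then f x else q) = b x"
      using c(2) by (simp add: f_def \<rho>_def)
  qed
qed

lemma closedin_compact_image:
  assumes "Hausdorff_space Y" "compact_space Z" "continuous_map Z Y f" "closedin Z S"
  shows "closedin Y (f ` S)"
  by (rule compactin_imp_closedin[OF assms(1) image_compactin[OF closedin_compact_space[OF assms(2,4)] assms(3)]])

text \<open>A homotopy that is continuous on the cylinder over every cell is continuous over a finite union of
  closed cells, because characteristic maps of compact disks into a Hausdorff space are closed.\<close>

lemma cylinder_boundary_map_closed:
  assumes Y: "Hausdorff_space Y" and F: "finite F"
    and \<Phi>: "\<And>f. f \<in> F \<Longrightarrow> continuous_map (closed_disk (d f)) Y (\<Phi> f)"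
    and H: "\<And>f. f \<in> F \<Longrightarrow> continuous_map (cylinder (d f)) P (\<lambda>(t, z). H t (\<Phi> f z))"
    and S: "closedin P S"
  shows "closedin (prod_topology (top_of_set {0..1::real}) Y)
    {(t, y). t \<in> {0..1} \<and> y \<in> (\<Union>f\<in>F. \<Phi> f ` topspace (closed_disk (d f))) \<and> H t y \<in> S}"
proof -
  let ?I = "top_of_set {0..1::real}"
  define \<Psi> where "\<Psi> f = (\<lambda>(t :: real, z). (t, \<Phi> f z))" for f
  define A where "A f = {x \<in> topspace (cylinder (d f)). (case x of (t, z) \<Rightarrow> H t (\<Phi> f z)) \<in> S}" for f
  have "closedin (prod_topology ?I Y) (\<Psi> f ` A f)" if f: "f \<in> F" for f
  proof (rule closedin_compact_image)
    show "Hausdorff_space (prod_topology ?I Y)"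
      using Y by (simp add: Hausdorff_space_prod_topology Hausdorff_space_subtopology)
    show "compact_space (cylinder (d f))" by (rule compact_space_cylinder)
    show "continuous_map (cylinder (d f)) (prod_topology ?I Y) (\<Psi> f)"
      using continuous_map_compose[OF continuous_map_snd \<Phi>[OF f], of ?I]
      by (simp add: \<Psi>_def case_prod_unfold continuous_map_paired continuous_map_fst o_def)
    show "closedin (cylinder (d f)) (A f)"
      unfolding A_def by (rule closedin_continuous_map_preimage[OF H[OF f] S])
  qed
  then have "closedin (prod_topology ?I Y) (\<Union>f\<in>F. \<Psi> f ` A f)"
    using F by (intro closedin_Union) auto
  also have "(\<Union>f\<in>F. \<Psi> f ` A f) =
      {(t, y). t \<in> {0..1} \<and> y \<in> (\<Union>f\<in>F. \<Phi> f ` topspace (closed_disk (d f))) \<and> H t y \<in> S}"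
    (is "?L = ?R")
  proof (intro equalityI subsetI)
    fix x assume "x \<in> ?L"
    then obtain f t z where "f \<in> F" "(t, z) \<in> A f" "x = (t, \<Phi> f z)" by (auto simp: \<Psi>_def)
    then show "x \<in> ?R" by (auto simp: A_def)
  next
    fix x assume "x \<in> ?R"
    then obtain f t z where f: "f \<in> F" "z \<in> topspace (closed_disk (d f))" "x = (t, \<Phi> f z)"
      "t \<in> {0..1}" "H t (\<Phi> f z) \<in> S" by auto
    then have "(t, z) \<in> A f" by (simp add: A_def)
    then have "x \<in> \<Psi> f ` A f" by (rule rev_image_eqI) (simp add: \<Psi>_def f)
    then show "x \<in> ?L" using f(1) by blast
  qed
  finally show ?thesis .
qed

text \<open>On the boundary of the cylinder over a cell the homotopy is prescribed: by \<open>k\<close> at time 0, by the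
  constant \<open>q\<close> at time 1, and on the side by the homotopy \<open>H\<close> on the lower cells \<open>F\<close> that contain the
  boundary of the cell.\<close>

lemma extend_homotopy_over_cell:
  assumes Y: "Hausdorff_space Y" and F: "finite F"
    and \<Phi>F: "\<And>f. f \<in> F \<Longrightarrow> continuous_map (closed_disk (d f)) Y (\<Phi> f)"
    and H: "\<And>f. f \<in> F \<Longrightarrow> continuous_map (cylinder (d f)) P (\<lambda>(t, z). H t (\<Phi> f z))"
    and H0: "\<And>y. y \<in> (\<Union>f\<in>F. \<Phi> f ` topspace (closed_disk (d f))) \<Longrightarrow> H 0 y = k y \<and> H 1 y = q"
    and k: "continuous_map Y P k" and q: "q \<in> topspace P"
    and P: "\<And>K. compactin P K \<Longrightarrow> \<exists>Q. K \<subseteq> Q \<and> contractible_space (subtopology P Q)"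
    and \<phi>: "continuous_map (closed_disk n) Y \<phi>"
    and bd: "\<And>z. z \<in> topspace (closed_disk n) \<Longrightarrow> radius n z = 1
      \<Longrightarrow> \<phi> z \<in> (\<Union>f\<in>F. \<Phi> f ` topspace (closed_disk (d f)))"
  shows "\<exists>J. continuous_map (cylinder n) P (\<lambda>(t, z). J t z) \<and>
    (\<forall>z\<in>topspace (closed_disk n). J 0 z = k (\<phi> z) \<and> J 1 z = q \<and>
       (\<forall>t\<in>{0..1}. radius n z = 1 \<longrightarrow> J t z = H t (\<phi> z)))"
proof -
  let ?I = "top_of_set {0..1::real}"
  let ?Y1 = "\<Union>f\<in>F. \<Phi> f ` topspace (closed_disk (d f))"
  let ?B = "{x. cylinder_gauge n x = 1}"
  define b where "b = (\<lambda>(t :: real, z). if t = 0 then k (\<phi> z) else if t = 1 then q else H t (\<phi> z))"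
  have k\<phi>: "continuous_map (cylinder n) P (\<lambda>x. k (\<phi> (snd x)))"
    using continuous_map_compose[OF continuous_map_snd continuous_map_compose[OF \<phi> k], of ?I]
    by (simp add: o_def)
  have cfst: "continuous_map (cylinder n) euclideanreal fst" by (rule continuous_map_cylinder_fst)
  have crad: "continuous_map (cylinder n) euclideanreal (\<lambda>x. radius n (snd x))"
    using continuous_map_compose[OF continuous_map_snd continuous_map_radius, of ?I] by (simp add: o_def)
  have id\<phi>: "continuous_map (cylinder n) (prod_topology ?I Y) (\<lambda>x. (fst x, \<phi> (snd x)))"
    using continuous_map_compose[OF continuous_map_snd \<phi>, of ?I]
    by (simp add: continuous_map_paired continuous_map_fst o_def)
  have cases: "fst x = 0 \<or> fst x = 1 \<or> radius n (snd x) = 1"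
    if "x \<in> topspace (cylinder n)" "cylinder_gauge n x = 1" for x
    using that by (auto simp: cylinder_gauge_def case_prod_unfold max_def split: if_splits)
  have gauge: "cylinder_gauge n x = 1"
    if "x \<in> topspace (cylinder n)" "fst x = 0 \<or> fst x = 1 \<or> radius n (snd x) = 1" for x
    using that by (auto simp: cylinder_gauge_def case_prod_unfold topspace_closed_disk max_def)
  have b3: "b x = H (fst x) (\<phi> (snd x))" "\<phi> (snd x) \<in> ?Y1"
    if "x \<in> topspace (cylinder n)" "radius n (snd x) = 1" for x
  proof -
    show *: "\<phi> (snd x) \<in> ?Y1" using bd[of "snd x"] that by (simp add: mem_Times_iff)
    show "b x = H (fst x) (\<phi> (snd x))" using H0[OF *] by (simp add: b_def case_prod_unfold)
  qed
  have Hmem: "H t y \<in> topspace P" if "t \<in> {0..1}" "y \<in> ?Y1" for t y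
  proof -
    obtain f z where f: "f \<in> F" "z \<in> topspace (closed_disk (d f))" "y = \<Phi> f z" using \<open>y \<in> ?Y1\<close> by blast
    have "(\<lambda>(t, z). H t (\<Phi> f z)) (t, z) \<in> topspace P"
      by (rule subsetD[OF continuous_map_image_subset_topspace[OF H[OF f(1)]] imageI]) (use that(1) f(2) in simp)
    then show ?thesis using f(3) by simp
  qed
  have cb: "continuous_map (subtopology (cylinder n) ?B) P b"
    unfolding continuous_map_closedin
  proof (intro conjI allI impI)
    show "b \<in> topspace (subtopology (cylinder n) ?B) \<rightarrow> topspace P"
    proof
      fix x assume "x \<in> topspace (subtopology (cylinder n) ?B)"
      then have x: "x \<in> topspace (cylinder n)" "cylinder_gauge n x = 1" by auto
      have "k (\<phi> (snd x)) \<in> topspace P"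
        using continuous_map_image_subset_topspace[OF k\<phi>] x(1) by blast
      moreover have "H (fst x) (\<phi> (snd x)) \<in> topspace P" if "radius n (snd x) = 1"
        using Hmem[OF _ b3(2)[OF x(1) that], of "fst x"] x(1) by (simp add: mem_Times_iff)
      ultimately show "b x \<in> topspace P" using cases[OF x] q b3(1)[OF x(1)]
        by (auto simp: b_def case_prod_unfold split: if_splits)
    qed
    fix S assume S: "closedin P S"
    \<comment> \<open>The preimage of a closed set, cut into its parts on the bottom, the top and the side of the cylinder.\<close>
    define A1 where "A1 = {x \<in> topspace (cylinder n). fst x \<in> {0}} \<inter> {x \<in> topspace (cylinder n). k (\<phi> (snd x)) \<in> S}"
    define A2 where "A2 = (if q \<in> S then {x \<in> topspace (cylinder n). fst x \<in> {1}} else {})"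
    define A3 where "A3 = {x \<in> topspace (cylinder n). radius n (snd x) \<in> {1}} \<inter>
      {x \<in> topspace (cylinder n). (fst x, \<phi> (snd x)) \<in> {(t, y). t \<in> {0..1} \<and> y \<in> ?Y1 \<and> H t y \<in> S}}"
    have "closedin (cylinder n) A1"
      unfolding A1_def by (intro closedin_Int closedin_continuous_map_preimage[OF cfst]
          closedin_continuous_map_preimage[OF k\<phi> S]) simp
    moreover have "closedin (cylinder n) A2"
      unfolding A2_def using closedin_continuous_map_preimage[OF cfst, of "{1}"] by simp
    moreover have "closedin (cylinder n) A3"
      unfolding A3_def
      by (intro closedin_Int closedin_continuous_map_preimage[OF crad]
          closedin_continuous_map_preimage[OF id\<phi> cylinder_boundary_map_closed[OF Y F \<Phi>F H S]]) simp_all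
    ultimately have closed: "closedin (cylinder n) (A1 \<union> A2 \<union> A3)" by (intro closedin_Un)
    have eq: "{x \<in> topspace (subtopology (cylinder n) ?B). b x \<in> S} = A1 \<union> A2 \<union> A3" (is "?L = ?R")
    proof (rule set_eqI)
      fix x
      have bx: "fst x = 0 \<Longrightarrow> b x = k (\<phi> (snd x))" "fst x = 1 \<Longrightarrow> b x = q"
        by (simp_all add: b_def case_prod_unfold)
      show "x \<in> ?L \<longleftrightarrow> x \<in> ?R"
      proof (cases "x \<in> topspace (cylinder n)")
        case True
        then have t01: "fst x \<in> {0..1}" by (simp add: mem_Times_iff)
        have m1: "x \<in> A1 \<longleftrightarrow> fst x = 0 \<and> k (\<phi> (snd x)) \<in> S" using True by (simp add: A1_def)
        have m2: "x \<in> A2 \<longleftrightarrow> fst x = 1 \<and> q \<in> S" using True by (simp add: A2_def)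
        have m3: "x \<in> A3 \<longleftrightarrow> radius n (snd x) = 1 \<and> H (fst x) (\<phi> (snd x)) \<in> S"
          using True t01 b3(2)[OF True] by (auto simp: A3_def)
        have "x \<in> ?L \<longleftrightarrow> cylinder_gauge n x = 1 \<and> b x \<in> S" using True by simp
        also have "\<dots> \<longleftrightarrow> x \<in> A1 \<or> x \<in> A2 \<or> x \<in> A3"
          unfolding m1 m2 m3
        proof
          assume *: "cylinder_gauge n x = 1 \<and> b x \<in> S"
          then consider "fst x = 0" | "fst x = 1" | "radius n (snd x) = 1" using cases[OF True] by blast
          then show "fst x = 0 \<and> k (\<phi> (snd x)) \<in> S \<or> fst x = 1 \<and> q \<in> S \<or>
              radius n (snd x) = 1 \<and> H (fst x) (\<phi> (snd x)) \<in> S"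
            by cases (use * bx b3(1)[OF True] in simp_all)
        next
          assume "fst x = 0 \<and> k (\<phi> (snd x)) \<in> S \<or> fst x = 1 \<and> q \<in> S \<or>
              radius n (snd x) = 1 \<and> H (fst x) (\<phi> (snd x)) \<in> S"
          then show "cylinder_gauge n x = 1 \<and> b x \<in> S"
            using gauge[OF True] bx b3(1)[OF True] by (elim disjE) simp_all
        qed
        finally show ?thesis by simp
      qed (auto simp: A1_def A2_def A3_def)
    qed
    have "A1 \<union> A2 \<union> A3 \<subseteq> ?B" unfolding eq[symmetric] by auto
    then show "closedin (subtopology (cylinder n) ?B) {x \<in> topspace (subtopology (cylinder n) ?B). b x \<in> S}"
      unfolding eq by (rule closedin_subset_topspace[OF closed])
  qed
  obtain J where J: "continuous_map (cylinder n) P J"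
    "\<And>x. x \<in> topspace (cylinder n) \<Longrightarrow> cylinder_gauge n x = 1 \<Longrightarrow> J x = b x"
    by (rule cylinder_extension[OF P cb]) (assumption, rule that)
  show ?thesis
  proof (intro exI[of _ "\<lambda>t z. J (t, z)"] conjI ballI impI)
    show "continuous_map (cylinder n) P (\<lambda>(t, z). J (t, z))" using J(1) by simp
    fix z assume z: "z \<in> topspace (closed_disk n)"
    have *: "J (t, z) = b (t, z)" if "t \<in> {0..1}" "t = 0 \<or> t = 1 \<or> radius n z = 1" for t
      using J(2)[of "(t, z)"] gauge[of "(t, z)"] that z by simp
    show "J (0, z) = k (\<phi> z)" using *[of 0] by (simp add: b_def)
    show "J (1, z) = q" using *[of 1] by (simp add: b_def)
    fix t :: real assume "t \<in> {0..1}" "radius n z = 1"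
    then show "J (t, z) = H t (\<phi> z)" using *[of t] b3(1)[of "(t, z)"] z by simp
  qed
qed

section \<open>Null-homotopic maps on CW-complexes\<close>

text \<open>A CW-complex with a chosen dimension, characteristic map and finite set of boundary cells for every
  cell. The dimension is a function of the cell here, while a set may be an \<open>n\<close>-cell for several \<open>n\<close> in
  a family \<open>C\<close> of cells.\<close>

locale cell_decomposition =
  fixes Y :: "'b topology" and E :: "'b set set" and d :: "'b set \<Rightarrow> nat"
    and \<Phi> :: "'b set \<Rightarrow> (nat \<Rightarrow> real) \<Rightarrow> 'b" and F :: "'b set \<Rightarrow> 'b set set"
  assumes Hausdorff: "Hausdorff_space Y"
    and cover: "\<Union>E = topspace Y" and disjoint: "pairwise disjnt E"
    and char_cont: "e \<in> E \<Longrightarrow> continuous_map (closed_disk (d e)) Y (\<Phi> e)"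
    and char_image: "e \<in> E \<Longrightarrow> \<Phi> e ` topspace (open_disk (d e)) = e"
    and char_inj: "e \<in> E \<Longrightarrow> inj_on (\<Phi> e) (topspace (open_disk (d e)))"
    and bd_finite: "e \<in> E \<Longrightarrow> finite (F e)"
    and bd_lower: "\<lbrakk>e \<in> E; f \<in> F e\<rbrakk> \<Longrightarrow> f \<in> E \<and> d f < d e"
    and bd_cover: "e \<in> E \<Longrightarrow> \<Phi> e ` (topspace (closed_disk (d e)) - topspace (open_disk (d e))) \<subseteq> \<Union>(F e)"
    and weak: "\<lbrakk>S \<subseteq> topspace Y; \<And>e. e \<in> E \<Longrightarrow> closedin Y (S \<inter> Y closure_of e)\<rbrakk> \<Longrightarrow> closedin Y S"
begin

definition cell :: "'b \<Rightarrow> 'b set" where "cell y = (THE e. e \<in> E \<and> y \<in> e)"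

lemma cell_eq:
  assumes "e \<in> E" "y \<in> e"
  shows "cell y = e"
  unfolding cell_def
proof (rule the_equality)
  fix e' assume "e' \<in> E \<and> y \<in> e'"
  then show "e' = e" using pairwiseD[OF disjoint, of e' e] assms by (auto simp: disjnt_iff)
qed (use assms in simp)

lemma cell_mem:
  assumes "y \<in> topspace Y"
  shows "cell y \<in> E" "y \<in> cell y"
proof -
  have "y \<in> \<Union>E" using assms cover by simp
  then obtain e where e: "e \<in> E" "y \<in> e" ..
  then show "cell y \<in> E" "y \<in> cell y" using cell_eq[OF e] by simp_all
qed

lemma in_disk_cases:
  assumes "z \<in> topspace (closed_disk n)"
  obtains "z \<in> topspace (open_disk n)" | "radius n z = 1" "z \<notin> topspace (open_disk n)"
proof (cases "radius n z = 1")
  case True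
  then have "z \<notin> topspace (open_disk n)" by (simp add: topspace_open_disk)
  then show ?thesis using True that(2) by simp
next
  case False
  then have "z \<in> topspace (open_disk n)" using assms by (simp add: topspace_open_disk topspace_closed_disk)
  then show ?thesis using that(1) by simp
qed

lemma cell_interior:
  assumes "e \<in> E" "z \<in> topspace (open_disk (d e))"
  shows "cell (\<Phi> e z) = e"
proof -
  have "\<Phi> e z \<in> \<Phi> e ` topspace (open_disk (d e))" using assms(2) by (rule imageI)
  then show ?thesis unfolding char_image[OF assms(1)] by (rule cell_eq[OF assms(1)])
qed

lemma cell_boundary:
  assumes "e \<in> E" "z \<in> topspace (closed_disk (d e))" "radius (d e) z = 1"
  obtains f where "f \<in> F e" "\<Phi> e z \<in> f" "cell (\<Phi> e z) = f"
proof -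
  have "z \<notin> topspace (open_disk (d e))" using assms(3) by (simp add: topspace_open_disk)
  then have "\<Phi> e z \<in> \<Union>(F e)" using bd_cover[OF assms(1)] assms(2) by blast
  then obtain f where f: "f \<in> F e" "\<Phi> e z \<in> f" ..
  show ?thesis
    by (rule that[OF f]) (rule cell_eq[OF conjunct1[OF bd_lower[OF assms(1) f(1)]] f(2)])
qed

lemma cell_dim_le:
  assumes "e \<in> E" "z \<in> topspace (closed_disk (d e))"
  shows "d (cell (\<Phi> e z)) \<le> d e"
  using assms(2)
proof (cases rule: in_disk_cases)
  case 1
  then show ?thesis using cell_interior[OF assms(1)] by simp
next
  case 2
  obtain f where f: "f \<in> F e" "cell (\<Phi> e z) = f" by (rule cell_boundary[OF assms 2(1)]) (rule that)
  have "d f < d e" using bd_lower[OF assms(1) f(1)] ..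
  then show ?thesis unfolding f(2) by (rule less_imp_le)
qed

lemma closure_of_cell_subset:
  assumes "e \<in> E"
  shows "Y closure_of e \<subseteq> \<Phi> e ` topspace (closed_disk (d e))"
proof (rule closure_of_minimal)
  show "closedin Y (\<Phi> e ` topspace (closed_disk (d e)))"
    by (rule closedin_compact_image[OF Hausdorff compact_space_closed_disk char_cont[OF assms]]) simp
  have "topspace (open_disk (d e)) \<subseteq> topspace (closed_disk (d e))"
    by (auto simp: topspace_open_disk topspace_closed_disk)
  then have "\<Phi> e ` topspace (open_disk (d e)) \<subseteq> \<Phi> e ` topspace (closed_disk (d e))" by (rule image_mono)
  then show "e \<subseteq> \<Phi> e ` topspace (closed_disk (d e))" unfolding char_image[OF assms] .
qed

text \<open>The product of the complex with the unit interval has the weak topology, in the following concrete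
  form. The points \<open>y\<close> for which the path \<open>t \<mapsto> G t y\<close> meets a closed set during a given compact time interval
  form a closed set, as they do so cell by cell; its complement is a neighbourhood of a point whose path
  avoids the closed set.\<close>

lemma continuous_map_homotopy:
  assumes G: "\<And>e. e \<in> E \<Longrightarrow> continuous_map (cylinder (d e)) P (\<lambda>(t, z). G t (\<Phi> e z))"
  shows "continuous_map (prod_topology (top_of_set {0..1}) Y) P (\<lambda>(t, y). G t y)"
proof -
  have lift: "\<exists>e z. e \<in> E \<and> z \<in> topspace (closed_disk (d e)) \<and> y = \<Phi> e z" if "y \<in> topspace Y" for y
  proof -
    have "y \<in> \<Union>E" using that cover by simp
    then obtain e where e: "e \<in> E" "y \<in> e" ..
    then have "y \<in> \<Phi> e ` topspace (open_disk (d e))" unfolding char_image[OF e(1)] by simp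
    then obtain z where z: "z \<in> topspace (open_disk (d e))" "y = \<Phi> e z" by blast
    then have "z \<in> topspace (closed_disk (d e))" by (simp add: topspace_open_disk topspace_closed_disk)
    then show ?thesis using e(1) z(2) by blast
  qed
  have mem: "G t (\<Phi> e z) \<in> topspace P"
    if "e \<in> E" "z \<in> topspace (closed_disk (d e))" "t \<in> {0..1}" for e z t
  proof -
    have "(\<lambda>(t, z). G t (\<Phi> e z)) (t, z) \<in> topspace P"
      by (rule subsetD[OF continuous_map_image_subset_topspace[OF G[OF that(1)]] imageI]) (use that in simp)
    then show ?thesis by simp
  qed
  have closed: "closedin Y {y \<in> topspace Y. \<exists>t\<in>{0..1} \<inter> {c..c'}. G t y \<in> S}" (is "closedin Y ?A")
    if S: "closedin P S" for S c c'
  proof (rule weak)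
    fix e assume e: "e \<in> E"
    let ?C = "cylinder (d e)"
    define B where "B = {x \<in> topspace ?C. fst x \<in> {c..c'}} \<inter> {x \<in> topspace ?C. (case x of (t, z) \<Rightarrow> G t (\<Phi> e z)) \<in> S}"
    have "closedin ?C B"
      unfolding B_def
      by (intro closedin_Int closedin_continuous_map_preimage[OF continuous_map_cylinder_fst]
          closedin_continuous_map_preimage[OF G[OF e] S]) simp_all
    moreover have "continuous_map ?C Y (\<lambda>x. \<Phi> e (snd x))"
      using continuous_map_compose[OF continuous_map_snd char_cont[OF e]] by (simp add: o_def)
    ultimately have "closedin Y ((\<lambda>x. \<Phi> e (snd x)) ` B)"
      by (rule closedin_compact_image[OF Hausdorff compact_space_cylinder, rotated])
    moreover have "(\<lambda>x. \<Phi> e (snd x)) ` B = ?A \<inter> \<Phi> e ` topspace (closed_disk (d e))"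
    proof (intro equalityI subsetI)
      fix y assume "y \<in> (\<lambda>x. \<Phi> e (snd x)) ` B"
      then obtain t z where x: "(t, z) \<in> B" "y = \<Phi> e z" by auto
      then have z: "z \<in> topspace (closed_disk (d e))" "t \<in> {0..1} \<inter> {c..c'}" "G t y \<in> S" by (auto simp: B_def)
      have "y \<in> topspace Y" using continuous_map_image_subset_topspace[OF char_cont[OF e]] z(1) x(2) by blast
      then show "y \<in> ?A \<inter> \<Phi> e ` topspace (closed_disk (d e))" using z x(2) by blast
    next
      fix y assume "y \<in> ?A \<inter> \<Phi> e ` topspace (closed_disk (d e))"
      then obtain t z where "t \<in> {0..1} \<inter> {c..c'}" "G t y \<in> S" "z \<in> topspace (closed_disk (d e))" "y = \<Phi> e z"
        by blast
      then have "(t, z) \<in> B" "y = \<Phi> e (snd (t, z))" by (simp_all add: B_def)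
      then show "y \<in> (\<lambda>x. \<Phi> e (snd x)) ` B" by (rule rev_image_eqI)
    qed
    ultimately have "closedin Y (?A \<inter> \<Phi> e ` topspace (closed_disk (d e)))" by (simp only:)
    from closedin_Int[OF this closedin_closure_of[of Y e]]
    have "closedin Y (?A \<inter> \<Phi> e ` topspace (closed_disk (d e)) \<inter> Y closure_of e)" .
    also have "?A \<inter> \<Phi> e ` topspace (closed_disk (d e)) \<inter> Y closure_of e = ?A \<inter> Y closure_of e"
      using closure_of_cell_subset[OF e] by blast
    finally show "closedin Y (?A \<inter> Y closure_of e)" .
  qed blast
  show ?thesis
    unfolding continuous_map_def
  proof (intro conjI allI impI)
    show "(\<lambda>(t, y). G t y) \<in> topspace (prod_topology (top_of_set {0..1}) Y) \<rightarrow> topspace P"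
    proof
      fix x assume "x \<in> topspace (prod_topology (top_of_set {0..1::real}) Y)"
      then have x: "fst x \<in> {0..1}" "snd x \<in> topspace Y" by auto
      then show "(\<lambda>(t, y). G t y) x \<in> topspace P"
        using lift[OF x(2)] mem by (auto simp: case_prod_unfold)
    qed
    fix U assume U: "openin P U"
    let ?X = "prod_topology (top_of_set {0..1::real}) Y"
    show "openin ?X {x \<in> topspace ?X. (\<lambda>(t, y). G t y) x \<in> U}" (is "openin ?X ?L")
    proof (subst openin_subopen, intro ballI)
      fix x assume "x \<in> ?L"
      then obtain t0 y0 where x: "x = (t0, y0)" "t0 \<in> {0..1}" "y0 \<in> topspace Y" "G t0 y0 \<in> U" by auto
      obtain e z0 where z0: "e \<in> E" "z0 \<in> topspace (closed_disk (d e))" "y0 = \<Phi> e z0" using lift[OF x(3)] by blast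
      have "continuous_map (top_of_set {0..1}) (cylinder (d e)) (\<lambda>t. (t, z0))"
        using z0(2) by (simp add: continuous_map_pairwise o_def)
      from continuous_map_compose[OF this G[OF z0(1)]]
      have "continuous_map (top_of_set {0..1}) P (\<lambda>t. G t y0)" by (simp add: o_def z0(3))
      then have "openin (top_of_set {0..1}) {t \<in> topspace (top_of_set {0..1}). G t y0 \<in> U}"
        using U by (rule openin_continuous_map_preimage)
      then have op: "openin (top_of_set {0..1}) {t \<in> {0..1}. G t y0 \<in> U}" by simp
      obtain \<epsilon> where \<epsilon>: "\<epsilon> > 0" "\<And>t. t \<in> {0..1} \<Longrightarrow> dist t t0 < \<epsilon> \<Longrightarrow> G t y0 \<in> U"
        using op x(2,4) unfolding openin_euclidean_subtopology_iff by (auto simp: subset_iff)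
      define A where "A = {y \<in> topspace Y. \<exists>t\<in>{0..1} \<inter> {t0 - \<epsilon> / 2..t0 + \<epsilon> / 2}. G t y \<in> topspace P - U}"
      have "closedin Y A" unfolding A_def by (rule closed) (use U in blast)
      then have V: "openin Y (topspace Y - A)" by blast
      have "y0 \<notin> A"
      proof
        assume "y0 \<in> A"
        then obtain t where t: "t \<in> {0..1}" "t \<in> {t0 - \<epsilon> / 2..t0 + \<epsilon> / 2}" "G t y0 \<notin> U" by (auto simp: A_def)
        then have "dist t t0 < \<epsilon>" using \<epsilon>(1) by (auto simp: dist_real_def)
        then show False using \<epsilon>(2)[OF t(1)] t(3) by simp
      qed
      have "openin (top_of_set {0..1}) ({0..1} \<inter> {t0 - \<epsilon> / 2<..<t0 + \<epsilon> / 2})"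
        by (rule openin_open_Int) simp
      then have "openin ?X (({0..1} \<inter> {t0 - \<epsilon> / 2<..<t0 + \<epsilon> / 2}) \<times> (topspace Y - A))"
        using V by (simp add: openin_prod_Times_iff)
      moreover have "x \<in> ({0..1} \<inter> {t0 - \<epsilon> / 2<..<t0 + \<epsilon> / 2}) \<times> (topspace Y - A)"
        using x \<open>y0 \<notin> A\<close> \<epsilon>(1) by simp
      moreover have "({0..1} \<inter> {t0 - \<epsilon> / 2<..<t0 + \<epsilon> / 2}) \<times> (topspace Y - A) \<subseteq> ?L"
      proof
        fix w assume "w \<in> ({0..1} \<inter> {t0 - \<epsilon> / 2<..<t0 + \<epsilon> / 2}) \<times> (topspace Y - A)"
        then obtain t y where w: "w = (t, y)" "t \<in> {0..1}" "t \<in> {t0 - \<epsilon> / 2..t0 + \<epsilon> / 2}" "y \<in> topspace Y" "y \<notin> A"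
          by auto
        have "G t y \<notin> topspace P - U" using w unfolding A_def by blast
        moreover have "G t y \<in> topspace P" using lift[OF w(4)] mem[OF _ _ w(2)] by blast
        ultimately show "w \<in> ?L" using w by simp
      qed
      ultimately show "\<exists>T. openin ?X T \<and> x \<in> T \<and> T \<subseteq> ?L" by blast
    qed
  qed
qed

definition homotopy_on_skeleton ::
  "'p topology \<Rightarrow> ('b \<Rightarrow> 'p) \<Rightarrow> 'p \<Rightarrow> nat \<Rightarrow> (real \<Rightarrow> 'b \<Rightarrow> 'p) \<Rightarrow> bool" where
  "homotopy_on_skeleton P k q n H \<longleftrightarrow> (\<forall>e\<in>E. d e < n \<longrightarrow>
     continuous_map (cylinder (d e)) P (\<lambda>(t, z). H t (\<Phi> e z)) \<and> (\<forall>y\<in>e. H 0 y = k y \<and> H 1 y = q))"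

lemma homotopy_on_skeleton_Suc:
  fixes P :: "'p topology"
  assumes P: "\<And>K. compactin P K \<Longrightarrow> \<exists>Q. K \<subseteq> Q \<and> contractible_space (subtopology P Q)"
    and k: "continuous_map Y P k" and q: "q \<in> topspace P"
    and H: "homotopy_on_skeleton P k q n H"
  shows "\<exists>H'. homotopy_on_skeleton P k q (Suc n) H' \<and> (\<forall>e\<in>E. d e < n \<longrightarrow> (\<forall>y\<in>e. \<forall>t. H' t y = H t y))"
proof -
  define R where "R e J \<longleftrightarrow> continuous_map (cylinder n) P (\<lambda>(t, z). J t z) \<and>
    (\<forall>z\<in>topspace (closed_disk n). J 0 z = k (\<Phi> e z) \<and> J 1 z = q \<and>
       (\<forall>t\<in>{0..1}. radius n z = 1 \<longrightarrow> J t z = H t (\<Phi> e z)))" for e and J :: "real \<Rightarrow> (nat \<Rightarrow> real) \<Rightarrow> 'p"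
  have Hc: "continuous_map (cylinder (d e)) P (\<lambda>(t, z). H t (\<Phi> e z))"
      "\<And>y. y \<in> e \<Longrightarrow> H 0 y = k y \<and> H 1 y = q" if "e \<in> E" "d e < n" for e
    using bspec[OF H[unfolded homotopy_on_skeleton_def] that(1)] that(2) by simp_all
  have "\<exists>J. R e J" if e: "e \<in> E" "d e = n" for e
    unfolding R_def
  proof (rule extend_homotopy_over_cell[OF Hausdorff bd_finite[OF e(1)] _ _ _ k q P])
    have f: "f \<in> E" "d f < n" if "f \<in> F e" for f using bd_lower[OF e(1) that] e(2) by simp_all
    show "continuous_map (closed_disk (d f)) Y (\<Phi> f)" if "f \<in> F e" for f
      by (rule char_cont[OF f(1)[OF that]])
    show "continuous_map (cylinder (d f)) P (\<lambda>(t, z). H t (\<Phi> f z))" if "f \<in> F e" for f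
      by (rule Hc(1)[OF f[OF that]])
    show "H 0 y = k y \<and> H 1 y = q" if yb: "y \<in> (\<Union>f\<in>F e. \<Phi> f ` topspace (closed_disk (d f)))" for y
    proof -
      obtain f z where fz: "f \<in> F e" "z \<in> topspace (closed_disk (d f))" "y = \<Phi> f z" using yb by blast
      have "y \<in> topspace Y"
        using continuous_map_image_subset_topspace[OF char_cont[OF f(1)[OF fz(1)]]] fz(2,3) by blast
      note y = cell_mem[OF this]
      have "d (cell y) \<le> d f" unfolding fz(3) by (rule cell_dim_le[OF f(1)[OF fz(1)] fz(2)])
      then have "d (cell y) < n" using f(2)[OF fz(1)] by simp
      then show ?thesis by (rule Hc(2)[OF y(1) _ y(2)])
    qed
    show "continuous_map (closed_disk n) Y (\<Phi> e)" using char_cont[OF e(1)] e(2) by simp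
    show "\<Phi> e z \<in> (\<Union>f\<in>F e. \<Phi> f ` topspace (closed_disk (d f)))"
      if z: "z \<in> topspace (closed_disk n)" "radius n z = 1" for z
    proof -
      obtain g where g: "g \<in> F e" "\<Phi> e z \<in> g"
        by (rule cell_boundary[OF e(1), of z]) (use z e(2) in simp, use z e(2) in simp, rule that)
      have "\<Phi> e z \<in> \<Phi> g ` topspace (open_disk (d g))" unfolding char_image[OF f(1)[OF g(1)]] by (rule g(2))
      moreover have "topspace (open_disk (d g)) \<subseteq> topspace (closed_disk (d g))"
        by (auto simp: topspace_open_disk topspace_closed_disk)
      ultimately show ?thesis using g(1) by blast
    qed
  qed
  then have ex: "\<exists>J. R e J" if "e \<in> E" "d e = n" for e using that by simp
  define J where "J e = (SOME J. R e J)" for e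
  have RJ: "R e (J e)" if "e \<in> E" "d e = n" for e
    unfolding J_def by (rule someI_ex[OF ex[OF that]])
  define H' where "H' t y = (if d (cell y) = n
    then J (cell y) t (inv_into (topspace (open_disk n)) (\<Phi> (cell y)) y) else H t y)" for t y
  have lower: "H' t y = H t y" if "e \<in> E" "d e < n" "y \<in> e" for e y t
    using cell_eq[OF that(1,3)] that(2) by (simp add: H'_def)
  have new: "H' t (\<Phi> e z) = J e t z" if e: "e \<in> E" "d e = n" and z: "z \<in> topspace (closed_disk n)" and t: "t \<in> {0..1}" for e z t
    using z
  proof (cases rule: in_disk_cases)
    case 1
    have "cell (\<Phi> e z) = e" using cell_interior[OF e(1)] 1 e(2) by simp
    moreover have "inv_into (topspace (open_disk n)) (\<Phi> e) (\<Phi> e z) = z"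
      using char_inj[OF e(1)] 1 e(2) by (simp add: inv_into_f_f)
    ultimately show ?thesis by (simp add: H'_def e(2))
  next
    case 2
    obtain f where f: "f \<in> F e" "\<Phi> e z \<in> f"
      by (rule cell_boundary[OF e(1), of z]) (use z 2 e(2) in simp, use z 2 e(2) in simp, rule that)
    have "f \<in> E" "d f < n" using bd_lower[OF e(1) f(1)] e(2) by simp_all
    then have "H' t (\<Phi> e z) = H t (\<Phi> e z)" by (rule lower[OF _ _ f(2)])
    then show ?thesis using RJ[OF e] z 2(1) t unfolding R_def by simp
  qed
  have "homotopy_on_skeleton P k q (Suc n) H'"
    unfolding homotopy_on_skeleton_def
  proof (intro ballI impI)
    fix e assume e: "e \<in> E" "d e < Suc n"
    show "continuous_map (cylinder (d e)) P (\<lambda>(t, z). H' t (\<Phi> e z)) \<and> (\<forall>y\<in>e. H' 0 y = k y \<and> H' 1 y = q)"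
    proof (cases "d e = n")
      case True
      have "continuous_map (cylinder n) P (\<lambda>(t, z). J e t z)" using RJ[OF e(1) True] by (simp add: R_def)
      then have "continuous_map (cylinder n) P (\<lambda>(t, z). H' t (\<Phi> e z))"
        by (rule continuous_map_eq) (use new[OF e(1) True] in auto)
      moreover have "H' 0 y = k y \<and> H' 1 y = q" if "y \<in> e" for y
      proof -
        have "y \<in> \<Phi> e ` topspace (open_disk n)" using char_image[OF e(1)] True that by simp
        then obtain z where z: "z \<in> topspace (open_disk n)" "y = \<Phi> e z" ..
        then have "z \<in> topspace (closed_disk n)" by (simp add: topspace_open_disk topspace_closed_disk)
        then show ?thesis using new[OF e(1) True, of z 0] new[OF e(1) True, of z 1] RJ[OF e(1) True] z(2)
          by (simp add: R_def)
      qed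
      ultimately show ?thesis using True by simp
    next
      case False
      then have dn: "d e < n" using e(2) by simp
      have eq: "H' t (\<Phi> e z) = H t (\<Phi> e z)" if "z \<in> topspace (closed_disk (d e))" for t z
      proof -
        have "\<Phi> e z \<in> topspace Y"
          using continuous_map_image_subset_topspace[OF char_cont[OF e(1)]] that by blast
        note y = cell_mem[OF this]
        have "d (cell (\<Phi> e z)) < n" using cell_dim_le[OF e(1) that] dn by simp
        then show ?thesis by (rule lower[OF y(1) _ y(2)])
      qed
      have "continuous_map (cylinder (d e)) P (\<lambda>(t, z). H' t (\<Phi> e z))"
        by (rule continuous_map_eq[OF Hc(1)[OF e(1) dn]]) (use eq in auto)
      moreover have "H' 0 y = k y \<and> H' 1 y = q" if "y \<in> e" for y
        using lower[OF e(1) dn that] Hc(2)[OF e(1) dn that] by simp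
      ultimately show ?thesis by simp
    qed
  qed
  then show ?thesis using lower by blast
qed

text \<open>The homotopies on the skeleta extend each other, so each point is eventually governed by the
  homotopy on the skeleton of its own cell.\<close>

lemma null_homotopic:
  fixes P :: "'p topology"
  assumes P: "\<And>K. compactin P K \<Longrightarrow> \<exists>Q. K \<subseteq> Q \<and> contractible_space (subtopology P Q)"
    and k: "continuous_map Y P k" and q: "q \<in> topspace P"
  shows "homotopic_with (\<lambda>_. True) Y P k (\<lambda>_. q)"
proof -
  have "\<exists>f. \<forall>n. homotopy_on_skeleton P k q n (f n) \<and>
      (\<forall>e\<in>E. d e < n \<longrightarrow> (\<forall>y\<in>e. \<forall>t. f (Suc n) t y = f n t y))"
  proof (rule dependent_nat_choice)
    show "\<exists>H. homotopy_on_skeleton P k q 0 H" by (simp add: homotopy_on_skeleton_def)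
    show "\<exists>H'. homotopy_on_skeleton P k q (Suc n) H' \<and>
        (\<forall>e\<in>E. d e < n \<longrightarrow> (\<forall>y\<in>e. \<forall>t. H' t y = H t y))"
      if "homotopy_on_skeleton P k q n H" for H n
      by (rule homotopy_on_skeleton_Suc[OF P k q that])
  qed
  then obtain f where f: "\<forall>n. homotopy_on_skeleton P k q n (f n) \<and>
      (\<forall>e\<in>E. d e < n \<longrightarrow> (\<forall>y\<in>e. \<forall>t. f (Suc n) t y = f n t y))" ..
  have stable: "f (Suc (d e + j)) t y = f (Suc (d e)) t y" if "e \<in> E" "y \<in> e" for e y t j
  proof (induction j)
    case (Suc j)
    have "f (Suc (Suc (d e + j))) t y = f (Suc (d e + j)) t y"
      using f[rule_format, of "Suc (d e + j)"] that by simp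
    then show ?case using Suc by simp
  qed simp
  define G where "G t y = f (Suc (d (cell y))) t y" for t y
  have G: "G t y = f (Suc m) t y" if "y \<in> topspace Y" "d (cell y) \<le> m" for t y m
    using stable[OF cell_mem[OF that(1)], of "m - d (cell y)"] that(2) by (simp add: G_def)
  have fS: "continuous_map (cylinder (d e)) P (\<lambda>(t, z). f (Suc (d e)) t (\<Phi> e z))"
    "\<And>y. y \<in> e \<Longrightarrow> f (Suc (d e)) 0 y = k y \<and> f (Suc (d e)) 1 y = q" if "e \<in> E" for e
  proof -
    have "homotopy_on_skeleton P k q (Suc (d e)) (f (Suc (d e)))" using f by blast
    from bspec[OF this[unfolded homotopy_on_skeleton_def] that]
    show "continuous_map (cylinder (d e)) P (\<lambda>(t, z). f (Suc (d e)) t (\<Phi> e z))"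
      "\<And>y. y \<in> e \<Longrightarrow> f (Suc (d e)) 0 y = k y \<and> f (Suc (d e)) 1 y = q" by simp_all
  qed
  have "continuous_map (prod_topology (top_of_set {0..1}) Y) P (\<lambda>(t, y). G t y)"
  proof (rule continuous_map_homotopy)
    fix e assume e: "e \<in> E"
    have "f (Suc (d e)) t (\<Phi> e z) = G t (\<Phi> e z)" if "z \<in> topspace (closed_disk (d e))" for t z
    proof (rule G[symmetric])
      show "\<Phi> e z \<in> topspace Y"
        using continuous_map_image_subset_topspace[OF char_cont[OF e]] that by blast
      show "d (cell (\<Phi> e z)) \<le> d e" by (rule cell_dim_le[OF e that])
    qed
    then show "continuous_map (cylinder (d e)) P (\<lambda>(t, z). G t (\<Phi> e z))"
      by (intro continuous_map_eq[OF fS(1)[OF e]]) auto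
  qed
  moreover have "G 0 y = k y \<and> G 1 y = q" if "y \<in> topspace Y" for y
    using fS(2)[OF cell_mem[OF that]] by (simp add: G_def)
  ultimately show ?thesis
    by (subst homotopic_with) (auto intro!: exI[of _ "\<lambda>(t, y). G t y"])
qed

end

text \<open>The direction of Whitehead's theorem that is needed: a map from a CW-complex to a space whose
  compact subsets are contained in contractible subspaces is null-homotopic.\<close>

theorem CW_complex_null_homotopic:
  assumes Y: "CW_complex Y"
    and P: "\<And>K. compactin P K \<Longrightarrow> \<exists>Q. K \<subseteq> Q \<and> contractible_space (subtopology P Q)"
    and k: "continuous_map Y P k" and q: "q \<in> topspace P"
  shows "homotopic_with (\<lambda>_. True) Y P k (\<lambda>_. q)"
proof -
  obtain C where C: "\<Union>(\<Union>n. C n) = topspace Y" "pairwise disjnt (\<Union>n. C n)"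
    "\<And>n e. e \<in> C n \<Longrightarrow> \<exists>\<Phi>. characteristic_map Y C n e \<Phi>"
    "\<And>S. S \<subseteq> topspace Y \<Longrightarrow> (\<forall>e\<in>\<Union>n. C n. closedin Y (S \<inter> Y closure_of e)) \<Longrightarrow> closedin Y S"
    and T2: "Hausdorff_space Y"
    using Y unfolding CW_complex_def by (elim conjE exE) blast
  define E where "E = (\<Union>n. C n)"
  \<comment> \<open>Choosing the least dimension keeps the boundary cells strictly lower even if a set occurs as a cell in several dimensions.\<close>
  define d where "d e = (LEAST n. e \<in> C n)" for e
  have dC: "e \<in> C (d e)" if "e \<in> E" for e
    using that unfolding E_def d_def by (auto intro: LeastI)
  define \<Phi> where "\<Phi> e = (SOME \<Phi>. characteristic_map Y C (d e) e \<Phi>)" for e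
  have ch: "characteristic_map Y C (d e) e (\<Phi> e)" if "e \<in> E" for e
    unfolding \<Phi>_def by (rule someI_ex[OF C(3)[OF dC[OF that]]])
  define B where "B e F \<longleftrightarrow> finite F \<and> F \<subseteq> (\<Union>m<d e. C m) \<and>
      \<Phi> e ` (topspace (closed_disk (d e)) - topspace (open_disk (d e))) \<subseteq> \<Union>F" for e F
  define F where "F e = (SOME F. B e F)" for e
  have F: "B e (F e)" if "e \<in> E" for e
    unfolding F_def by (rule someI_ex) (use ch[OF that] in \<open>simp add: characteristic_map_def B_def\<close>)
  have "cell_decomposition Y E d \<Phi> F"
  proof
    fix e assume e: "e \<in> E"
    have e_sub: "e \<subseteq> topspace Y" using e C(1) unfolding E_def by blast
    have hom: "homeomorphic_map (open_disk (d e)) (subtopology Y e) (\<Phi> e)"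
      using ch[OF e] by (simp add: characteristic_map_def)
    show "continuous_map (closed_disk (d e)) Y (\<Phi> e)" using ch[OF e] by (simp add: characteristic_map_def)
    show "\<Phi> e ` topspace (open_disk (d e)) = e"
      using homeomorphic_imp_surjective_map[OF hom] e_sub by auto
    show "inj_on (\<Phi> e) (topspace (open_disk (d e)))" by (rule homeomorphic_imp_injective_map[OF hom])
    show "finite (F e)"
      "\<Phi> e ` (topspace (closed_disk (d e)) - topspace (open_disk (d e))) \<subseteq> \<Union>(F e)"
      using F[OF e] by (simp_all add: B_def)
    fix f assume "f \<in> F e"
    then obtain m where m: "m < d e" "f \<in> C m" using F[OF e] by (auto simp: B_def)
    then have "d f \<le> m" unfolding d_def by (intro Least_le)
    then show "f \<in> E \<and> d f < d e" using m by (auto simp: E_def)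
  next
    fix S assume S: "S \<subseteq> topspace Y" "\<And>e. e \<in> E \<Longrightarrow> closedin Y (S \<inter> Y closure_of e)"
    show "closedin Y S" by (rule C(4)[OF S(1)]) (use S(2) in \<open>simp add: E_def\<close>)
  qed (use C(1,2) T2 in \<open>simp_all add: E_def\<close>)
  then show ?thesis by (rule cell_decomposition.null_homotopic[OF _ P k q])
qed

section \<open>Smooth structures on the open longray\<close>

lemma real_smooth_on_cong:
  assumes S: "open S" and f: "real_smooth_on S f" and eq: "\<And>x. x \<in> S \<Longrightarrow> g x = f x"
  shows "real_smooth_on S g"
proof -
  have 1: "(deriv ^^ n) g x = (deriv ^^ n) f x" if "x \<in> S" for n x
    using that
  proof (induction n arbitrary: x)
    case 0
    then show ?case by (simp add: eq)
  next
    case (Suc n)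
    have "\<forall>\<^sub>F y in nhds x. (deriv ^^ n) g y = (deriv ^^ n) f y"
      using eventually_nhds_in_open[OF S Suc.prems] by (rule eventually_mono) (rule Suc.IH)
    then show ?case by (simp add: deriv_cong_ev)
  qed
  show ?thesis
    unfolding real_smooth_on_def
  proof (intro allI ballI)
    fix n x assume x: "x \<in> S"
    have "(deriv ^^ n) f field_differentiable at x" using f x by (simp add: real_smooth_on_def)
    then obtain D where "((deriv ^^ n) f has_field_derivative D) (at x)" by (auto simp: field_differentiable_def)
    then have "((deriv ^^ n) g has_field_derivative D) (at x)"
      by (rule DERIV_cong_ev[THEN iffD1, rotated -1, OF _ refl _ refl])
        (rule eventually_mono[OF eventually_nhds_in_open[OF S x]], simp add: 1)
    then show "(deriv ^^ n) g field_differentiable at x" by (auto simp: field_differentiable_def)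
  qed
qed

lemma real_smooth_on_uminus:
  assumes S: "open S" and f: "real_smooth_on S f"
  shows "real_smooth_on S (\<lambda>x. - f x)"
proof -
  have fd: "(deriv ^^ n) f field_differentiable at x" if "x \<in> S" for n x
    using f that by (simp add: real_smooth_on_def)
  have eq: "(deriv ^^ n) (\<lambda>x. - f x) x = - (deriv ^^ n) f x" if "x \<in> S" for n x
    using that
  proof (induction n arbitrary: x)
    case (Suc n)
    have "\<forall>\<^sub>F y in nhds x. (deriv ^^ n) (\<lambda>x. - f x) y = - (deriv ^^ n) f y"
      using eventually_nhds_in_open[OF S Suc.prems] by (rule eventually_mono) (rule Suc.IH)
    then have "deriv ((deriv ^^ n) (\<lambda>x. - f x)) x = deriv (\<lambda>y. - (deriv ^^ n) f y) x"
      by (rule deriv_cong_ev) simp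
    also have "\<dots> = - deriv ((deriv ^^ n) f) x"
      by (rule DERIV_imp_deriv) (intro DERIV_minus DERIV_deriv_iff_field_differentiable[THEN iffD2] fd Suc.prems)
    finally show ?case by simp
  qed simp
  have "(deriv ^^ n) (\<lambda>x. - f x) field_differentiable at x" if x: "x \<in> S" for n x
  proof -
    have "((\<lambda>y. - (deriv ^^ n) f y) has_field_derivative - deriv ((deriv ^^ n) f) x) (at x)"
      by (intro DERIV_minus DERIV_deriv_iff_field_differentiable[THEN iffD2] fd x)
    then have "((deriv ^^ n) (\<lambda>x. - f x) has_field_derivative - deriv ((deriv ^^ n) f) x) (at x)"
      by (rule has_field_derivative_transform_within_open[OF _ S x]) (simp add: eq)
    then show ?thesis by (auto simp: field_differentiable_def)
  qed
  then show ?thesis by (simp add: real_smooth_on_def)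
qed

lemma real_smooth_on_reflect:
  assumes S: "open S" and f: "real_smooth_on (uminus ` S) f"
  shows "real_smooth_on S (\<lambda>x. f (- x))"
proof -
  have fd: "(deriv ^^ n) f field_differentiable at (- x)" if "x \<in> S" for n x
    using f that by (simp add: real_smooth_on_def)
  have der: "((\<lambda>y. c * (deriv ^^ n) f (- y)) has_field_derivative - c * deriv ((deriv ^^ n) f) (- x)) (at x)"
    if "x \<in> S" for n x c
  proof -
    have "((deriv ^^ n) f has_field_derivative deriv ((deriv ^^ n) f) (- x)) (at (- x))"
      by (rule DERIV_deriv_iff_field_differentiable[THEN iffD2, OF fd[OF that]])
    then have "((\<lambda>y. (deriv ^^ n) f (- y)) has_field_derivative deriv ((deriv ^^ n) f) (- x) * -1) (at x)"
      by (rule DERIV_chain2) (auto intro!: derivative_eq_intros)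
    from DERIV_cmult[OF this, of c] show ?thesis by (simp add: mult_ac)
  qed
  have eq: "(deriv ^^ n) (\<lambda>x. f (- x)) x = (-1) ^ n * (deriv ^^ n) f (- x)" if "x \<in> S" for n x
    using that
  proof (induction n arbitrary: x)
    case (Suc n)
    have "\<forall>\<^sub>F y in nhds x. (deriv ^^ n) (\<lambda>x. f (- x)) y = (-1) ^ n * (deriv ^^ n) f (- y)"
      using eventually_nhds_in_open[OF S Suc.prems] by (rule eventually_mono) (rule Suc.IH)
    then have "deriv ((deriv ^^ n) (\<lambda>x. f (- x))) x = deriv (\<lambda>y. (-1) ^ n * (deriv ^^ n) f (- y)) x"
      by (rule deriv_cong_ev) simp
    also have "\<dots> = - ((-1) ^ n) * deriv ((deriv ^^ n) f) (- x)"
      by (rule DERIV_imp_deriv[OF der[OF Suc.prems]])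
    finally show ?case by simp
  qed simp
  have "(deriv ^^ n) (\<lambda>x. f (- x)) field_differentiable at x" if x: "x \<in> S" for n x
  proof -
    have "((deriv ^^ n) (\<lambda>x. f (- x)) has_field_derivative - ((-1) ^ n) * deriv ((deriv ^^ n) f) (- x)) (at x)"
      by (rule has_field_derivative_transform_within_open[OF der[OF x] S x]) (simp add: eq)
    then show ?thesis by (auto simp: field_differentiable_def)
  qed
  then show ?thesis by (simp add: real_smooth_on_def)
qed

lemma open_longray_plus: "open (- {bot :: longray})"
  by (simp add: open_Compl)

lemma openin_longray_plus: "openin longray_plus U \<longleftrightarrow> open U \<and> bot \<notin> U"
  unfolding longray_plus_def using openin_open_eq[OF open_longray_plus, of U] by auto

lemma subtopology_longray_plus: "bot \<notin> U \<Longrightarrow> subtopology longray_plus U = top_of_set U"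
  unfolding longray_plus_def subtopology_subtopology by (rule arg_cong[where f = top_of_set]) auto

lemma topspace_longray_plus: "topspace longray_plus = - {bot}"
  by (simp add: longray_plus_def)

lemma chart_of_longray_plus_iff:
  "chart_of longray_plus (U, \<phi>) \<longleftrightarrow> open U \<and> bot \<notin> U \<and> open (\<phi> ` U) \<and> inj_on \<phi> U \<and>
     continuous_on U \<phi> \<and> continuous_on (\<phi> ` U) (inv_into U \<phi>)"
proof -
  have "homeomorphic_map (top_of_set U) (top_of_set (\<phi> ` U)) \<phi> \<longleftrightarrow>
      inj_on \<phi> U \<and> continuous_on U \<phi> \<and> continuous_on (\<phi> ` U) (inv_into U \<phi>)"
  proof
    assume h: "homeomorphic_map (top_of_set U) (top_of_set (\<phi> ` U)) \<phi>"
    then obtain g where g: "homeomorphic_maps (top_of_set U) (top_of_set (\<phi> ` U)) \<phi> g"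
      by (auto simp: homeomorphic_map_maps)
    have inj: "inj_on \<phi> U" using homeomorphic_imp_injective_map[OF h] by simp
    have "continuous_on (\<phi> ` U) g" "\<And>x. x \<in> U \<Longrightarrow> g (\<phi> x) = x" "continuous_on U \<phi>"
      using g by (auto simp: homeomorphic_maps_def)
    then have "continuous_on (\<phi> ` U) (inv_into U \<phi>)"
      by (subst continuous_on_cong[OF refl, of _ _ g]) (auto simp: inj)
    then show "inj_on \<phi> U \<and> continuous_on U \<phi> \<and> continuous_on (\<phi> ` U) (inv_into U \<phi>)"
      using inj \<open>continuous_on U \<phi>\<close> by blast
  next
    assume "inj_on \<phi> U \<and> continuous_on U \<phi> \<and> continuous_on (\<phi> ` U) (inv_into U \<phi>)"
    then have "homeomorphic_maps (top_of_set U) (top_of_set (\<phi> ` U)) \<phi> (inv_into U \<phi>)"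
      unfolding homeomorphic_maps_def by (auto simp: inv_into_into f_inv_into_f continuous_map_in_subtopology)
    then show "homeomorphic_map (top_of_set U) (top_of_set (\<phi> ` U)) \<phi>"
      using homeomorphic_map_maps by blast
  qed
  then show ?thesis
    by (auto simp: chart_of_def openin_longray_plus subtopology_longray_plus)
qed

text \<open>The factor by which the coordinate of a tangent vector at \<open>x\<close> changes from the chart \<open>c\<close> to the
  chart \<open>d\<close>.\<close>

definition jac :: "longray chart \<Rightarrow> longray chart \<Rightarrow> longray \<Rightarrow> real" where
  "jac c d x = deriv (transition c d) (snd c x)"

locale smooth_longray =
  fixes A :: "longray chart set"
  assumes smooth: "smooth_structure longray_plus A"
begin

lemma chart:
  assumes "c \<in> A"
  shows "open (fst c)" "bot \<notin> fst c" "open (snd c ` fst c)" "inj_on (snd c) (fst c)"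
    "continuous_on (fst c) (snd c)" "continuous_on (snd c ` fst c) (inv_into (fst c) (snd c))"
proof -
  have "chart_of longray_plus (fst c, snd c)" using smooth assms by (simp add: smooth_structure_def)
  then show "open (fst c)" "bot \<notin> fst c" "open (snd c ` fst c)" "inj_on (snd c) (fst c)"
    "continuous_on (fst c) (snd c)" "continuous_on (snd c ` fst c) (inv_into (fst c) (snd c))"
    unfolding chart_of_longray_plus_iff by blast+
qed

lemma open_chart_image:
  assumes c: "c \<in> A" and W: "open W" "W \<subseteq> fst c"
  shows "open (snd c ` W)"
proof -
  have "open (inv_into (fst c) (snd c) -` W \<inter> snd c ` fst c)"
    using chart(6)[OF c] chart(3)[OF c] W(1)
      continuous_on_open_vimage[of "snd c ` fst c" "inv_into (fst c) (snd c)"] by simp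
  also have "inv_into (fst c) (snd c) -` W \<inter> snd c ` fst c = snd c ` W"
    using W(2) chart(4)[OF c] by (auto simp: inv_into_f_f subset_iff image_iff)
  finally show ?thesis .
qed

lemma compatible: "c \<in> A \<Longrightarrow> d \<in> A \<Longrightarrow> smoothly_compatible c d"
  using smooth by (simp add: smooth_structure_def)

lemma transition_eq: "c \<in> A \<Longrightarrow> x \<in> fst c \<Longrightarrow> transition c d (snd c x) = snd d x"
  using chart(4)[of c] by (simp add: transition_def)

lemma transition_smooth:
  "c \<in> A \<Longrightarrow> d \<in> A \<Longrightarrow> x \<in> fst c \<Longrightarrow> x \<in> fst d \<Longrightarrow> (deriv ^^ n) (transition c d) field_differentiable at (snd c x)"
  using compatible[of c d] by (simp add: smoothly_compatible_def real_smooth_on_def)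

lemma transition_deriv:
  assumes "c \<in> A" "d \<in> A" "x \<in> fst c" "x \<in> fst d"
  shows "(transition c d has_field_derivative jac c d x) (at (snd c x))"
  using transition_smooth[OF assms, of 0] by (simp add: DERIV_deriv_iff_field_differentiable jac_def)

lemma jac_cocycle:
  assumes "c \<in> A" "d \<in> A" "e \<in> A" "x \<in> fst c" "x \<in> fst d" "x \<in> fst e"
  shows "jac c e x = jac d e x * jac c d x"
proof -
  have "(transition d e has_field_derivative jac d e x) (at (transition c d (snd c x)))"
    using transition_deriv[of d e x] assms by (simp add: transition_eq)
  from DERIV_chain2[OF this transition_deriv[of c d x]]
  have "((\<lambda>y. transition d e (transition c d y)) has_field_derivative jac d e x * jac c d x) (at (snd c x))"
    using assms by simp
  then have "(transition c e has_field_derivative jac d e x * jac c d x) (at (snd c x))"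
  proof (rule has_field_derivative_transform_within_open)
    show "open (snd c ` (fst c \<inter> fst d))"
      using chart(1)[of c] chart(1)[of d] assms by (intro open_chart_image) auto
    show "snd c x \<in> snd c ` (fst c \<inter> fst d)" using assms by auto
    show "transition d e (transition c d y) = transition c e y" if "y \<in> snd c ` (fst c \<inter> fst d)" for y
    proof -
      from that obtain w where "w \<in> fst c" "w \<in> fst d" "y = snd c w" by blast
      then show ?thesis using assms by (simp add: transition_eq)
    qed
  qed
  then show ?thesis unfolding jac_def[of c e] by (rule DERIV_imp_deriv)
qed

lemma jac_refl:
  assumes "c \<in> A" "x \<in> fst c"
  shows "jac c c x = 1"
proof -
  have "(transition c c has_field_derivative 1) (at (snd c x))"
  proof (rule has_field_derivative_transform_within_open[OF DERIV_ident chart(3)[OF assms(1)]])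
    show "snd c x \<in> snd c ` fst c" using assms by simp
    show "y = transition c c y" if "y \<in> snd c ` fst c" for y
      using that assms(1) by (auto simp: transition_eq)
  qed
  then show ?thesis unfolding jac_def by (rule DERIV_imp_deriv)
qed

lemma jac_inverse:
  "c \<in> A \<Longrightarrow> d \<in> A \<Longrightarrow> x \<in> fst c \<Longrightarrow> x \<in> fst d \<Longrightarrow> jac d c x * jac c d x = 1"
  using jac_cocycle[of c d c x] jac_refl[of c x] by simp

lemma jac_continuous:
  assumes "c \<in> A" "d \<in> A"
  shows "continuous_on (fst c \<inter> fst d) (jac c d)"
proof -
  have "continuous_on (snd c ` (fst c \<inter> fst d)) (deriv (transition c d))"
  proof (intro continuous_at_imp_continuous_on ballI)
    fix y assume "y \<in> snd c ` (fst c \<inter> fst d)"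
    then obtain x where "x \<in> fst c" "x \<in> fst d" "y = snd c x" by blast
    then show "isCont (deriv (transition c d)) y"
      using transition_smooth[OF assms, of x 1] field_differentiable_imp_continuous_at by simp
  qed
  moreover have "continuous_on (fst c \<inter> fst d) (snd c)"
    by (rule continuous_on_subset[OF chart(5)[OF assms(1)]]) blast
  ultimately have "continuous_on (fst c \<inter> fst d) (\<lambda>x. deriv (transition c d) (snd c x))"
    by (rule continuous_on_compose2) simp
  then show ?thesis by (simp add: jac_def[abs_def])
qed

text \<open>A transition function between charts that preserve the order near \<open>x\<close> is increasing, so its
  derivative is nonnegative, and it is invertible by the cocycle identity.\<close>

lemma jac_pos:
  assumes c: "c \<in> A" "d \<in> A" and N: "open N" "x \<in> N" "N \<subseteq> fst c" "strict_mono_on N (snd c)"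
    and M: "open M" "x \<in> M" "M \<subseteq> fst d" "strict_mono_on M (snd d)"
  shows "0 < jac c d x"
proof (rule ccontr)
  have xc: "x \<in> fst c" and xd: "x \<in> fst d" using N(2,3) M(2,3) by blast+
  assume "\<not> 0 < jac c d x"
  moreover have "jac c d x \<noteq> 0" using jac_inverse[OF c xc xd] by auto
  ultimately have "jac c d x < 0" by simp
  from DERIV_neg_dec_right[OF transition_deriv[OF c xc xd] this]
  obtain e where e: "e > 0" "\<And>h. 0 < h \<Longrightarrow> h < e \<Longrightarrow> transition c d (snd c x + h) < transition c d (snd c x)"
    by blast
  have "open (snd c ` (N \<inter> M))" using N M by (intro open_chart_image[OF c(1)]) auto
  moreover have "snd c x \<in> snd c ` (N \<inter> M)" using N M by blast
  ultimately obtain r where r: "r > 0" "ball (snd c x) r \<subseteq> snd c ` (N \<inter> M)"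
    using open_contains_ball by metis
  define h where "h = min e r / 2"
  have h: "0 < h" "h < e" "h < r" using e(1) r(1) by (auto simp: h_def min_def)
  then have "snd c x + h \<in> ball (snd c x) r" by (simp add: dist_real_def)
  then obtain y where y: "y \<in> N" "y \<in> M" "snd c x + h = snd c y" using r(2) by blast
  have "x < y"
  proof (rule ccontr)
    assume "\<not> x < y"
    then have "y = x \<or> y < x" by auto
    then have "snd c y \<le> snd c x" using N(2,4) y(1) by (auto dest: strict_mono_onD)
    then show False using y(3) h(1) by simp
  qed
  then have "snd d x < snd d y" using M y by (auto dest: strict_mono_onD)
  moreover have "transition c d (snd c y) < transition c d (snd c x)" using e(2)[OF h(1,2)] y(3) by simp
  ultimately show False using c(1) y(1) N by (simp add: transition_eq subset_iff)
qed

text \<open>The reflection of a chart is compatible with the atlas, and by maximality belongs to it. Thus there is a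
  chart that preserves the order near any given point; without one the fibre of positive vectors
  over the point would be empty.\<close>

lemma reflected_chart:
  assumes "c \<in> A"
  shows "(fst c, \<lambda>x. - snd c x) \<in> A"
proof -
  let ?r = "(fst c, \<lambda>x. - snd c x)"
  have im: "(\<lambda>x. - snd c x) ` W = uminus ` (snd c ` W)" for W by (simp add: image_image)
  have inv: "inv_into (fst c) (\<lambda>x. - snd c x) y = inv_into (fst c) (snd c) (- y)"
    if "y \<in> (\<lambda>x. - snd c x) ` fst c" for y
  proof -
    from that obtain x where x: "x \<in> fst c" "y = - snd c x" by blast
    have "inj_on (\<lambda>x. - snd c x) (fst c)" using chart(4)[OF assms] by (simp add: inj_on_def)
    then have "inv_into (fst c) (\<lambda>x. - snd c x) y = x" unfolding x(2) by (rule inv_into_f_f[OF _ x(1)])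
    then show ?thesis using chart(4)[OF assms] x by simp
  qed
  have "chart_of longray_plus ?r"
    unfolding chart_of_longray_plus_iff
  proof (intro conjI)
    show "open ((\<lambda>x. - snd c x) ` fst c)" unfolding im by (rule open_negations[OF chart(3)[OF assms]])
    show "inj_on (\<lambda>x. - snd c x) (fst c)" using chart(4)[OF assms] by (simp add: inj_on_def)
    show "continuous_on ((\<lambda>x. - snd c x) ` fst c) (inv_into (fst c) (\<lambda>x. - snd c x))"
      by (subst continuous_on_cong[OF refl inv])
        (auto intro!: continuous_on_compose2[OF chart(6)[OF assms]] continuous_intros)
  qed (use chart[OF assms] in \<open>auto intro!: continuous_intros\<close>)
  moreover have "smoothly_compatible ?r d" if d: "d \<in> A" for d
  proof -
    have o: "open (snd c ` (fst c \<inter> fst d))" "open (snd d ` (fst c \<inter> fst d))"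
      using chart(1)[OF assms] chart(1)[OF d] by (auto intro!: open_chart_image assms d)
    have cd: "real_smooth_on (snd c ` (fst c \<inter> fst d)) (transition c d)"
      "real_smooth_on (snd d ` (fst c \<inter> fst d)) (transition d c)"
      using compatible[OF assms d] by (auto simp: smoothly_compatible_def)
    have o': "open ((\<lambda>x. - snd c x) ` (fst c \<inter> fst d))" unfolding im by (rule open_negations[OF o(1)])
    have "real_smooth_on ((\<lambda>x. - snd c x) ` (fst c \<inter> fst d)) (\<lambda>x. transition c d (- x))"
      by (rule real_smooth_on_reflect[OF o']) (use cd(1) in \<open>simp add: image_image\<close>)
    then have "real_smooth_on ((\<lambda>x. - snd c x) ` (fst c \<inter> fst d)) (transition ?r d)"
      by (rule real_smooth_on_cong[OF o']) (auto simp: transition_def inv)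
    moreover have "transition d ?r = (\<lambda>x. - transition d c x)" by (auto simp: transition_def)
    ultimately show ?thesis
      using real_smooth_on_uminus[OF o(2) cd(2)] by (simp add: smoothly_compatible_def)
  qed
  moreover have "\<forall>c. chart_of longray_plus c \<and> (\<forall>d\<in>A. smoothly_compatible c d) \<longrightarrow> c \<in> A"
    using smooth unfolding smooth_structure_def by (elim conjE)
  ultimately show ?thesis by (elim allE impE) (intro conjI ballI)
qed

definition increasing_chart :: "longray \<Rightarrow> longray \<Rightarrow> longray chart \<Rightarrow> bool" where
  "increasing_chart a b c \<longleftrightarrow> c \<in> A \<and> {a<..<b} \<subseteq> fst c \<and> strict_mono_on {a<..<b} (snd c)"

text \<open>An injective continuous function on an interval is monotone, and reflection makes it increasing.\<close>

lemma increasing_chart_exists: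
  assumes "bot < x"
  obtains a b c where "increasing_chart a b c" "a < x" "x < b"
proof -
  have "(\<Union>c\<in>A. fst c) = topspace longray_plus" using smooth by (simp add: smooth_structure_def)
  moreover have "x \<in> topspace longray_plus" using assms by (simp add: topspace_longray_plus bot.not_eq_extremum)
  ultimately have "x \<in> (\<Union>c\<in>A. fst c)" by simp
  then obtain c where c: "c \<in> A" "x \<in> fst c" by (rule UN_E)
  obtain a where a: "a < x" "{a<..x} \<subseteq> fst c" using open_left[OF chart(1)[OF c(1)] c(2) assms] by blast
  obtain y where "x < y" using gt_ex by blast
  then obtain b where b: "x < b" "{x..<b} \<subseteq> fst c" using open_right[OF chart(1)[OF c(1)] c(2)] by blast
  have sub: "{a<..<b} \<subseteq> fst c"
  proof
    fix z assume "z \<in> {a<..<b}"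
    then show "z \<in> fst c" using a(2) b(2) by (cases "z \<le> x") auto
  qed
  have cont: "continuous_on {u..v} (snd c)" "inj_on (snd c) {u..v}" if "a < u" "v < b" for u v
  proof -
    have "{u..v} \<subseteq> {a<..<b}"
      using less_le_trans[OF that(1)] le_less_trans[OF _ that(2)] by auto
    then have "{u..v} \<subseteq> fst c" using sub by (rule order_trans)
    then show "continuous_on {u..v} (snd c)" "inj_on (snd c) {u..v}"
      using chart(4,5)[OF c(1)] by (auto intro: continuous_on_subset inj_on_subset)
  qed
  have between: "snd c u < snd c w \<and> snd c w < snd c v \<or> snd c v < snd c w \<and> snd c w < snd c u"
    if "a < u" "u < w" "w < v" "v < b" for u w v
    by (rule continuous_inj_imp_mono[OF that(2,3) cont[OF that(1,4)]])
  obtain p where p: "a < p" "p < x" using dense[OF a(1)] by blast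
  obtain q where q: "x < q" "q < b" using dense[OF b(1)] by blast
  have mono: "snd c u < snd c v \<longleftrightarrow> snd c p < snd c q" if "a < u" "u < v" "v < b" for u v
  proof -
    define l where "l = min u p"
    define r where "r = max v q"
    have l: "a < l" "l \<le> u" "l \<le> p" and r: "r < b" "v \<le> r" "q \<le> r"
      using that p q by (auto simp: l_def r_def)
    have key: "snd c u' < snd c v' \<longleftrightarrow> snd c l < snd c r" if "l \<le> u'" "u' < v'" "v' \<le> r" for u' v'
    proof -
      have lv: "snd c l < snd c v' \<longleftrightarrow> snd c l < snd c r"
      proof (cases "v' = r")
        case False
        have "l < v'" "v' < r" using that False by auto
        from between[OF l(1) this r(1)] show ?thesis by argo
      qed simp
      show ?thesis
      proof (cases "u' = l")
        case True
        then show ?thesis using lv by simp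
      next
        case False
        have "l < u'" "v' < b" using that False r(1) by auto
        from between[OF l(1) this(1) that(2) this(2)] show ?thesis using lv by argo
      qed
    qed
    have pq: "p < q" using p q by auto
    show ?thesis using key[OF l(2) that(2) r(2)] key[OF l(3) pq r(3)] by simp
  qed
  show ?thesis
  proof (cases "snd c p < snd c q")
    case True
    then have "strict_mono_on {a<..<b} (snd c)" by (intro strict_mono_onI) (simp add: mono)
    then have "increasing_chart a b c" using c sub by (simp add: increasing_chart_def)
    then show ?thesis by (rule that[OF _ a(1) b(1)])
  next
    case False
    have "snd c v < snd c u" if "a < u" "u < v" "v < b" for u v
    proof -
      have "snd c u \<noteq> snd c v"
      proof
        assume "snd c u = snd c v"
        then have "u = v"
          by (rule inj_onD[OF cont(2)[OF that(1,3)]]) (use that(2) in \<open>simp_all add: less_imp_le\<close>)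
        then show False using that(2) by simp
      qed
      then show ?thesis using mono[OF that] False by simp
    qed
    then have "strict_mono_on {a<..<b} (\<lambda>x. - snd c x)" by (intro strict_mono_onI) simp
    then have "increasing_chart a b (fst c, \<lambda>x. - snd c x)"
      using reflected_chart[OF c(1)] sub by (simp add: increasing_chart_def)
    then show ?thesis by (rule that[OF _ a(1) b(1)])
  qed
qed

end

section \<open>The positive tangent bundle\<close>

lemma continuous_map_quotient_projection:
  "continuous_map X (quotient_topology X r) (\<lambda>x. r `` {x})"
  unfolding continuous_map_def topspace_quotient_topology openin_quotient_topology
  by (auto simp: quotient_def)

lemma continuous_map_from_quotient:
  assumes "continuous_map X Z (\<lambda>x. f (r `` {x}))"
  shows "continuous_map (quotient_topology X r) Z f"
  unfolding continuous_map_def topspace_quotient_topology openin_quotient_topology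
proof (intro conjI allI impI)
  show "f \<in> topspace X // r \<rightarrow> topspace Z"
    using continuous_map_image_subset_topspace[OF assms] by (auto simp: quotient_def)
  fix U assume U: "openin Z U"
  have eq: "{x \<in> topspace X. r `` {x} \<in> {\<xi> \<in> topspace X // r. f \<xi> \<in> U}} = {x \<in> topspace X. f (r `` {x}) \<in> U}"
    by (auto simp: quotient_def)
  show "openin X {x \<in> topspace X. r `` {x} \<in> {\<xi> \<in> topspace X // r. f \<xi> \<in> U}}"
    unfolding eq by (rule openin_continuous_map_preimage[OF assms U])
qed blast

lemma continuous_map_from_sum:
  assumes "\<And>i. i \<in> I \<Longrightarrow> continuous_map (X i) Z (\<lambda>x. f (i, x))"
  shows "continuous_map (sum_topology X I) Z f"
  unfolding continuous_map_def
proof (intro conjI allI impI)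
  show "f \<in> topspace (sum_topology X I) \<rightarrow> topspace Z"
    using continuous_map_image_subset_topspace[OF assms] by (fastforce simp: image_subset_iff)
  fix U assume U: "openin Z U"
  show "openin (sum_topology X I) {x \<in> topspace (sum_topology X I). f x \<in> U}"
    unfolding openin_sum_topology
  proof (intro conjI ballI)
    fix i assume i: "i \<in> I"
    have "{x. (i, x) \<in> {x \<in> topspace (sum_topology X I). f x \<in> U}} = {x \<in> topspace (X i). f (i, x) \<in> U}"
      using i by auto
    then show "openin (X i) {x. (i, x) \<in> {x \<in> topspace (sum_topology X I). f x \<in> U}}"
      using openin_continuous_map_preimage[OF assms[OF i] U] by simp
  qed auto
qed

type_synonym tangent = "(longray chart \<times> longray \<times> real) set"

text \<open>The base point of a tangent vector and its coordinate in the chart \<open>c\<close>, read off from an arbitrary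
  representative of the class.\<close>

definition base :: "tangent \<Rightarrow> longray" where
  "base \<xi> = fst (snd (SOME z. z \<in> \<xi>))"

definition component :: "longray chart \<Rightarrow> tangent \<Rightarrow> real" where
  "component c \<xi> = (SOME w. (c, base \<xi>, w) \<in> \<xi>)"

context smooth_longray
begin

abbreviation "TB \<equiv> tangent_bundle longray_plus A"
abbreviation "PTB \<equiv> positive_tangent_bundle longray_plus A"

definition vec :: "longray chart \<Rightarrow> longray \<Rightarrow> real \<Rightarrow> tangent" where
  "vec c x v = tangent_rel A `` {(c, x, v)}"

lemma mem_vec: "(d, y, w) \<in> vec c x v \<longleftrightarrow> c \<in> A \<and> d \<in> A \<and> y = x \<and> x \<in> fst c \<and> x \<in> fst d \<and> w = jac c d x * v"
  by (auto simp: vec_def tangent_rel_def jac_def)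

lemma vec_self: "c \<in> A \<Longrightarrow> x \<in> fst c \<Longrightarrow> (c, x, v) \<in> vec c x v"
  by (simp add: mem_vec jac_refl)

lemma vec_transition:
  assumes "c \<in> A" "d \<in> A" "x \<in> fst c" "x \<in> fst d"
  shows "vec c x v = vec d x (jac c d x * v)"
proof (intro set_eqI, clarify)
  fix e y w
  show "(e, y, w) \<in> vec c x v \<longleftrightarrow> (e, y, w) \<in> vec d x (jac c d x * v)"
    unfolding mem_vec using assms jac_cocycle[of c d e x] by (auto simp: mult.assoc)
qed

lemma base_vec:
  assumes "c \<in> A" "x \<in> fst c"
  shows "base (vec c x v) = x"
proof -
  have "(SOME z. z \<in> vec c x v) \<in> vec c x v" by (rule someI[of "\<lambda>z. z \<in> vec c x v", OF vec_self[OF assms]])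
  then show ?thesis by (cases "SOME z. z \<in> vec c x v") (simp add: base_def mem_vec)
qed

lemma component_vec:
  assumes "c \<in> A" "d \<in> A" "x \<in> fst c" "x \<in> fst d"
  shows "component d (vec c x v) = jac c d x * v"
  unfolding component_def base_vec[OF assms(1,3)] by (rule some_equality) (use assms in \<open>simp_all add: mem_vec\<close>)

abbreviation "charts_sum \<equiv> sum_topology (\<lambda>c. prod_topology (subtopology longray_plus (fst c)) euclideanreal) A"

lemma TB_eq: "TB = quotient_topology charts_sum (tangent_rel A)"
  by (simp add: tangent_bundle_def)

lemma topspace_chart: "c \<in> A \<Longrightarrow> topspace (subtopology longray_plus (fst c)) = fst c"
  using chart(2)[of c] by (auto simp: topspace_longray_plus)

lemma topspace_charts_sum: "topspace charts_sum = {(c, x, v). c \<in> A \<and> x \<in> fst c}"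
  using topspace_chart by auto

lemma topspace_TB: "\<xi> \<in> topspace TB \<longleftrightarrow> (\<exists>c x v. c \<in> A \<and> x \<in> fst c \<and> \<xi> = vec c x v)"
  unfolding TB_eq topspace_quotient_topology topspace_charts_sum quotient_def vec_def by auto

lemma chart_topology: "c \<in> A \<Longrightarrow> prod_topology (subtopology longray_plus (fst c)) euclideanreal = top_of_set (fst c \<times> UNIV)"
  using chart(2)[of c] by (simp add: subtopology_longray_plus prod_topology_subtopology euclidean_product_topology flip: subtopology_Times)

lemma continuous_map_vec:
  assumes "c \<in> A"
  shows "continuous_map (top_of_set (fst c \<times> UNIV)) TB (\<lambda>(x, v). vec c x v)"
proof -
  have "continuous_map (top_of_set (fst c \<times> UNIV)) charts_sum (\<lambda>x. (c, x))"
    using continuous_map_component_injection[OF assms, of "\<lambda>c. prod_topology (subtopology longray_plus (fst c)) euclideanreal"]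
    by (simp only: chart_topology[OF assms])
  from continuous_map_compose[OF this continuous_map_quotient_projection]
  show ?thesis by (simp add: TB_eq vec_def o_def case_prod_unfold)
qed

lemma continuous_map_from_TB:
  assumes "\<And>c. c \<in> A \<Longrightarrow> continuous_map (top_of_set (fst c \<times> UNIV)) Z (\<lambda>(x, v). f (vec c x v))"
  shows "continuous_map TB Z f"
  unfolding TB_eq
proof (intro continuous_map_from_quotient continuous_map_from_sum)
  fix c assume c: "c \<in> A"
  show "continuous_map (prod_topology (subtopology longray_plus (fst c)) euclideanreal) Z
      (\<lambda>x. f (tangent_rel A `` {(c, x)}))"
    using assms[OF c] by (simp add: chart_topology[OF c] vec_def case_prod_unfold)
qed

lemma continuous_map_base: "continuous_map TB euclidean base"
proof (rule continuous_map_from_TB)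
  fix c assume c: "c \<in> A"
  have "continuous_map (top_of_set (fst c \<times> (UNIV :: real set))) euclidean fst"
    by (simp add: continuous_on_fst)
  then show "continuous_map (top_of_set (fst c \<times> UNIV)) euclidean (\<lambda>(x, v). base (vec c x v))"
    by (rule continuous_map_eq) (auto simp: base_vec[OF c])
qed

text \<open>Coordinates are continuous on the quotient because the derivatives of the transition functions are
  continuous.\<close>

lemma continuous_map_component:
  assumes c: "c \<in> A"
  shows "continuous_map (subtopology TB {\<xi>. base \<xi> \<in> fst c}) euclideanreal (component c)"
  unfolding continuous_map_def
proof (intro conjI allI impI)
  fix U :: "real set" assume "openin euclideanreal U"
  then have U: "open U" by simp
  let ?W = "{\<xi> \<in> topspace TB. base \<xi> \<in> fst c \<and> component c \<xi> \<in> U}"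
  have "openin TB ?W"
    unfolding TB_eq openin_quotient_topology openin_sum_topology
  proof (intro conjI ballI)
    fix d assume d: "d \<in> A"
    let ?D = "(fst d \<inter> fst c) \<times> (UNIV :: real set)"
    have "continuous_on ?D (\<lambda>x. jac d c (fst x) * snd x)"
      by (intro continuous_intros continuous_on_compose2[OF jac_continuous[OF d c]]) auto
    moreover have "open ?D" using chart(1)[OF d] chart(1)[OF c] by (intro open_Times open_Int) auto
    ultimately have "open ((\<lambda>x. jac d c (fst x) * snd x) -` U \<inter> ?D)"
      using U continuous_on_open_vimage by blast
    moreover have "(\<lambda>x. jac d c (fst x) * snd x) -` U \<inter> ?D \<subseteq> fst d \<times> UNIV" by blast
    ultimately have op: "openin (top_of_set (fst d \<times> UNIV)) ((\<lambda>x. jac d c (fst x) * snd x) -` U \<inter> ?D)"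
      by (simp add: openin_open_eq[OF open_Times[OF chart(1)[OF d] open_UNIV]])
    have eq: "{x. (d, x) \<in> {z \<in> topspace charts_sum. tangent_rel A `` {z} \<in>
        {\<xi> \<in> topspace (quotient_topology charts_sum (tangent_rel A)). base \<xi> \<in> fst c \<and> component c \<xi> \<in> U}}}
      = (\<lambda>x. jac d c (fst x) * snd x) -` U \<inter> ?D" (is "?L = ?R")
    proof (intro set_eqI, clarify)
      fix x v
      have "(x, v) \<in> ?L \<longleftrightarrow> x \<in> fst d \<and> vec d x v \<in> topspace TB \<and> base (vec d x v) \<in> fst c \<and> component c (vec d x v) \<in> U"
        unfolding TB_eq vec_def topspace_charts_sum using d by simp
      also have "\<dots> \<longleftrightarrow> x \<in> fst d \<and> x \<in> fst c \<and> jac d c x * v \<in> U"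
        using topspace_TB base_vec[OF d] component_vec[OF d c] d by metis
      also have "\<dots> \<longleftrightarrow> (x, v) \<in> ?R" by auto
      finally show "(x, v) \<in> ?L \<longleftrightarrow> (x, v) \<in> ?R" .
    qed
    show "openin (prod_topology (subtopology longray_plus (fst d)) euclideanreal)
       {x. (d, x) \<in> {z \<in> topspace charts_sum. tangent_rel A `` {z} \<in>
        {\<xi> \<in> topspace (quotient_topology charts_sum (tangent_rel A)). base \<xi> \<in> fst c \<and> component c \<xi> \<in> U}}}"
      unfolding eq chart_topology[OF d] by (rule op)
  qed (auto simp: topspace_quotient_topology)
  moreover have "{x \<in> topspace (subtopology TB {\<xi>. base \<xi> \<in> fst c}). component c x \<in> U} = ?W" by auto
  ultimately show "openin (subtopology TB {\<xi>. base \<xi> \<in> fst c})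
      {x \<in> topspace (subtopology TB {\<xi>. base \<xi> \<in> fst c}). component c x \<in> U}"
    unfolding openin_subtopology by (intro exI[of _ ?W]) auto
qed simp

lemma increasing_near_iff:
  "increasing_near longray_plus c x \<longleftrightarrow> (\<exists>N. open N \<and> x \<in> N \<and> N \<subseteq> fst c \<and> bot \<notin> N \<and> strict_mono_on N (snd c))"
  by (auto simp: increasing_near_def openin_longray_plus)

lemma increasing_chart_mem:
  assumes "increasing_chart a b c"
  shows "c \<in> A" "x \<in> {a<..<b} \<Longrightarrow> x \<in> fst c" "x \<in> {a<..<b} \<Longrightarrow> increasing_near longray_plus c x"
proof -
  show c: "c \<in> A" and m: "x \<in> {a<..<b} \<Longrightarrow> x \<in> fst c" for x
    using assms by (auto simp: increasing_chart_def)
  show "increasing_near longray_plus c x" if "x \<in> {a<..<b}"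
    unfolding increasing_near_iff using assms that chart(2)[OF c]
    by (intro exI[of _ "{a<..<b}"]) (auto simp: increasing_chart_def)
qed

lemma jac_increasing:
  assumes "c \<in> A" "d \<in> A" "increasing_near longray_plus c x" "increasing_near longray_plus d x"
  shows "0 < jac c d x"
proof -
  obtain N where N: "open N" "x \<in> N" "N \<subseteq> fst c" "strict_mono_on N (snd c)"
    using assms(3) unfolding increasing_near_iff by blast
  obtain M where M: "open M" "x \<in> M" "M \<subseteq> fst d" "strict_mono_on M (snd d)"
    using assms(4) unfolding increasing_near_iff by blast
  show ?thesis by (rule jac_pos[OF assms(1,2) N M])
qed

lemma topspace_PTB: "topspace PTB = positive_vectors longray_plus A"
  by (auto simp: positive_tangent_bundle_def positive_vectors_def)

lemma vec_positive_iff: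
  assumes c: "increasing_chart a b c" and x: "x \<in> {a<..<b}"
  shows "vec c x v \<in> topspace PTB \<longleftrightarrow> 0 < v"
proof
  note cA = increasing_chart_mem(1)[OF c] and xc = increasing_chart_mem(2,3)[OF c x]
  assume "0 < v"
  then show "vec c x v \<in> topspace PTB"
    unfolding topspace_PTB positive_vectors_def using topspace_TB vec_self[OF cA xc(1), of v] cA xc by blast
next
  note cA = increasing_chart_mem(1)[OF c] and xc = increasing_chart_mem(2,3)[OF c x]
  assume "vec c x v \<in> topspace PTB"
  then obtain d y w where d: "(d, y, w) \<in> vec c x v" "increasing_near longray_plus d y" "0 < w"
    unfolding topspace_PTB positive_vectors_def by blast
  then have "d \<in> A" "y = x" "w = jac c d x * v" by (simp_all add: mem_vec)
  then show "0 < v" using jac_increasing[OF cA _ xc(2), of d] d(2,3) by (simp add: zero_less_mult_iff)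
qed

lemma positive_vector_component:
  assumes c: "increasing_chart a b c" and \<xi>: "\<xi> \<in> topspace PTB" "base \<xi> \<in> {a<..<b}"
  shows "0 < component c \<xi>" "\<xi> = vec c (base \<xi>) (component c \<xi>)"
proof -
  note cA = increasing_chart_mem(1)[OF c] and xc = increasing_chart_mem(2)[OF c \<xi>(2)]
  have "\<xi> \<in> topspace TB" using \<xi>(1) by (simp add: positive_tangent_bundle_def)
  then obtain d x v where d: "d \<in> A" "x \<in> fst d" "\<xi> = vec d x v" unfolding topspace_TB by blast
  have x: "base \<xi> = x" unfolding d(3) by (rule base_vec[OF d(1,2)])
  have xc': "x \<in> fst c" using xc x by simp
  have "component c \<xi> = jac d c x * v" unfolding d(3) by (rule component_vec[OF d(1) cA d(2) xc'])
  then show eq: "\<xi> = vec c (base \<xi>) (component c \<xi>)"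
    using vec_transition[OF d(1) cA d(2) xc', of v] d(3) x by simp
  show "0 < component c \<xi>" using vec_positive_iff[OF c \<xi>(2), of "component c \<xi>"] \<xi>(1) eq by simp
qed

lemma base_PTB:
  assumes "\<xi> \<in> topspace PTB"
  shows "bot < base \<xi>"
proof -
  have "\<xi> \<in> topspace TB" using assms by (simp add: positive_tangent_bundle_def)
  then obtain c x v where c: "c \<in> A" "x \<in> fst c" "\<xi> = vec c x v" unfolding topspace_TB by blast
  then show ?thesis using base_vec[OF c(1,2)] chart(2)[OF c(1)] by (auto simp: bot.not_eq_extremum[symmetric])
qed

lemma continuous_map_vec_PTB:
  assumes c: "increasing_chart a b c"
  shows "continuous_map (top_of_set ({a<..<b} \<times> {0<..})) PTB (\<lambda>(x, v). vec c x v)"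
  unfolding positive_tangent_bundle_def continuous_map_in_subtopology
proof
  have "{a<..<b} \<times> {0<..} \<subseteq> fst c \<times> (UNIV :: real set)" using increasing_chart_mem(2)[OF c] by auto
  then show "continuous_map (top_of_set ({a<..<b} \<times> {0<..})) TB (\<lambda>(x, v). vec c x v)"
    by (rule continuous_map_from_subtopology_mono[OF continuous_map_vec[OF increasing_chart_mem(1)[OF c]]])
  show "(\<lambda>(x, v). vec c x v) \<in> topspace (top_of_set ({a<..<b} \<times> {0<..})) \<rightarrow> positive_vectors longray_plus A"
    using vec_positive_iff[OF c] unfolding topspace_PTB by auto
qed

lemma continuous_map_base_PTB: "continuous_map PTB euclidean base"
  unfolding positive_tangent_bundle_def by (rule continuous_map_from_subtopology[OF continuous_map_base])

lemma continuous_map_component_PTB: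
  assumes c: "increasing_chart a b c"
  shows "continuous_map (subtopology PTB {\<xi>. base \<xi> \<in> {a<..<b}}) euclideanreal (component c)"
proof -
  have "continuous_map (subtopology TB (positive_vectors longray_plus A \<inter> {\<xi>. base \<xi> \<in> {a<..<b}})) euclideanreal (component c)"
    by (rule continuous_map_from_subtopology_mono[OF continuous_map_component[OF increasing_chart_mem(1)[OF c]]])
      (use increasing_chart_mem(2)[OF c] in auto)
  then show ?thesis by (simp add: positive_tangent_bundle_def subtopology_subtopology)
qed

end

section \<open>Contractible parts of the positive tangent bundle\<close>

text \<open>Pasting along a level of a function with values in a linear order.\<close>

lemma continuous_map_split_at:
  fixes y :: "'a :: linorder_topology"
  assumes h: "continuous_map Z euclidean h"
    and f: "continuous_map (subtopology Z {w \<in> topspace Z. h w \<in> {..y}}) T f"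
    and g: "continuous_map (subtopology Z {w \<in> topspace Z. h w \<in> {y..}}) T g"
    and eq: "\<And>w. w \<in> topspace Z \<Longrightarrow> h w = y \<Longrightarrow> f w = g w"
  shows "continuous_map Z T (\<lambda>w. if h w \<le> y then f w else g w)"
proof -
  let ?A = "{w \<in> topspace Z. h w \<in> {..y}}" and ?B = "{w \<in> topspace Z. h w \<in> {y..}}"
  have A: "closedin Z ?A" and B: "closedin Z ?B"
    by (rule closedin_continuous_map_preimage[OF h], simp)+
  show ?thesis
    unfolding continuous_map_closedin
  proof (intro conjI allI impI)
    have "f w \<in> topspace T" if "w \<in> topspace Z" "h w \<le> y" for w
      using continuous_map_image_subset_topspace[OF f] that by auto
    moreover have "g w \<in> topspace T" if "w \<in> topspace Z" "\<not> h w \<le> y" for w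
      using continuous_map_image_subset_topspace[OF g] that by auto
    ultimately show "(\<lambda>w. if h w \<le> y then f w else g w) \<in> topspace Z \<rightarrow> topspace T" by simp
    fix S assume S: "closedin T S"
    have "closedin Z {w \<in> topspace (subtopology Z ?A). f w \<in> S}"
      by (rule closedin_trans_full[OF closedin_continuous_map_preimage[OF f S] A])
    moreover have "closedin Z {w \<in> topspace (subtopology Z ?B). g w \<in> S}"
      by (rule closedin_trans_full[OF closedin_continuous_map_preimage[OF g S] B])
    moreover have "{w \<in> topspace Z. (if h w \<le> y then f w else g w) \<in> S} =
        {w \<in> topspace (subtopology Z ?A). f w \<in> S} \<union> {w \<in> topspace (subtopology Z ?B). g w \<in> S}"
    proof (rule set_eqI)
      fix w
      consider "h w < y" | "h w = y" | "y < h w" by (rule linorder_cases)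
      then show "w \<in> {w \<in> topspace Z. (if h w \<le> y then f w else g w) \<in> S} \<longleftrightarrow>
          w \<in> {w \<in> topspace (subtopology Z ?A). f w \<in> S} \<union> {w \<in> topspace (subtopology Z ?B). g w \<in> S}"
        by cases (use eq[of w] in auto)
    qed
    ultimately show "closedin Z {w \<in> topspace Z. (if h w \<le> y then f w else g w) \<in> S}"
      by (simp only: closedin_Un)
  qed
qed

context smooth_longray
begin

definition band :: "longray \<Rightarrow> longray \<Rightarrow> tangent topology" where
  "band x y = subtopology PTB {\<xi>. base \<xi> \<in> {x..y}}"

lemma topspace_band: "\<xi> \<in> topspace (band x y) \<longleftrightarrow> \<xi> \<in> topspace PTB \<and> base \<xi> \<in> {x..y}"
  by (simp add: band_def)

lemma continuous_map_base_band: "continuous_map (band x y) euclidean base"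
  unfolding band_def by (rule continuous_map_from_subtopology[OF continuous_map_base_PTB])

lemma continuous_map_vec_compose:
  assumes c: "increasing_chart a b c"
    and f: "continuous_map Z euclidean f" and g: "continuous_map Z euclideanreal g"
    and mem: "\<And>w. w \<in> topspace Z \<Longrightarrow> f w \<in> {a<..<b} \<and> 0 < g w"
  shows "continuous_map Z PTB (\<lambda>w. vec c (f w) (g w))"
proof -
  have "continuous_map Z (prod_topology euclidean euclidean) (\<lambda>w. (f w, g w))"
    using f g by (simp only: continuous_map_paired simp_thms)
  then have "continuous_map Z (top_of_set ({a<..<b} \<times> {0<..})) (\<lambda>w. (f w, g w))"
    using mem by (auto simp: continuous_map_in_subtopology euclidean_product_topology)
  from continuous_map_compose[OF this continuous_map_vec_PTB[OF c]]
  show ?thesis by (simp add: o_def)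
qed

text \<open>The fibre is a half-line; its contraction moves coordinates linearly to 1.\<close>

lemma fiber_contractible:
  assumes "bot < x"
  shows "contractible_space (band x x)"
proof -
  obtain a b c where c: "increasing_chart a b c" "a < x" "x < b" by (rule increasing_chart_exists[OF assms]) (rule that)
  have x: "x \<in> {a<..<b}" using c by simp
  let ?Z = "prod_topology (top_of_set {0..1::real}) (band x x)"
  have comp: "continuous_map (band x x) euclideanreal (component c)"
    unfolding band_def
    by (rule continuous_map_from_subtopology_mono[OF continuous_map_component_PTB[OF c(1)]]) (use x in auto)
  have comp': "continuous_map ?Z euclideanreal (\<lambda>w. component c (snd w))"
    using continuous_map_compose[OF continuous_map_snd comp] by (simp add: o_def)
  have fst: "continuous_map ?Z euclideanreal fst"
    by (rule continuous_map_into_fulltopology[OF continuous_map_fst])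
  have pt: "0 < component c \<xi>" "\<xi> = vec c x (component c \<xi>)" if "\<xi> \<in> topspace (band x x)" for \<xi>
    using positive_vector_component[OF c(1), of \<xi>] that x by (auto simp: topspace_band)
  define h where "h w = vec c x ((1 - fst w) * component c (snd w) + fst w)" for w :: "real \<times> tangent"
  have pos: "0 < (1 - t) * v + t" if "0 \<le> t" "t \<le> 1" "0 < v" for t v :: real
    using that by (cases "t = 0") (auto intro: add_nonneg_pos)
  have "continuous_map ?Z PTB h"
    unfolding h_def
  proof (rule continuous_map_vec_compose[OF c(1)])
    show "x \<in> {a<..<b} \<and> 0 < (1 - fst w) * component c (snd w) + fst w" if "w \<in> topspace ?Z" for w
      using that x pos[of "fst w" "component c (snd w)"] pt(1)[of "snd w"] by (auto simp: mem_Times_iff)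
  qed (intro continuous_intros fst comp', simp)+
  moreover have "base (h w) = x" for w
    unfolding h_def by (rule base_vec) (use increasing_chart_mem[OF c(1)] x in auto)
  ultimately have "continuous_map ?Z (band x x) h"
    unfolding band_def by (auto simp: continuous_map_in_subtopology)
  then have "homotopic_with (\<lambda>_. True) (band x x) (band x x) id (\<lambda>_. vec c x 1)"
    by (subst homotopic_with) (auto intro!: exI[of _ h] simp: h_def pt(2)[symmetric])
  then show ?thesis unfolding contractible_space_def by blast
qed

text \<open>When \<open>[y, z]\<close> lies in one chart, the part over \<open>[y, z]\<close> is pushed down to the fibre over \<open>y\<close> by moving the base point linearly in
  the chart and keeping the coordinate of the vector.\<close>

lemma band_retraction:
  assumes x: "x \<le> y" "y \<le> z" and c: "increasing_chart a b c" "a < y" "z < b"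
  shows "band x z homotopy_equivalent_space band x y"
proof -
  note cA = increasing_chart_mem(1)[OF c(1)] and cm = increasing_chart_mem(2)[OF c(1)]
  have sub: "{y..z} \<subseteq> {a<..<b}" using less_le_trans[OF c(2)] le_less_trans[OF _ c(3)] by auto
  have cont: "continuous_on {y..z} (snd c)"
    by (rule continuous_on_subset[OF chart(5)[OF cA]]) (use sub cm in blast)
  \<comment> \<open>The straight path in the chart from \<open>w\<close> to \<open>y\<close>, and the path \<open>\<psi>\<close> of base points that it describes.\<close>
  define s where "s t w = (1 - t) * snd c w + t * snd c y" for t w
  define \<psi> where "\<psi> t w = inv_into (fst c) (snd c) (s t w)" for t w
  have mono: "snd c y \<le> snd c w" if "w \<in> {y..z}" for w
  proof (cases "w = y")
    case False
    have "strict_mono_on {a<..<b} (snd c)" using c(1) by (simp add: increasing_chart_def)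
    then have "snd c y < snd c w" by (rule strict_mono_onD) (use that False sub x in auto)
    then show ?thesis by simp
  qed simp
  have \<psi>: "\<psi> t w \<in> {y..z}" "s t w \<in> snd c ` fst c" "\<psi> 0 w = w" "\<psi> 1 w = y"
    if t: "t \<in> {0..1}" and w: "w \<in> {y..z}" for t w
  proof -
    have le: "snd c y \<le> s t w" "s t w \<le> snd c w"
    proof -
      have "s t w = snd c y + (1 - t) * (snd c w - snd c y)" "s t w = snd c w - t * (snd c w - snd c y)"
        by (simp_all add: s_def algebra_simps)
      moreover have "0 \<le> (1 - t) * (snd c w - snd c y)" "0 \<le> t * (snd c w - snd c y)"
        using mono[OF w] t by simp_all
      ultimately show "snd c y \<le> s t w" "s t w \<le> snd c w" by linarith+
    qed
    have "{y..w} \<subseteq> {y..z}" using w by auto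
    from continuous_on_subset[OF cont this] obtain v where v: "y \<le> v" "v \<le> w" "snd c v = s t w"
      using IVT'[of "snd c" y "s t w" w] le w by auto
    have vz: "v \<in> {y..z}" using v w by auto
    have vc: "v \<in> fst c" using vz sub cm by blast
    have "\<psi> t w = v" unfolding \<psi>_def v(3)[symmetric] by (rule inv_into_f_f[OF chart(4)[OF cA] vc])
    then show "\<psi> t w \<in> {y..z}" using vz by simp
    show "s t w \<in> snd c ` fst c" unfolding v(3)[symmetric] using vc by (rule imageI)
    have "w \<in> fst c" "y \<in> fst c" using w sub cm x by auto
    then show "\<psi> 0 w = w" "\<psi> 1 w = y" using chart(4)[OF cA] by (simp_all add: \<psi>_def s_def)
  qed
  let ?X = "band x z" and ?W = "band x y"
  let ?Z = "prod_topology (top_of_set {0..1::real}) ?X"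
  define h where "h p = (if base (snd p) \<le> y then snd p else vec c (\<psi> (fst p) (base (snd p))) (component c (snd p)))"
    for p :: "real \<times> tangent"
  have Zmem: "fst p \<in> {0..1}" "snd p \<in> topspace PTB" "base (snd p) \<in> {x..z}" if "p \<in> topspace ?Z" for p
    using that by (auto simp: topspace_band)
  have cb: "continuous_map ?Z euclidean (\<lambda>p. base (snd p))"
    using continuous_map_compose[OF continuous_map_snd continuous_map_base_band] by (simp add: o_def)
  have csnd: "continuous_map ?Z PTB snd"
    using continuous_map_snd by (rule continuous_map_into_fulltopology[of ?Z PTB "{\<xi>. base \<xi> \<in> {x..z}}" snd, folded band_def])
  let ?B = "subtopology ?Z {p \<in> topspace ?Z. base (snd p) \<in> {y..}}"
  have Bmem: "p \<in> topspace ?Z" "base (snd p) \<in> {y..z}" "base (snd p) \<in> {a<..<b}" if "p \<in> topspace ?B" for p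
  proof -
    show p: "p \<in> topspace ?Z" and "base (snd p) \<in> {y..z}" using that Zmem(3)[of p] by auto
    then show "base (snd p) \<in> {a<..<b}" using sub by blast
  qed
  have "continuous_map ?Z PTB h"
    unfolding h_def
  proof (rule continuous_map_split_at[OF cb])
    show "continuous_map (subtopology ?Z {w \<in> topspace ?Z. base (snd w) \<in> {..y}}) PTB snd"
      by (rule continuous_map_from_subtopology[OF csnd])
    show "snd w = vec c (\<psi> (fst w) (base (snd w))) (component c (snd w))"
      if w: "w \<in> topspace ?Z" "base (snd w) = y" for w
    proof -
      have "s (fst w) y = snd c y" by (simp add: s_def algebra_simps)
      moreover have "y \<in> fst c" using cm[of y] sub x by auto
      ultimately have "\<psi> (fst w) y = y" using chart(4)[OF cA] by (simp add: \<psi>_def)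
      moreover have "base (snd w) \<in> {a<..<b}" using w(2) sub x by auto
      ultimately show ?thesis using positive_vector_component(2)[OF c(1) Zmem(2)[OF w(1)]] w(2) by simp
    qed
    show "continuous_map ?B PTB (\<lambda>w. vec c (\<psi> (fst w) (base (snd w))) (component c (snd w)))"
    proof (rule continuous_map_vec_compose[OF c(1)])
      have cb': "continuous_map ?B (top_of_set {y..z}) (\<lambda>w. base (snd w))"
        unfolding continuous_map_in_subtopology using continuous_map_from_subtopology[OF cb] Bmem(2) by blast
      have cfst: "continuous_map ?B euclideanreal fst"
        by (rule continuous_map_from_subtopology[OF continuous_map_into_fulltopology[OF continuous_map_fst]])
      have "continuous_map (top_of_set {y..z}) euclideanreal (snd c)" using cont by simp
      from continuous_map_compose[OF cb' this]
      have "continuous_map ?B euclideanreal (\<lambda>w. snd c (base (snd w)))" by (simp add: o_def)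
      then have "continuous_map ?B euclideanreal (\<lambda>w. s (fst w) (base (snd w)))"
        unfolding s_def by (intro continuous_intros cfst) simp_all
      then have cs: "continuous_map ?B (top_of_set (snd c ` fst c)) (\<lambda>w. s (fst w) (base (snd w)))"
        unfolding continuous_map_in_subtopology using \<psi>(2) Zmem(1) Bmem by blast
      have "continuous_map (top_of_set (snd c ` fst c)) euclidean (inv_into (fst c) (snd c))"
        using chart(6)[OF cA] by simp
      from continuous_map_compose[OF cs this]
      show "continuous_map ?B euclidean (\<lambda>w. \<psi> (fst w) (base (snd w)))" by (simp add: \<psi>_def o_def)
      have "continuous_map ?B (subtopology PTB {\<xi>. base \<xi> \<in> {a<..<b}}) snd"
        unfolding continuous_map_in_subtopology
        using continuous_map_from_subtopology[OF csnd] Bmem(3) by blast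
      from continuous_map_compose[OF this continuous_map_component_PTB[OF c(1)]]
      show "continuous_map ?B euclideanreal (\<lambda>w. component c (snd w))" by (simp add: o_def)
      show "\<psi> (fst w) (base (snd w)) \<in> {a<..<b} \<and> 0 < component c (snd w)" if "w \<in> topspace ?B" for w
        using \<psi>(1)[OF Zmem(1)[OF Bmem(1)[OF that]] Bmem(2)[OF that]] sub
          positive_vector_component(1)[OF c(1) Zmem(2)[OF Bmem(1)[OF that]] Bmem(3)[OF that]] by blast
    qed
  qed
  have hbase: "base (h p) \<in> {x..z}" "fst p = 0 \<Longrightarrow> h p = snd p" "fst p = 1 \<Longrightarrow> base (h p) \<in> {x..y}"
    if p: "p \<in> topspace ?Z" for p
  proof -
    note m = Zmem[OF p]
    have "base (h p) \<in> {x..z} \<and> (fst p = 0 \<longrightarrow> h p = snd p) \<and> (fst p = 1 \<longrightarrow> base (h p) \<in> {x..y})"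
    proof (cases "base (snd p) \<le> y")
      case True
      then show ?thesis using m(3) by (simp add: h_def)
    next
      case False
      then have yz: "base (snd p) \<in> {y..z}" using m(3) by auto
      note q = \<psi>[OF m(1) yz]
      have "\<psi> (fst p) (base (snd p)) \<in> fst c" using q(1) sub cm by blast
      then have b: "base (h p) = \<psi> (fst p) (base (snd p))" using False by (simp add: h_def base_vec[OF cA])
      have "h p = snd p" if "fst p = 0"
        using False that q(3) positive_vector_component(2)[OF c(1) m(2)] yz sub by (auto simp: h_def)
      moreover have "base (h p) \<in> {x..z}" unfolding b using q(1) x(1) by auto
      moreover have "base (h p) \<in> {x..y}" if "fst p = 1" unfolding b that q(4) using x by simp
      ultimately show ?thesis by blast
    qed
    then show "base (h p) \<in> {x..z}" "fst p = 0 \<Longrightarrow> h p = snd p" "fst p = 1 \<Longrightarrow> base (h p) \<in> {x..y}" by blast+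
  qed
  have ch: "continuous_map ?Z ?X h"
    unfolding band_def continuous_map_in_subtopology
    using \<open>continuous_map ?Z PTB h\<close> hbase(1) unfolding band_def by blast
  define r where "r \<xi> = h (1, \<xi>)" for \<xi>
  have hom: "homotopic_with (\<lambda>_. True) ?X ?X id r"
    by (subst homotopic_with) (use ch hbase(2) in \<open>auto intro!: exI[of _ h] simp: r_def\<close>)
  have "continuous_map ?X ?X r" using homotopic_with_imp_continuous_maps[OF hom] by blast
  then have "continuous_map ?X PTB r" unfolding band_def[of x z] by (rule continuous_map_into_fulltopology)
  then have r: "continuous_map ?X ?W r"
    unfolding band_def[of x y] continuous_map_in_subtopology using hbase(3) by (auto simp: r_def)
  have "continuous_map ?W ?X id"
    unfolding band_def by (rule continuous_map_from_subtopology_mono[of _ "{\<xi>. base \<xi> \<in> {x..z}}"])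
      (use x in \<open>auto simp: continuous_map_in_subtopology\<close>)
  moreover have "r \<xi> = \<xi>" if "\<xi> \<in> topspace ?W" for \<xi>
    using that by (simp add: topspace_band r_def h_def)
  ultimately have "retraction_maps ?X ?W r id" using r by (simp add: retraction_maps_def)
  moreover have "homotopic_with (\<lambda>_. True) ?X ?X r id" using hom by (simp add: homotopic_with_sym)
  ultimately show ?thesis by (intro deformation_retract_imp_homotopy_equivalent_space)
qed

text \<open>Whether the part over \<open>[x, z]\<close> is contractible does not change as \<open>z\<close> moves within a chart, and
  \<open>[x, y]\<close> is connected.\<close>

lemma band_contractible:
  assumes "bot < x" "x \<le> y"
  shows "contractible_space (band x y)"
proof (rule connected_induction_simple[of "{x..y}" x y "\<lambda>z. contractible_space (band x z)"])
  fix w assume w: "w \<in> {x..y}"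
  then have "bot < w" using assms(1) by auto
  then obtain a b c where c: "increasing_chart a b c" "a < w" "w < b" by (rule increasing_chart_exists) (rule that)
  have "contractible_space (band x u) \<longleftrightarrow> contractible_space (band x v)"
    if "u \<in> {x..y} \<inter> {a<..<b}" "v \<in> {x..y} \<inter> {a<..<b}" "u \<le> v" for u v
    using homotopy_equivalent_space_contractibility[OF band_retraction[of x u v a b c]] that c(1) by auto
  then have "\<forall>u\<in>{x..y} \<inter> {a<..<b}. \<forall>v\<in>{x..y} \<inter> {a<..<b}.
      contractible_space (band x u) \<longrightarrow> contractible_space (band x v)"
    by (meson linear)
  moreover have "openin (top_of_set {x..y}) ({x..y} \<inter> {a<..<b})" by (rule openin_open_Int) simp
  ultimately show "\<exists>T. openin (top_of_set {x..y}) T \<and> w \<in> T \<and>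
      (\<forall>u\<in>T. \<forall>v\<in>T. contractible_space (band x u) \<longrightarrow> contractible_space (band x v))"
    using w c(2,3) by (intro exI[of _ "{x..y} \<inter> {a<..<b}"]) simp
qed (use assms in \<open>simp_all add: fiber_contractible connected_Icc\<close>)

lemma compact_subset_contractible:
  assumes K: "compactin PTB K"
  shows "\<exists>Q. K \<subseteq> Q \<and> contractible_space (subtopology PTB Q)"
proof (cases "K = {}")
  case True
  then show ?thesis by (intro exI[of _ "{}"]) simp
next
  case False
  have "compact (base ` K)"
    using image_compactin[OF K continuous_map_base_PTB] by (simp add: compactin_euclidean_iff)
  then obtain x y where xy: "x \<in> base ` K" "\<And>z. z \<in> base ` K \<Longrightarrow> x \<le> z" "\<And>z. z \<in> base ` K \<Longrightarrow> z \<le> y"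
    using compact_attains_inf[of "base ` K"] compact_attains_sup[of "base ` K"] False by blast
  have "bot < x" using xy(1) base_PTB compactin_subset_topspace[OF K] by blast
  moreover have "x \<le> y" using xy by blast
  ultimately have "contractible_space (band x y)" by (rule band_contractible)
  then show ?thesis using xy(2,3) by (intro exI[of _ "{\<xi>. base \<xi> \<in> {x..y}}"]) (auto simp: band_def)
qed

end

section \<open>Homotopy type of the positive tangent bundle\<close>

context smooth_longray
begin

text \<open>The base point of a contraction would be a homotopy from the projection to a constant map.\<close>

theorem positive_tangent_bundle_not_contractible: "\<not> contractible_space PTB"
proof
  assume "contractible_space PTB"
  then obtain \<xi>0 where "homotopic_with (\<lambda>_. True) PTB PTB id (\<lambda>_. \<xi>0)"
    unfolding contractible_space_def by blast
  then obtain h where h: "continuous_map (prod_topology (top_of_set {0..1::real}) PTB) PTB h"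
    "\<And>\<xi>. h (0, \<xi>) = \<xi>" "\<And>\<xi>. h (1, \<xi>) = \<xi>0"
    unfolding homotopic_with_def by auto
  have bh: "continuous_map (prod_topology (top_of_set {0..1::real}) PTB) euclidean (\<lambda>w. base (h w))"
    using continuous_map_compose[OF h(1) continuous_map_base_PTB] by (simp add: o_def)
  define R where "R x = (\<lambda>(a, b, c). increasing_chart a b c \<and> a < x \<and> x < b)" for x
  define \<sigma> where "\<sigma> x = (SOME r. R x r)" for x
  have R\<sigma>: "R x (\<sigma> x)" if "bot < x" for x
  proof -
    have "\<exists>r. R x r" by (rule increasing_chart_exists[OF that]) (auto simp: R_def)
    then show ?thesis unfolding \<sigma>_def by (rule someI_ex)
  qed
  define a where "a x = fst (\<sigma> x)" for x
  define b where "b x = fst (snd (\<sigma> x))" for x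
  define c where "c x = snd (snd (\<sigma> x))" for x
  have ch: "increasing_chart (a x) (b x) (c x)" "a x < x" "x < b x" if "bot < x" for x
    using R\<sigma>[OF that] by (simp_all add: R_def case_prod_unfold a_def b_def c_def)
  have cA: "c x \<in> A" if "bot < x" for x by (rule increasing_chart_mem(1)[OF ch(1)[OF that]])
  have cm: "y \<in> fst (c x)" "increasing_near longray_plus (c x) y" if "bot < x" "y \<in> {a x<..<b x}" for x y
    using increasing_chart_mem(2,3)[OF ch(1)[OF that(1)] that(2)] .
  have is_bundle: "longray_line_bundle a b (\<lambda>x. vec (c x)) (\<lambda>x x'. jac (c x') (c x))"
  proof
    fix x x' x'' y :: longray and v :: real
    show "a x < x" "x < b x" if "bot < x" using ch[OF that] by simp_all
    show "continuous_on ({a x<..<b x} \<inter> {a x'<..<b x'}) (jac (c x') (c x))" if "bot < x" "bot < x'"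
      by (rule continuous_on_subset[OF jac_continuous[OF cA[OF that(2)] cA[OF that(1)]]]) (use cm(1) that in blast)
    assume x: "bot < x" "bot < x'" and y: "y \<in> {a x<..<b x}" "y \<in> {a x'<..<b x'}"
    note mx = cA[OF x(1)] cm[OF x(1) y(1)] and mx' = cA[OF x(2)] cm[OF x(2) y(2)]
    show "vec (c x') y v = vec (c x) y (jac (c x') (c x) y * v)"
      by (rule vec_transition[OF mx'(1) mx(1) mx'(2) mx(2)])
    show "0 < jac (c x') (c x) y" by (rule jac_increasing[OF mx'(1) mx(1) mx'(3) mx(3)])
    show "jac (c x'') (c x) y = jac (c x') (c x) y * jac (c x'') (c x') y"
      if "bot < x''" "y \<in> {a x''<..<b x''}"
      by (rule jac_cocycle[OF cA[OF that(1)] mx'(1) mx(1) cm(1)[OF that] mx'(2) mx(2)])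
  qed
  have vec_mem: "vec (c x) x v \<in> topspace PTB" if "bot < x" "0 < v" for x v
    using vec_positive_iff[OF ch(1)[OF that(1)], of x v] ch(2,3)[OF that(1)] that(2) by simp
  show False
  proof (rule longray_line_bundle.projection_not_null_homotopic[OF is_bundle,
        where G = "\<lambda>t \<xi>. base (h (t, \<xi>))" and q = "base \<xi>0"])
    fix x :: longray and v :: real assume x: "bot < x" and v: "0 < v"
    have "continuous_map (top_of_set {0..1}) (prod_topology (top_of_set {0..1::real}) PTB) (\<lambda>t. (t, vec (c x) x v))"
      using vec_mem[OF x v] by (simp add: continuous_map_pairwise o_def)
    from continuous_map_compose[OF this bh]
    show "continuous_on {0..1} (\<lambda>t. base (h (t, vec (c x) x v)))" by (simp add: o_def)
    show "base (h (0, vec (c x) x v)) = x"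
      unfolding h(2) by (rule base_vec[OF cA[OF x] cm(1)[OF x]]) (use ch(2,3)[OF x] in simp)
    show "base (h (1, vec (c x) x v)) = base \<xi>0" by (simp add: h(3))
  next
    fix t :: real and x :: longray assume t: "t \<in> {0..1}" and x: "bot < x"
    have "continuous_map (top_of_set ({a x<..<b x} \<times> {0<..})) (prod_topology (top_of_set {0..1::real}) PTB)
        (\<lambda>w. (t, (\<lambda>(y, v). vec (c x) y v) w))"
      using continuous_map_vec_PTB[OF ch(1)[OF x]] t by (simp add: continuous_map_paired)
    from continuous_map_compose[OF this bh]
    show "continuous_on ({a x<..<b x} \<times> {0<..}) (\<lambda>(y, v). base (h (t, vec (c x) y v)))"
      by (simp add: o_def case_prod_unfold)
  qed
qed

text \<open>A homotopy equivalence with a CW-complex would factor the identity, up to homotopy, through a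
  null-homotopic map.\<close>

theorem positive_tangent_bundle_not_CW:
  assumes Y: "CW_complex Y"
  shows "\<not> PTB homotopy_equivalent_space Y"
proof
  assume "PTB homotopy_equivalent_space Y"
  then obtain f k where f: "continuous_map PTB Y f" and k: "continuous_map Y PTB k"
    and kf: "homotopic_with (\<lambda>_. True) PTB PTB (k \<circ> f) id"
    unfolding homotopy_equivalent_space_def by blast
  have "topspace PTB \<noteq> {}"
  proof
    assume "topspace PTB = {}"
    then have "contractible_space PTB" using null_topspace_iff_trivial contractible_space_empty by metis
    then show False using positive_tangent_bundle_not_contractible by simp
  qed
  then obtain \<xi> where \<xi>: "\<xi> \<in> topspace PTB" by blast
  have "homotopic_with (\<lambda>_. True) Y PTB k (\<lambda>_. \<xi>)"
    by (rule CW_complex_null_homotopic[OF Y compact_subset_contractible k \<xi>])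
  then have "homotopic_with (\<lambda>_. True) PTB PTB (k \<circ> f) ((\<lambda>_. \<xi>) \<circ> f)"
    by (rule homotopic_with_compose_continuous_map_right[OF _ f]) simp
  with kf have "homotopic_with (\<lambda>_. True) PTB PTB id ((\<lambda>_. \<xi>) \<circ> f)"
    using homotopic_with_sym homotopic_with_trans by blast
  then have "contractible_space PTB" unfolding contractible_space_def by (auto simp: o_def)
  then show False using positive_tangent_bundle_not_contractible by simp
qed

end

theorem theorem1p6:
  fixes A :: "longray chart set"
  assumes "smooth_structure longray_plus A"
  shows "\<not> contractible_space (positive_tangent_bundle longray_plus A) \<and>
    \<not> (\<exists>Y :: 'b topology. CW_complex Y \<and>
          positive_tangent_bundle longray_plus A homotopy_equivalent_space Y)"
proof -
  interpret smooth_longray A by (rule smooth_longray.intro[OF assms])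
  show ?thesis
    using positive_tangent_bundle_not_contractible positive_tangent_bundle_not_CW by blast
qed

end
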